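(* Consider a sequence of generalized linear variable selection problems indexed by the sample size $n$, as set up in the context, with $p_n$ covariates, model size bound $q_n$, true parameter $\beta_0(n)$ with support $J_0(n)$, $|J_0(n)|\le q_n$, and signal strength $\beta_{\min}(n)=\min_{j\in J_0(n)}|(\beta_0(n))_j|$. Suppose that $p_n=n^\kappa$ for $\kappa>0$, that $q_n=n^\psi$ for $0\le\psi<1/3$, that $\beta_{\min}(n)=n^{-\phi/2}$ for $0\le\phi<1-\psi$, and that $\kappa>\psi$. Assume that there are a fixed constant $a_0\in(0,\infty)$, a fixed decreasing function $c_{\mathrm{lower}}:[0,\infty)\to(0,\infty)$, a fixed increasing function $c_{\mathrm{upper}}:[0,\infty)\to(0,\infty)$ and a fixed constant $c_{\mathrm{change}}\in(0,\infty)$ (none depending on $n$) such that for every $n$: $\|\beta_0(n)\|_2\le a_0$, and for all $J\subset[p_n]$ with $J\supseteq J_0(n)$ and $|J|\le 2q_n$ and all $\beta,\beta'\in\mathbb{R}^J$, $$c_{\mathrm{lower}}(\|\beta\|_2)\,\mathbf{I}_J\preceq\tfrac1n H_J(\beta)\preceq c_{\mathrm{upper}}(\|\beta\|_2)\,\mathbf{I}_J,\qquad \tfrac1n\|H_J(\beta)-H_J(\beta')\|_{\mathrm{sp}}\le c_{\mathrm{change}}\cdot\|\beta-\beta'\|_2 .$$ Moreover, assume that for the considered family of prior densities $\{f_J:J\subset[p_n],|J|\le q_n\}$ there are constants $F_3,F_4\in(0,\infty)$ such that, uniformly for all $|J|\le q_n$ (and all $n$), $$\sup_{\beta}f_J(\beta)\le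 F_3<\infty,\qquad \inf_{\|\beta\|_2\le a_{\mathrm{MLE}}}f_J(\beta)\ge F_4>0,$$ where $a_{\mathrm{MLE}}$ is the constant described in the context. Then, for any $\gamma\ge 0$ with $\gamma>1-\frac{1-2\psi}{2(\kappa-\psi)}$, model selection with $\mathrm{Laplace}_\gamma$ is consistent in the sense that the event $$J_0(n)=\arg\max\{\mathrm{Laplace}_\gamma(J):J\subset[p_n],|J|\le q_n\}$$ has probability tending to one as $n\to\infty$.
   Context: Model (for sample size $n$, $p=p_n$ covariates, model size bound $q=q_n$, true parameter $\beta_0=\beta_0(n)$, support $J_0=J_0(n)$; $n^\kappa$ and $n^\psi$ are understood as rounded to integers). $X\in\mathbb{R}^{n\times p}$ is a deterministic design matrix (which may depend on $n$) with $i$th row $X_i$ (viewed as a vector in $\mathbb{R}^p$). The responses $Y_1,\dots,Y_n$ are independent real random variables, $Y_i\sim p_{\theta_i}$, where $\{p_\theta:\theta\in\mathbb{R}\}$ is a univariate exponential family with densities $p_\theta(y)\propto\exp\{y\theta-\mathrm{b}(\theta)\}$ with respect to some measure on $\mathbb{R}$; the natural parameter space is all of $\mathbb{R}$ and $\mathrm{b}$ is the log-partition (cumulant) function. The true parameters are $\theta_i=X_i^T\beta_0$ for a vector $\beta_0\in\mathbb{R}^p$ with support $J_0\subset[p]:=\{1,\dots,p\}$ (i.e. $\beta_{0j}\ne0$ iff $j\in J_0$), and $|J_0|\le q$. The log-likelihood and its negative Hessian are, for $\beta\in\mathbb{R}^p$, $$\log L(\beta)=\sum_{i=1}^n \left(Y_i\cdot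 X_i^T\beta-\mathrm{b}(X_i^T\beta)\right),\qquad H(\beta)=\sum_{i=1}^n X_iX_i^T\,\mathrm{b}''(X_i^T\beta)\in\mathbb{R}^{p\times p}.$$ Submodels. A set $J\subset[p]$ is identified with the regression model using only the covariates in $J$. $\mathbb{R}^J$ is the space of vectors $(\beta_j:j\in J)$; a vector in $\mathbb{R}^J$ is identified with the vector in $\mathbb{R}^p$ obtained by filling in zeros outside $J$. $H_J(\beta)$ is the submatrix of $H(\beta)$ with rows and columns indexed by $J$, and $\mathbf{I}_J$ is the identity matrix of that size. $\hat\beta_J$ denotes the maximum likelihood estimator in model $J$, i.e. the maximizer of $L$ over $\mathbb{R}^J$; an assertion about $\hat\beta_J$ is understood to include its existence. $\preceq$ is the positive semidefinite order and $\|\cdot\|_{\mathrm{sp}}$ is the spectral norm. For each $J\subset[p]$ with $|J|\le q$, $f_J:\mathbb{R}^J\to[0,\infty)$ is a probability density function. Criterion. For $J\subset[p]$ with $|J|\le q$ and $\gamma\ge0$, $$\mathrm{Laplace}(J):=L(\hat\beta_J)f_J(\hat\beta_J)\left(\frac{(2\pi)^{|J|}}{\det H_J(\hat\beta_J)}\right)^{1/2},\qquad \mathrm{Laplace}_\gamma(J):=\binom{p}{|J|}^{-\gamma}\mathrm{Laplace}(J).$$ The constant $a_{\mathrm{MLE}}$. It is the constant in the following uniform bound on MLEs: there are constants $\nu,c_{\mathrm{sample}},a_{\mathrm{MLE}}\in(0,\infty)$, depending only on $(a_0,c_{\mathrm{lower}},c_{\mathrm{upper}},c_{\mathrm{change}})$,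 such that for every generalized linear regression problem with deterministic design matrix $X\in\mathbb{R}^{n\times p}$ with rows $X_i$, independent responses $Y_i\sim p_{\theta_i}$, $i=1,\dots,n$, from a univariate exponential family with densities $p_\theta(y)\propto\exp\{y\theta-\mathrm{b}(\theta)\}$, $\theta\in\mathbb{R}$, natural parameters $\theta_i=X_i^T\beta_0$, true parameter $\beta_0\in\mathbb{R}^p$ whose support $J_0$ satisfies $|J_0|\le q$, log-likelihood $\log L(\beta)=\sum_{i=1}^n(Y_i\cdot X_i^T\beta-\mathrm{b}(X_i^T\beta))$ and negative Hessian $H(\beta)=\sum_{i=1}^n X_iX_i^T\,\mathrm{b}''(X_i^T\beta)$ (with any $n,p,q$) which satisfies $\|\beta_0\|_2\le a_0$ and, for all $J\subset[p]$ with $|J|\le2q$ and all $\beta,\beta'\in\mathbb{R}^J$, $c_{\mathrm{lower}}(\|\beta\|_2)\mathbf{I}_J\preceq\frac1nH_J(\beta)\preceq c_{\mathrm{upper}}(\|\beta\|_2)\mathbf{I}_J$ and $\frac1n\|H_J(\beta)-H_J(\beta')\|_{\mathrm{sp}}\le c_{\mathrm{change}}\|\beta-\beta'\|_2$, if $n\ge c_{\mathrm{sample}}\,q^3\max\{\log(p),\log^3(n)\}$, then with probability at least $1-p^{-\nu}$ one has $\|\hat\beta_J\|_2\le a_{\mathrm{MLE}}$ for all $J\subset[p]$ with $|J|\le q$. Such a triple of constants is fixed. *)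

theory Defs
  imports "HOL-Probability.Probability" "Jordan_Normal_Form.Determinant"
begin

text \<open>The numbers of observations and covariates vary with the sample size, so a vector in
  \<open>\<real>\<^sup>p\<close> is a function \<open>nat \<Rightarrow> real\<close> vanishing outside \<open>[p] = {1..p}\<close>, a matrix is a function
  \<open>nat \<Rightarrow> nat \<Rightarrow> real\<close>, and \<open>\<real>\<^sup>J\<close> is identified with the vectors vanishing outside \<open>J\<close>.
  The Euclidean norm of a vector in \<open>\<real>\<^sup>J\<close> is \<open>L2_set \<beta> J\<close>.\<close>

definition coord_space :: "nat set \<Rightarrow> (nat \<Rightarrow> real) set" where
  "coord_space J = {\<beta>. \<forall>j. j \<notin> J \<longrightarrow> \<beta> j = 0}"

definition support :: "(nat \<Rightarrow> real) \<Rightarrow> nat set" where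
  "support \<beta> = {j. \<beta> j \<noteq> 0}"

definition submodels :: "nat \<Rightarrow> nat \<Rightarrow> nat set set" where
  "submodels p k = {J. J \<subseteq> {1..p} \<and> card J \<le> k}"

text \<open>Operations on the submatrix of \<open>A\<close> with rows and columns in the finite set \<open>J\<close>.\<close>

definition loewner_le :: "nat set \<Rightarrow> (nat \<Rightarrow> nat \<Rightarrow> real) \<Rightarrow> (nat \<Rightarrow> nat \<Rightarrow> real) \<Rightarrow> bool" where
  "loewner_le J A B \<longleftrightarrow>
     (\<forall>v \<in> coord_space J. (\<Sum>j\<in>J. \<Sum>k\<in>J. v j * (B j k - A j k) * v k) \<ge> 0)"

definition spectral_norm :: "nat set \<Rightarrow> (nat \<Rightarrow> nat \<Rightarrow> real) \<Rightarrow> real" where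
  "spectral_norm J A =
     (SUP v \<in> {v \<in> coord_space J. L2_set v J \<le> 1}. L2_set (\<lambda>j. \<Sum>k\<in>J. A j k * v k) J)"

definition subdet :: "nat set \<Rightarrow> (nat \<Rightarrow> nat \<Rightarrow> real) \<Rightarrow> real" where
  "subdet J A = Determinant.det (Matrix.mat (card J) (card J)
     (\<lambda>(r, s). A (sorted_list_of_set J ! r) (sorted_list_of_set J ! s)))"

definition scalar_matrix :: "real \<Rightarrow> nat \<Rightarrow> nat \<Rightarrow> real" where
  "scalar_matrix c = (\<lambda>j k. if j = k then c else 0)"

text \<open>The base measure \<open>\<mu>\<close> absorbs any carrier density, so the density with respect to \<open>\<mu>\<close> at natural
  parameter \<open>\<theta>\<close> is \<open>exp (y * \<theta> - b \<theta>)\<close>. Finiteness of the integral for every real \<open>\<theta>\<close> says that the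
  natural parameter space is the whole line, and its value says that \<open>b\<close> is the log-partition
  function.\<close>

definition exp_family :: "real measure \<Rightarrow> (real \<Rightarrow> real) \<Rightarrow> bool" where
  "exp_family \<mu> b \<longleftrightarrow> sets \<mu> = sets borel \<and>
     (\<forall>\<theta>. (\<integral>\<^sup>+ y. ennreal (exp (y * \<theta>)) \<partial>\<mu>) = ennreal (exp (b \<theta>)))"

definition lin_pred :: "nat \<Rightarrow> (nat \<Rightarrow> nat \<Rightarrow> real) \<Rightarrow> nat \<Rightarrow> (nat \<Rightarrow> real) \<Rightarrow> real" where
  "lin_pred p X i \<beta> = (\<Sum>j\<in>{1..p}. X i j * \<beta> j)"

definition glm_problem ::
  "'w measure \<Rightarrow> (nat \<Rightarrow> 'w \<Rightarrow> real) \<Rightarrow> real measure \<Rightarrow> (real \<Rightarrow> real) \<Rightarrow> nat \<Rightarrow> nat \<Rightarrow> nat \<Rightarrow>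
   (nat \<Rightarrow> nat \<Rightarrow> real) \<Rightarrow> (nat \<Rightarrow> real) \<Rightarrow> bool" where
  "glm_problem M Y \<mu> b n p q X \<beta>0 \<longleftrightarrow>
     prob_space M \<and> exp_family \<mu> b \<and>
     \<beta>0 \<in> coord_space {1..p} \<and> card (support \<beta>0) \<le> q \<and>
     prob_space.indep_vars M (\<lambda>_. borel) Y {1..n} \<and>
     (\<forall>i\<in>{1..n}. distributed M \<mu> (Y i)
        (\<lambda>y. ennreal (exp (y * lin_pred p X i \<beta>0 - b (lin_pred p X i \<beta>0)))))"

definition log_lik ::
  "nat \<Rightarrow> nat \<Rightarrow> (nat \<Rightarrow> nat \<Rightarrow> real) \<Rightarrow> (real \<Rightarrow> real) \<Rightarrow> (nat \<Rightarrow> real) \<Rightarrow> (nat \<Rightarrow> real) \<Rightarrow> real" where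
  "log_lik n p X b y \<beta> = (\<Sum>i\<in>{1..n}. y i * lin_pred p X i \<beta> - b (lin_pred p X i \<beta>))"

definition lik ::
  "nat \<Rightarrow> nat \<Rightarrow> (nat \<Rightarrow> nat \<Rightarrow> real) \<Rightarrow> (real \<Rightarrow> real) \<Rightarrow> (nat \<Rightarrow> real) \<Rightarrow> (nat \<Rightarrow> real) \<Rightarrow> real" where
  "lik n p X b y \<beta> = exp (log_lik n p X b y \<beta>)"

definition neg_hess ::
  "nat \<Rightarrow> nat \<Rightarrow> (nat \<Rightarrow> nat \<Rightarrow> real) \<Rightarrow> (real \<Rightarrow> real) \<Rightarrow> (nat \<Rightarrow> real) \<Rightarrow> nat \<Rightarrow> nat \<Rightarrow> real" where
  "neg_hess n p X b \<beta> = (\<lambda>j k. \<Sum>i\<in>{1..n}. X i j * X i k * deriv (deriv b) (lin_pred p X i \<beta>))"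

definition hess_regular ::
  "nat \<Rightarrow> nat \<Rightarrow> (nat \<Rightarrow> nat \<Rightarrow> real) \<Rightarrow> (real \<Rightarrow> real) \<Rightarrow> (real \<Rightarrow> real) \<Rightarrow> (real \<Rightarrow> real) \<Rightarrow> real \<Rightarrow>
   nat set \<Rightarrow> bool" where
  "hess_regular n p X b c_lower c_upper c_change J \<longleftrightarrow>
     (\<forall>\<beta> \<in> coord_space J. \<forall>\<beta>' \<in> coord_space J.
        loewner_le J (scalar_matrix (c_lower (L2_set \<beta> J)))
                     (\<lambda>j k. 1 / real n * neg_hess n p X b \<beta> j k) \<and>
        loewner_le J (\<lambda>j k. 1 / real n * neg_hess n p X b \<beta> j k)
                     (scalar_matrix (c_upper (L2_set \<beta> J))) \<and>
        1 / real n * spectral_norm J (\<lambda>j k. neg_hess n p X b \<beta> j k - neg_hess n p X b \<beta>' j k)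
          \<le> c_change * L2_set (\<lambda>j. \<beta> j - \<beta>' j) J)"

definition is_mle ::
  "nat \<Rightarrow> nat \<Rightarrow> (nat \<Rightarrow> nat \<Rightarrow> real) \<Rightarrow> (real \<Rightarrow> real) \<Rightarrow> (nat \<Rightarrow> real) \<Rightarrow> nat set \<Rightarrow> (nat \<Rightarrow> real) \<Rightarrow>
   bool" where
  "is_mle n p X b y J = is_arg_max (lik n p X b y) (\<lambda>\<beta>. \<beta> \<in> coord_space J)"

definition mle_exists ::
  "nat \<Rightarrow> nat \<Rightarrow> (nat \<Rightarrow> nat \<Rightarrow> real) \<Rightarrow> (real \<Rightarrow> real) \<Rightarrow> (nat \<Rightarrow> real) \<Rightarrow> nat set \<Rightarrow> bool" where
  "mle_exists n p X b y J \<longleftrightarrow> (\<exists>!\<beta>. is_mle n p X b y J \<beta>)"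

text \<open>Only meaningful together with \<open>mle_exists\<close>.\<close>

definition mle ::
  "nat \<Rightarrow> nat \<Rightarrow> (nat \<Rightarrow> nat \<Rightarrow> real) \<Rightarrow> (real \<Rightarrow> real) \<Rightarrow> (nat \<Rightarrow> real) \<Rightarrow> nat set \<Rightarrow> (nat \<Rightarrow> real)" where
  "mle n p X b y J = (THE \<beta>. is_mle n p X b y J \<beta>)"

text \<open>\<open>mle_bound_constants\<close> is the defining property of the triple \<open>(\<nu>, c_sample, a_MLE)\<close> for given
  \<open>(a\<^sub>0, c_lower, c_upper, c_change)\<close>: a bound that holds for every problem. The sample space is taken
  to have type \<open>nat \<Rightarrow> real\<close> because a definition cannot quantify over types; every joint law of
  \<open>Y\<^sub>1, \<dots>, Y\<^sub>n\<close> is realised by the coordinate process on such a space, so nothing is lost.\<close>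

definition mle_bound_constants ::
  "real \<Rightarrow> (real \<Rightarrow> real) \<Rightarrow> (real \<Rightarrow> real) \<Rightarrow> real \<Rightarrow> real \<Rightarrow> real \<Rightarrow> real \<Rightarrow> bool" where
  "mle_bound_constants a\<^sub>0 c_lower c_upper c_change \<nu> c_sample a_MLE \<longleftrightarrow>
     0 < \<nu> \<and> 0 < c_sample \<and> 0 < a_MLE \<and>
     (\<forall>(M :: (nat \<Rightarrow> real) measure) Y \<mu> b n p q X \<beta>0.
        1 \<le> n \<and> 1 \<le> p \<and>
        glm_problem M Y \<mu> b n p q X \<beta>0 \<and>
        L2_set \<beta>0 {1..p} \<le> a\<^sub>0 \<and>
        (\<forall>J \<in> submodels p (2 * q). hess_regular n p X b c_lower c_upper c_change J) \<and>
        real n \<ge> c_sample * real q ^ 3 * max (ln (real p)) (ln (real n) ^ 3)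
        \<longrightarrow> measure M {\<omega> \<in> space M. \<forall>J \<in> submodels p q.
              mle_exists n p X b (\<lambda>i. Y i \<omega>) J \<and>
              L2_set (mle n p X b (\<lambda>i. Y i \<omega>) J) J \<le> a_MLE}
            \<ge> 1 - real p powr (- \<nu>))"

text \<open>The product measure \<open>\<Pi>\<^sub>M j\<in>J. lborel\<close> is Lebesgue measure on \<open>\<real>\<^sup>J\<close>; its points are undefined
  outside \<open>J\<close>, hence the passage to the zero-filled vector.\<close>

definition prior_density :: "nat set \<Rightarrow> ((nat \<Rightarrow> real) \<Rightarrow> real) \<Rightarrow> bool" where
  "prior_density J f \<longleftrightarrow>
     (\<forall>\<beta> \<in> coord_space J. 0 \<le> f \<beta>) \<and>
     (\<lambda>x. f (\<lambda>j. if j \<in> J then x j else 0)) \<in> borel_measurable (\<Pi>\<^sub>M j\<in>J. lborel) \<and>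
     (\<integral>\<^sup>+ x. ennreal (f (\<lambda>j. if j \<in> J then x j else 0)) \<partial>(\<Pi>\<^sub>M j\<in>J. lborel)) = 1"

definition Laplace ::
  "nat \<Rightarrow> nat \<Rightarrow> (nat \<Rightarrow> nat \<Rightarrow> real) \<Rightarrow> (real \<Rightarrow> real) \<Rightarrow> (nat set \<Rightarrow> (nat \<Rightarrow> real) \<Rightarrow> real) \<Rightarrow>
   (nat \<Rightarrow> real) \<Rightarrow> nat set \<Rightarrow> real" where
  "Laplace n p X b f y J =
     (let \<beta>h = mle n p X b y J in
        lik n p X b y \<beta>h * f J \<beta>h * sqrt ((2 * pi) ^ card J / subdet J (neg_hess n p X b \<beta>h)))"

definition Laplace_gen ::
  "real \<Rightarrow> nat \<Rightarrow> nat \<Rightarrow> (nat \<Rightarrow> nat \<Rightarrow> real) \<Rightarrow> (real \<Rightarrow> real) \<Rightarrow>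
   (nat set \<Rightarrow> (nat \<Rightarrow> real) \<Rightarrow> real) \<Rightarrow> (nat \<Rightarrow> real) \<Rightarrow> nat set \<Rightarrow> real" where
  "Laplace_gen \<gamma> n p X b f y J = real (p choose card J) powr (- \<gamma>) * Laplace n p X b f y J"

text \<open>All the estimators entering the comparison exist, and the true support is the one and only
  maximizer of the criterion.\<close>

definition selects_truth ::
  "real \<Rightarrow> nat \<Rightarrow> nat \<Rightarrow> nat \<Rightarrow> (nat \<Rightarrow> nat \<Rightarrow> real) \<Rightarrow> (real \<Rightarrow> real) \<Rightarrow>
   (nat set \<Rightarrow> (nat \<Rightarrow> real) \<Rightarrow> real) \<Rightarrow> (nat \<Rightarrow> real) \<Rightarrow> (nat \<Rightarrow> real) \<Rightarrow> bool" where
  "selects_truth \<gamma> n p q X b f \<beta>0 y \<longleftrightarrow>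
     (\<forall>J \<in> submodels p q. mle_exists n p X b y J) \<and>
     {J. is_arg_max (Laplace_gen \<gamma> n p X b f y) (\<lambda>J. J \<in> submodels p q) J} = {support \<beta>0}"

text \<open>\<open>k\<close> is \<open>x\<close> rounded to an integer, in either direction.\<close>

definition rounding_of :: "nat \<Rightarrow> real \<Rightarrow> bool" where
  "rounding_of k x \<longleftrightarrow> int k = \<lfloor>x\<rfloor> \<or> int k = \<lceil>x\<rceil>"

text \<open>Only meaningful for nonempty support.\<close>

definition signal_strength :: "(nat \<Rightarrow> real) \<Rightarrow> real" where
  "signal_strength \<beta> = Min ((\<lambda>j. \<bar>\<beta> j\<bar>) ` support \<beta>)"

end

(*
  Every competing submodel J is compared with the true support J0 through the expansion
  l(beta0 + u) = l(beta0) + S(u) - R(u), where S is the score at the true parameter and R the Bregman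
  remainder, for which E exp S(u) = exp R(u). A Chernoff bound in the coordinate directions gives
  |S(u)| <= sigma |u| with sigma of order sqrt(n q log p); convexity of R then yields existence of all
  estimators and a bound on them, and consistency for J containing J0.
  If J misses a true covariate, l drops by a multiple of n * beta_min^2, of order n^(1-phi), which
  dominates all other terms, of order n^psi * log n.
  If J strictly contains J0, with k additional covariates, the gain in l is, up to o(1), half of the
  squared norm of a k-dimensional isotropic vector of scores. A grid of directions of size (C sqrt k)^k
  and the union over at most p^k / k! sets J bound it by (1 + eps) k log p uniformly in J. The
  determinant contributes -(k/2) log n and the binomial factor -gamma k (kappa - psi) log n,
  so the condition on gamma makes the sum negative.
  The bound a_MLE enters only through F_4, at the estimator for J0. The Hessian condition is assumed
  only for supersets of J0, so the property defining a_MLE does not apply to the given problem; instead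
  it implies a_0 < a_MLE, and the estimator for J0 is close to the true parameter.
*)
theory Submission
  imports Defs "HOL-Combinatorics.List_Permutation" "HOL-Real_Asymp.Real_Asymp"
begin

section \<open>Quadratic forms and determinants on coordinate subspaces\<close>

text \<open>The condition on \<gamma> compares coefficients of k log n, so the score gain of an
  overfitted model must be bounded by k log p with leading constant 1. Hence the net resolves
  directions up to a factor 1 - \<eta>. Its size is harmless: (C sqrt k)^k is at most C'^k k!, and
  the k! cancels against the count p^k / k!, leaving a constant per covariate. Chernoff's bound is
  sharp enough there because the cubic part of R stays bounded on the net.

  The crude bound |S(u)| <= sigma |u| may lose constants and a factor sqrt q. For J containing J0 it
  serves to place the estimator within delta, of order sqrt(q log p / n), of the true parameter. The
  remaining errors are n delta^3 in the likelihood and q delta in the determinant; both vanish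
  because \<psi> < 1/3.

  The comparison of models is deterministic in the responses, and randomness is confined to one
  exceptional set. A candidate J need not contain J0, so curvature is read off in the union of J0
  and J, of size at most 2q.\<close>

definition bform :: "nat set \<Rightarrow> (nat \<Rightarrow> nat \<Rightarrow> real) \<Rightarrow> (nat \<Rightarrow> real) \<Rightarrow> (nat \<Rightarrow> real) \<Rightarrow> real" where
  "bform J A u v = (\<Sum>j\<in>J. \<Sum>k\<in>J. u j * A j k * v k)"

definition pos_def_on :: "nat set \<Rightarrow> (nat \<Rightarrow> nat \<Rightarrow> real) \<Rightarrow> bool" where
  "pos_def_on J A \<longleftrightarrow> (\<forall>j k. A j k = A k j) \<and>
     (\<forall>u \<in> coord_space J. u \<noteq> (\<lambda>_. 0) \<longrightarrow> 0 < bform J A u u)"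

lemma coord_space_mono: "J \<subseteq> K \<Longrightarrow> coord_space J \<subseteq> coord_space K"
  by (auto simp: coord_space_def)

lemma coord_space_zero [simp]: "(\<lambda>_. 0) \<in> coord_space J"
  by (simp add: coord_space_def)

lemma coord_space_add:
  "u \<in> coord_space J \<Longrightarrow> v \<in> coord_space J \<Longrightarrow> (\<lambda>j. u j + v j) \<in> coord_space J"
  by (auto simp: coord_space_def)

lemma coord_space_diff:
  "u \<in> coord_space J \<Longrightarrow> v \<in> coord_space J \<Longrightarrow> (\<lambda>j. u j - v j) \<in> coord_space J"
  by (auto simp: coord_space_def)

lemma coord_space_scale: "u \<in> coord_space J \<Longrightarrow> (\<lambda>j. a * u j) \<in> coord_space J"
  by (auto simp: coord_space_def)

lemma coord_space_sum:
  "(\<And>i. i \<in> I \<Longrightarrow> w i \<in> coord_space J) \<Longrightarrow> (\<lambda>j. \<Sum>i\<in>I. a i * w i j) \<in> coord_space J"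
  by (auto simp: coord_space_def intro!: sum.neutral)

lemma bform_superset:
  assumes "finite L" "J \<subseteq> L" "u \<in> coord_space J" "v \<in> coord_space J"
  shows "bform L A u v = bform J A u v"
proof -
  have "(\<Sum>k\<in>L. u j * A j k * v k) = (\<Sum>k\<in>J. u j * A j k * v k)" for j
    using assms by (intro sum.mono_neutral_right) (auto simp: coord_space_def)
  then have "bform L A u v = (\<Sum>j\<in>L. \<Sum>k\<in>J. u j * A j k * v k)"
    by (simp add: bform_def)
  also have "\<dots> = bform J A u v"
    unfolding bform_def
    using assms by (intro sum.mono_neutral_right) (auto simp: coord_space_def)
  finally show ?thesis .
qed

lemma bform_add_left: "bform J A (\<lambda>j. u j + v j) w = bform J A u w + bform J A v w"
  by (simp add: bform_def algebra_simps sum.distrib)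

lemma bform_add_right: "bform J A w (\<lambda>j. u j + v j) = bform J A w u + bform J A w v"
  by (simp add: bform_def algebra_simps sum.distrib)

lemma bform_scale_left: "bform J A (\<lambda>j. a * u j) w = a * bform J A u w"
  by (simp add: bform_def algebra_simps sum_distrib_left)

lemma bform_scale_right: "bform J A w (\<lambda>j. a * u j) = a * bform J A w u"
  by (simp add: bform_def algebra_simps sum_distrib_left)

lemma bform_zero_left [simp]: "bform J A (\<lambda>_. 0) w = 0"
  by (simp add: bform_def)

lemma bform_zero_right [simp]: "bform J A w (\<lambda>_. 0) = 0"
  by (simp add: bform_def)

lemma bform_sum_left:
  "bform J A (\<lambda>j. \<Sum>i\<in>I. a i * u i j) w = (\<Sum>i\<in>I. a i * bform J A (u i) w)"
  by (induction I rule: infinite_finite_induct)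
     (simp_all add: bform_add_left bform_scale_left)

lemma bform_sum_right:
  "bform J A w (\<lambda>j. \<Sum>i\<in>I. a i * u i j) = (\<Sum>i\<in>I. a i * bform J A w (u i))"
  by (induction I rule: infinite_finite_induct)
     (simp_all add: bform_add_right bform_scale_right)

lemma bform_sym:
  assumes "\<And>j k. A j k = A k j"
  shows "bform J A u v = bform J A v u"
proof -
  have "bform J A u v = (\<Sum>k\<in>J. \<Sum>j\<in>J. u j * A j k * v k)"
    unfolding bform_def by (rule sum.swap)
  also have "\<dots> = bform J A v u"
    unfolding bform_def by (intro sum.cong refl) (subst assms, simp)
  finally show ?thesis .
qed

lemma bform_alt: "bform J A u v = (\<Sum>j\<in>J. u j * (\<Sum>k\<in>J. A j k * v k))"
  by (simp add: bform_def sum_distrib_left mult.assoc)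

lemma pos_def_on_subset:
  assumes "pos_def_on L A" "J \<subseteq> L" "finite L"
  shows "pos_def_on J A"
  using assms coord_space_mono[OF assms(2)] bform_superset[OF assms(3,2)]
  unfolding pos_def_on_def by (metis subsetD)

lemma pos_def_on_nonneg:
  assumes "pos_def_on J A" "u \<in> coord_space J"
  shows "0 \<le> bform J A u u"
proof (cases "u = (\<lambda>_. 0)")
  case True
  then show ?thesis by simp
next
  case False
  then show ?thesis using assms by (auto simp: pos_def_on_def intro: less_imp_le)
qed

text \<open>Gaussian elimination as an induction on the index set: adding an index changes the
  solution by a multiple of one vector, and positive definiteness makes the new pivot
  positive.\<close>

lemma pos_def_on_solve:
  assumes "finite J" "pos_def_on J A"
  shows "\<exists>v\<in>coord_space J. \<forall>j\<in>J. (\<Sum>k\<in>J. A j k * v k) = g j"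
  using assms
proof (induction J arbitrary: g rule: finite_induct)
  case empty
  show ?case using coord_space_zero by fastforce
next
  case (insert j J)
  have pdJ: "pos_def_on J A"
    using pos_def_on_subset[OF insert.prems] insert.hyps by auto
  have sym: "A i k = A k i" for i k
    using insert.prems by (auto simp: pos_def_on_def)
  obtain v1 where v1: "v1 \<in> coord_space J" "\<forall>i\<in>J. (\<Sum>k\<in>J. A i k * v1 k) = - A i j"
    using insert.IH[OF pdJ, of "\<lambda>i. - A i j"] by auto
  obtain v2 where v2: "v2 \<in> coord_space J" "\<forall>i\<in>J. (\<Sum>k\<in>J. A i k * v2 k) = g i"
    using insert.IH[OF pdJ, of g] by auto
  \<comment> \<open>\<open>v1\<close> solves the old rows against minus column \<open>j\<close>, so
    every row in \<open>J\<close> annihilates \<open>w\<close>; the value \<open>d\<close> of row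
    \<open>j\<close> on it is the Schur complement.\<close>
  define w where "w = v1(j := 1)"
  have wcs: "w \<in> coord_space (insert j J)"
    using v1 by (auto simp: coord_space_def w_def)
  have wJ: "(\<Sum>k\<in>J. A i k * w k) = (\<Sum>k\<in>J. A i k * v1 k)" for i
    using insert.hyps by (intro sum.cong) (auto simp: w_def)
  have w0: "(\<Sum>k\<in>insert j J. A i k * w k) = 0" if "i \<in> J" for i
    using insert.hyps v1 that by (simp add: wJ) (simp add: w_def)
  define d where "d = (\<Sum>k\<in>insert j J. A j k * w k)"
  have wj: "w j = 1" by (simp add: w_def)
  have "bform (insert j J) A w w = d"
  proof -
    have "bform (insert j J) A w w =
        w j * (\<Sum>k\<in>insert j J. A j k * w k) + (\<Sum>i\<in>J. w i * (\<Sum>k\<in>insert j J. A i k * w k))"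
      unfolding bform_alt using insert.hyps by (rule sum.insert)
    also have "(\<Sum>i\<in>J. w i * (\<Sum>k\<in>insert j J. A i k * w k)) = 0"
      using w0 by (intro sum.neutral) auto
    finally show ?thesis by (simp only: wj d_def mult_1 add_0_right)
  qed
  moreover have "w \<noteq> (\<lambda>_. 0)"
    by (metis fun_upd_same w_def zero_neq_one)
  ultimately have d: "d > 0"
    using insert.prems wcs by (auto simp: pos_def_on_def)
  define c where "c = (g j - (\<Sum>k\<in>J. A j k * v2 k)) / d"
  define v where "v = (\<lambda>k. v2 k + c * w k)"
  have vcs: "v \<in> coord_space (insert j J)"
    using v2 wcs by (auto simp: coord_space_def v_def)
  have v2j: "v2 j = 0" using v2 insert.hyps by (auto simp: coord_space_def)
  have eq: "(\<Sum>k\<in>insert j J. A i k * v k) =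
      (\<Sum>k\<in>J. A i k * v2 k) + c * (\<Sum>k\<in>insert j J. A i k * w k)" for i
  proof -
    have "(\<Sum>k\<in>insert j J. A i k * v k) =
        (\<Sum>k\<in>insert j J. A i k * v2 k) + c * (\<Sum>k\<in>insert j J. A i k * w k)"
      by (simp add: v_def algebra_simps sum.distrib sum_distrib_left)
    then show ?thesis using insert.hyps v2j by simp
  qed
  have "\<forall>i\<in>insert j J. (\<Sum>k\<in>insert j J. A i k * v k) = g i"
  proof
    fix i assume "i \<in> insert j J"
    then consider "i = j" | "i \<in> J" by auto
    then show "(\<Sum>k\<in>insert j J. A i k * v k) = g i"
    proof cases
      case 1
      show ?thesis
        unfolding eq 1 d_def[symmetric] using d by (simp add: c_def)
    next
      case 2
      then show ?thesis unfolding eq using w0 v2 by simp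
    qed
  qed
  then show ?case using vcs by blast
qed

lemma orthogonal_to_coord_space:
  assumes "finite L" "J \<subseteq> L" "w \<in> coord_space L" "v \<in> coord_space J"
    "\<And>i. i \<in> J \<Longrightarrow> (\<Sum>k\<in>L. A i k * w k) = 0"
  shows "bform L A v w = 0"
  unfolding bform_alt
proof (rule sum.neutral, rule ballI)
  fix j assume "j \<in> L"
  show "v j * (\<Sum>k\<in>L. A j k * w k) = 0"
    using assms by (cases "j \<in> J") (auto simp: coord_space_def)
qed

text \<open>Projection in the inner product of \<open>A\<close>: \<open>v\<close> solves the normal
  equations on \<open>J\<close>, and the residual \<open>w\<close> is then annihilated by the rows
  in \<open>J\<close>.\<close>

lemma orthogonal_decomposition:
  assumes "finite L" "J \<subseteq> L" "pos_def_on L A" "u \<in> coord_space L"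
  obtains v w where "v \<in> coord_space J" "w \<in> coord_space L" "u = (\<lambda>j. v j + w j)"
    "\<And>i. i \<in> J \<Longrightarrow> (\<Sum>k\<in>L. A i k * w k) = 0"
proof -
  have fJ: "finite J" using assms finite_subset by blast
  obtain v where v: "v \<in> coord_space J" "\<And>i. i \<in> J \<Longrightarrow> (\<Sum>k\<in>J. A i k * v k) = (\<Sum>k\<in>L. A i k * u k)"
    using pos_def_on_solve[OF fJ pos_def_on_subset[OF assms(3,2,1)], of "\<lambda>i. \<Sum>k\<in>L. A i k * u k"]
    by auto
  have vL: "(\<Sum>k\<in>L. A i k * v k) = (\<Sum>k\<in>J. A i k * v k)" for i
    using assms v by (intro sum.mono_neutral_right) (auto simp: coord_space_def)
  show ?thesis
  proof
    show "v \<in> coord_space J" by fact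
    show "(\<lambda>j. u j - v j) \<in> coord_space L"
      using v assms coord_space_mono[OF assms(2)] by (intro coord_space_diff) auto
    show "u = (\<lambda>j. v j + (u j - v j))" by simp
    show "(\<Sum>k\<in>L. A i k * (u k - v k)) = 0" if "i \<in> J" for i
      using v(2)[OF that] vL by (simp add: algebra_simps sum_subtractf)
  qed
qed

text \<open>\<open>subdet\<close> fixes the sorted enumeration, whereas an induction wants the new
  index last. Reordering applies one permutation to rows and columns, so its sign enters
  twice.\<close>

lemma subdet_enum:
  assumes "distinct ys"
  shows "subdet (set ys) A =
    Determinant.det (Matrix.mat (length ys) (length ys) (\<lambda>(r, s). A (ys ! r) (ys ! s)))"
proof -
  define n zs where "n = length ys" and "zs = sorted_list_of_set (set ys)"
  have card: "card (set ys) = n" using assms by (simp add: distinct_card n_def)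
  have lz: "length zs = n" unfolding zs_def using card by simp
  have "mset ys = mset zs"
  proof -
    have "distinct zs" "set ys = set zs" by (simp_all add: zs_def)
    then show ?thesis using set_eq_iff_mset_eq_distinct[OF assms] by blast
  qed
  then obtain p where p: "p permutes {..<length zs}" "permute_list p zs = ys"
    using mset_eq_permutation by blast
  have p': "p permutes {0..<n}" using p lz by (simp add: lessThan_atLeast0)
  have ysn: "ys ! i = zs ! p i" if "i < n" for i
    using permute_list_nth[OF p(1)] p(2) that lz by auto
  define B where "B = Matrix.mat n n (\<lambda>(r, s). A (zs ! r) (zs ! s))"
  have B: "B \<in> carrier_mat n n" by (simp add: B_def)
  have plt: "p i < n" if "i < n" for i
    using permutes_in_image[OF p'] that by auto
  define C where "C = Matrix.mat n n (\<lambda>(i, j). B $$ (p i, j))"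
  have C: "C \<in> carrier_mat n n" by (simp add: C_def)
  have dC: "det C = signof p * det B"
    unfolding C_def by (rule det_permute_rows[OF B p'])
  have "det (Matrix.mat n n (\<lambda>(i, j). C\<^sup>T $$ (p i, j))) = signof p * det (C\<^sup>T)"
    by (rule det_permute_rows[OF _ p']) (simp add: C)
  also have "\<dots> = det B"
    using dC det_transpose[OF C] by (simp add: sign_def)
  finally have 1: "det (Matrix.mat n n (\<lambda>(i, j). C\<^sup>T $$ (p i, j))) = det B" .
  have "Matrix.mat n n (\<lambda>(i, j). C\<^sup>T $$ (p i, j)) =
      (Matrix.mat n n (\<lambda>(r, s). A (ys ! r) (ys ! s)))\<^sup>T"
    by (rule eq_matI) (auto simp: C_def B_def ysn plt)
  then have "det (Matrix.mat n n (\<lambda>(r, s). A (ys ! r) (ys ! s))) = det B"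
    using 1 det_transpose[of "Matrix.mat n n (\<lambda>(r, s). A (ys ! r) (ys ! s))" n] by simp
  then show ?thesis
    by (simp add: subdet_def card B_def zs_def n_def)
qed

lemma subdet_empty [simp]: "subdet {} A = 1"
  by (simp add: subdet_def det_dim_zero)

text \<open>Schur complement formula by one column operation: the unitriangular \<open>Q\<close>
  replaces the last column by the combination with weights \<open>w\<close>, which vanishes except
  at the new index.\<close>

lemma subdet_insert:
  assumes "finite J" "j \<notin> J" "w j = 1"
    "\<And>i. i \<in> J \<Longrightarrow> (\<Sum>k\<in>insert j J. A i k * w k) = 0"
  shows "subdet (insert j J) A = subdet J A * (\<Sum>k\<in>insert j J. A j k * w k)"
proof -
  define xs where "xs = sorted_list_of_set J"
  define n where "n = length xs"
  define ys where "ys = xs @ [j]"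
  have setx: "set xs = J" and dx: "distinct xs"
    using assms by (auto simp: xs_def)
  have dy: "distinct ys" and sety: "set ys = insert j J"
    using setx dx assms by (auto simp: ys_def)
  have ly: "length ys = Suc n" by (simp add: ys_def n_def)
  have ynth: "ys ! i = xs ! i" if "i < n" for i using that by (simp add: ys_def n_def nth_append)
  have yn: "ys ! n = j" by (simp add: ys_def n_def)
  define M where "M = Matrix.mat (Suc n) (Suc n) (\<lambda>(r, s). A (ys ! r) (ys ! s))"
  define M0 where "M0 = Matrix.mat n n (\<lambda>(r, s). A (xs ! r) (xs ! s))"
  define Q where "Q = Matrix.mat (Suc n) (Suc n) (\<lambda>(r, s). if s < n then (if r = s then 1 else 0) else w (ys ! r))"
  define d where "d = (\<Sum>k\<in>insert j J. A j k * w k)"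
  define T where "T = four_block_mat M0 (0\<^sub>m n 1) (Matrix.mat 1 n (\<lambda>(r, s). A j (xs ! s)))
    (Matrix.mat 1 1 (\<lambda>_. d))"
  have M: "M \<in> carrier_mat (Suc n) (Suc n)" and Q: "Q \<in> carrier_mat (Suc n) (Suc n)"
    and M0: "M0 \<in> carrier_mat n n" by (auto simp: M_def Q_def M0_def)
  have detQ: "det Q = 1"
  proof -
    have "upper_triangular Q" by (auto simp: Q_def upper_triangular_def)
    then have "det Q = prod_list (diag_mat Q)" by (rule det_upper_triangular[OF _ Q])
    also have "\<dots> = 1"
      unfolding prod_list_diag_prod
      using assms yn by (intro prod.neutral) (auto simp: Q_def less_Suc_eq)
    finally show ?thesis .
  qed
  have sumy: "(\<Sum>k\<in>insert j J. A (ys ! r) k * w k) = (\<Sum>l = 0..<Suc n. A (ys ! r) (ys ! l) * w (ys ! l))" for r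
  proof -
    have "bij_betw (nth ys) {0..<Suc n} (insert j J)"
      using bij_betw_nth[OF dy] ly sety by (simp add: lessThan_atLeast0)
    from sum.reindex_bij_betw[OF this, of "\<lambda>k. A (ys ! r) k * w k"] show ?thesis by simp
  qed
  have "M * Q = T"
  proof (rule eq_matI)
    fix r s assume rs: "r < dim_row T" "s < dim_col T"
    then have r: "r < Suc n" and s: "s < Suc n" by (auto simp: T_def M0_def)
    have prod: "(M * Q) $$ (r, s) = (\<Sum>l = 0..<Suc n. A (ys ! r) (ys ! l) * Q $$ (l, s))"
      using r s by (simp add: M_def Q_def scalar_prod_def times_mat_def)
    show "(M * Q) $$ (r, s) = T $$ (r, s)"
    proof (cases "s < n")
      case True
      have "(M * Q) $$ (r, s) = (\<Sum>l = 0..<Suc n. if l = s then A (ys ! r) (ys ! l) else 0)"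
        unfolding prod using True by (intro sum.cong) (auto simp: Q_def)
      also have "\<dots> = A (ys ! r) (ys ! s)" using s by simp
      also have "\<dots> = T $$ (r, s)"
        using r True ynth yn by (auto simp: T_def M0_def four_block_mat_def Let_def less_Suc_eq)
      finally show ?thesis .
    next
      case False
      then have sn: "s = n" using s by simp
      have "(M * Q) $$ (r, s) = (\<Sum>k\<in>insert j J. A (ys ! r) k * w k)"
        unfolding prod sumy using sn by (intro sum.cong) (auto simp: Q_def)
      also have "\<dots> = T $$ (r, s)"
      proof (cases "r < n")
        case True
        then have "ys ! r \<in> J" using setx ynth n_def by auto
        then show ?thesis using assms True sn M0 by (auto simp: T_def four_block_mat_def Let_def)
      next
        case False
        then have "r = n" using r by simp
        then show ?thesis using yn sn M0 by (auto simp: T_def four_block_mat_def Let_def d_def)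
      qed
      finally show ?thesis .
    qed
  qed (use M0 in \<open>auto simp: T_def M_def Q_def\<close>)
  moreover have "det (M * Q) = det M" using det_mult[OF M Q] detQ by simp
  moreover have "det T = det M0 * d"
  proof -
    have "det T = det M0 * det (Matrix.mat 1 1 (\<lambda>_. d))"
      unfolding T_def by (rule det_four_block_mat_upper_right_zero[OF M0]) auto
    then show ?thesis by (simp add: det_single)
  qed
  ultimately have "det M = det M0 * d" by simp
  moreover have "subdet (insert j J) A = det M"
    using subdet_enum[OF dy, of A] sety ly by (simp add: M_def)
  moreover have "subdet J A = det M0"
    using subdet_enum[OF dx, of A] setx by (simp add: M0_def n_def)
  ultimately show ?thesis by (simp add: d_def)
qed

text \<open>\<open>w\<close> is the component of the unit vector at \<open>j\<close> that is
  orthogonal to \<open>coord_space J\<close>. Its energy is at once the ratio of two determinants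
  and a minimum of the form; through this variational description determinants are compared by
  quadratic forms, without eigenvalues.\<close>

lemma pos_def_on_insert_obtain:
  assumes "finite J" "j \<notin> J" "pos_def_on (insert j J) A"
  obtains w where "w \<in> coord_space (insert j J)" "w j = 1"
    "\<And>i. i \<in> J \<Longrightarrow> (\<Sum>k\<in>insert j J. A i k * w k) = 0"
    "\<And>u. u \<in> coord_space J \<Longrightarrow> bform (insert j J) A u w = 0"
    "subdet (insert j J) A = subdet J A * bform (insert j J) A w w"
    "0 < bform (insert j J) A w w"
    "\<And>u. u \<in> coord_space (insert j J) \<Longrightarrow> u j = 1 \<Longrightarrow>
        bform (insert j J) A w w \<le> bform (insert j J) A u u"
proof -
  let ?L = "insert j J"
  have fL: "finite ?L" using assms by simp
  define e :: "nat \<Rightarrow> real" where "e = (\<lambda>k. if k = j then 1 else 0)"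
  have e: "e \<in> coord_space ?L" by (auto simp: e_def coord_space_def)
  obtain v w where vw: "v \<in> coord_space J" "w \<in> coord_space ?L" "e = (\<lambda>j. v j + w j)"
    "\<And>i. i \<in> J \<Longrightarrow> (\<Sum>k\<in>?L. A i k * w k) = 0"
    using orthogonal_decomposition[OF fL _ assms(3) e, of J] by blast
  have wj: "w j = 1"
    using vw(1) assms(2) fun_cong[OF vw(3), of j] by (simp add: e_def coord_space_def)
  have orth: "bform ?L A u w = 0" if "u \<in> coord_space J" for u
    by (rule orthogonal_to_coord_space[OF fL subset_insertI vw(2) that vw(4)])
  have sym: "A i k = A k i" for i k using assms by (auto simp: pos_def_on_def)
  have dd: "bform ?L A w w = (\<Sum>k\<in>?L. A j k * w k)"
    unfolding bform_alt using assms wj vw(4) by (simp add: sum.neutral)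
  have pos: "0 < bform ?L A w w"
  proof -
    have "w \<noteq> (\<lambda>_. 0)" using wj by (metis zero_neq_one)
    then show ?thesis using assms vw by (auto simp: pos_def_on_def)
  qed
  show ?thesis
  proof (rule that[OF vw(2) wj vw(4) orth _ pos])
    show "subdet ?L A = subdet J A * bform ?L A w w"
      unfolding dd by (rule subdet_insert[OF assms(1,2) wj vw(4)])
    fix u assume u: "u \<in> coord_space ?L" "u j = 1"
    define z where "z = (\<lambda>k. u k - w k)"
    have "z i = 0" if "i \<notin> J" for i
      using u vw(2) wj that by (cases "i = j") (auto simp: coord_space_def z_def)
    then have z: "z \<in> coord_space J" by (simp add: coord_space_def)
    have zL: "z \<in> coord_space ?L" using z coord_space_mono[of J ?L] by auto
    have "u = (\<lambda>k. z k + w k)" by (simp add: z_def)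
    then have "bform ?L A u u = bform ?L A z z + bform ?L A z w + bform ?L A w z + bform ?L A w w"
      by (simp add: bform_add_left bform_add_right)
    also have "\<dots> = bform ?L A z z + bform ?L A w w"
      using orth[OF z] bform_sym[OF sym, where J = ?L and u = w and v = z] by simp
    finally show "bform ?L A w w \<le> bform ?L A u u"
      using pos_def_on_nonneg[OF assms(3) zL] by simp
  qed
qed

lemma subdet_pos:
  assumes "finite J" "pos_def_on J A"
  shows "0 < subdet J A"
  using assms
proof (induction J rule: finite_induct)
  case (insert j J)
  have "pos_def_on J A" using pos_def_on_subset[OF insert.prems] insert.hyps by auto
  then show ?case using insert pos_def_on_insert_obtain[OF insert.hyps insert.prems]
    by (metis mult_pos_pos)
qed simp

text \<open>Each pivot of \<open>A\<close> is a minimum, so it may be tested with the minimiser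
  belonging to \<open>B\<close>; this costs one factor \<open>t\<close> per index.\<close>

lemma subdet_mono:
  assumes "finite J" "pos_def_on J A" "pos_def_on J B" "0 \<le> t"
    "\<And>u. u \<in> coord_space J \<Longrightarrow> bform J A u u \<le> t * bform J B u u"
  shows "subdet J A \<le> t ^ card J * subdet J B"
  using assms
proof (induction J rule: finite_induct)
  case (insert j J)
  let ?L = "insert j J"
  have fL: "finite ?L" using insert.hyps by simp
  have A: "pos_def_on J A" and B: "pos_def_on J B"
    using pos_def_on_subset[OF insert.prems(1)] pos_def_on_subset[OF insert.prems(2)] insert.hyps by auto
  have "bform J A u u \<le> t * bform J B u u" if "u \<in> coord_space J" for u
    using insert.prems(4)[of u] that coord_space_mono[OF subset_insertI, of J j]
      bform_superset[OF fL subset_insertI that that, of A]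
      bform_superset[OF fL subset_insertI that that, of B] by auto
  from insert.IH[OF A B insert.prems(3) this]
  have IH: "subdet J A \<le> t ^ card J * subdet J B" .
  obtain w where w: "w \<in> coord_space ?L" "w j = 1"
    "subdet ?L A = subdet J A * bform ?L A w w" "0 < bform ?L A w w"
    "\<And>u. u \<in> coord_space ?L \<Longrightarrow> u j = 1 \<Longrightarrow> bform ?L A w w \<le> bform ?L A u u"
    using pos_def_on_insert_obtain[OF insert.hyps insert.prems(1)] by metis
  obtain z where z: "z \<in> coord_space ?L" "z j = 1"
    "subdet ?L B = subdet J B * bform ?L B z z" "0 < bform ?L B z z"
    using pos_def_on_insert_obtain[OF insert.hyps insert.prems(2)] by metis
  have "bform ?L A w w \<le> t * bform ?L B z z"
    using w(5)[OF z(1,2)] insert.prems(4)[OF z(1)] by linarith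
  then have "subdet J A * bform ?L A w w \<le> (t ^ card J * subdet J B) * (t * bform ?L B z z)"
    using IH w(4) subdet_pos[OF insert.hyps(1) A] subdet_pos[OF insert.hyps(1) B] insert.prems(3)
    by (intro mult_mono) auto
  then show ?case using insert.hyps w(3) z(3) by (simp add: algebra_simps)
qed simp

text \<open>Every added index contributes a pivot attained at a vector whose entry there is 1, hence
  of norm at least 1, so the pivot is at least \<open>c\<close>.\<close>

lemma subdet_lower:
  assumes "finite L" "J \<subseteq> L" "pos_def_on L A" "0 \<le> c"
    "\<And>u. u \<in> coord_space L \<Longrightarrow> c * (L2_set u L)\<^sup>2 \<le> bform L A u u"
  shows "c ^ card (L - J) * subdet J A \<le> subdet L A"
proof -
  have fJ: "finite J" using assms finite_subset by blast
  have "finite K \<Longrightarrow> K \<subseteq> L - J \<Longrightarrow> c ^ card K * subdet J A \<le> subdet (J \<union> K) A" for K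
  proof (induction K rule: finite_induct)
    case (insert j K)
    let ?S = "J \<union> K"
    have sub: "insert j ?S \<subseteq> L" using insert.prems assms(2) by auto
    have fS: "finite ?S" and fS': "finite (insert j ?S)" using fJ insert.hyps by auto
    have jS: "j \<notin> ?S" using insert by auto
    obtain w where w: "w \<in> coord_space (insert j ?S)" "w j = 1"
      "subdet (insert j ?S) A = subdet ?S A * bform (insert j ?S) A w w"
      using pos_def_on_insert_obtain[OF fS jS pos_def_on_subset[OF assms(3) sub assms(1)]] by metis
    have wL: "w \<in> coord_space L" using w coord_space_mono[OF sub] by auto
    have "(w j)\<^sup>2 \<le> (\<Sum>i\<in>L. (w i)\<^sup>2)"
      using assms(1) sub by (intro member_le_sum) auto
    then have "1 \<le> (L2_set w L)\<^sup>2" using w by (simp add: L2_set_def sum_nonneg)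
    then have "c \<le> c * (L2_set w L)\<^sup>2" using assms(4) by (simp add: mult_left_le mult_le_cancel_left1)
    also have "\<dots> \<le> bform (insert j ?S) A w w"
      using assms(5)[OF wL] bform_superset[OF assms(1) sub w(1) w(1)] by simp
    finally have c: "c \<le> bform (insert j ?S) A w w" .
    have "(c ^ card K * subdet J A) * c \<le> subdet ?S A * bform (insert j ?S) A w w"
      using insert assms c subdet_pos[OF fS pos_def_on_subset[OF assms(3) _ assms(1)]] sub
      by (intro mult_mono) (auto intro: less_imp_le)
    then show ?case using insert.hyps w(3) by (simp add: algebra_simps)
  qed simp
  from this[of "L - J"] show ?thesis using assms by (simp add: Un_absorb1)
qed

text \<open>Each pivot is a minimum and is tested with the unit vector at the new index.\<close>

lemma subdet_upper:
  assumes "finite J" "pos_def_on J A"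
    "\<And>u. u \<in> coord_space J \<Longrightarrow> bform J A u u \<le> c * (L2_set u J)\<^sup>2"
  shows "subdet J A \<le> c ^ card J"
  using assms
proof (induction J rule: finite_induct)
  case (insert j J)
  let ?L = "insert j J"
  have fL: "finite ?L" using insert.hyps by simp
  have A: "pos_def_on J A"
    using pos_def_on_subset[OF insert.prems(1)] insert.hyps by auto
  have "bform J A u u \<le> c * (L2_set u J)\<^sup>2" if "u \<in> coord_space J" for u
  proof -
    have "L2_set u ?L = L2_set u J" using that insert.hyps
      by (auto simp: L2_set_def coord_space_def)
    then show ?thesis
      using insert.prems(2)[of u] that coord_space_mono[OF subset_insertI, of J j]
        bform_superset[OF fL subset_insertI that that, of A] by auto
  qed
  from insert.IH[OF A this] have IH: "subdet J A \<le> c ^ card J" .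
  obtain w where w: "w \<in> coord_space ?L" "w j = 1"
    "subdet ?L A = subdet J A * bform ?L A w w" "0 < bform ?L A w w"
    "\<And>u. u \<in> coord_space ?L \<Longrightarrow> u j = 1 \<Longrightarrow> bform ?L A w w \<le> bform ?L A u u"
    using pos_def_on_insert_obtain[OF insert.hyps insert.prems(1)] by metis
  define e :: "nat \<Rightarrow> real" where "e = (\<lambda>k. if k = j then 1 else 0)"
  have e: "e \<in> coord_space ?L" "e j = 1" by (auto simp: e_def coord_space_def)
  have "(L2_set e ?L)\<^sup>2 = (\<Sum>i\<in>?L. (e i)\<^sup>2)" by (simp add: L2_set_def sum_nonneg)
  also have "\<dots> = (\<Sum>i\<in>?L. if i = j then 1 else 0)" by (intro sum.cong) (auto simp: e_def)
  also have "\<dots> = 1" using fL by simp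
  finally have "bform ?L A w w \<le> c"
    using w(5)[OF e] insert.prems(2)[OF e(1)] by simp
  then have "subdet J A * bform ?L A w w \<le> c ^ card J * c"
    using IH w(4) subdet_pos[OF insert.hyps(1) A] by (intro mult_mono) auto
  then show ?case using insert.hyps w(3) by (simp add: algebra_simps)
qed simp

text \<open>Gram-Schmidt in the inner product of \<open>A\<close>. The basis of the complement of
  \<open>coord_space J\<close> is indexed by \<open>K\<close> itself, one vector per added index, so
  its size needs no dimension count.\<close>

lemma orthonormal_basis_of_complement:
  assumes "finite K" "finite J" "J \<inter> K = {}" "pos_def_on (J \<union> K) A"
  shows "\<exists>w. (\<forall>i\<in>K. w i \<in> coord_space (J \<union> K)) \<and>
    (\<forall>i\<in>K. \<forall>l\<in>K. bform (J \<union> K) A (w i) (w l) = (if i = l then 1 else 0)) \<and>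
    (\<forall>u\<in>coord_space (J \<union> K). (\<forall>v\<in>coord_space J. bform (J \<union> K) A v u = 0) \<longrightarrow>
       (\<exists>c. u = (\<lambda>j. \<Sum>i\<in>K. c i * w i j)))"
  using assms(1,3,4)
proof (induction K rule: finite_induct)
  case empty
  have "u = (\<lambda>_. 0)" if "u \<in> coord_space J" "\<forall>v\<in>coord_space J. bform J A v u = 0" for u
    using empty that by (force simp: pos_def_on_def)
  then show ?case by auto
next
  case (insert j K)
  let ?S = "J \<union> K" let ?L = "insert j ?S"
  have L: "J \<union> insert j K = ?L" by auto
  have fS: "finite ?S" and fL: "finite ?L" using insert.hyps assms(2) by auto
  have jS: "j \<notin> ?S" using insert by auto
  have pdL: "pos_def_on ?L A" using insert.prems L by simp
  have sym: "A i k = A k i" for i k using pdL by (auto simp: pos_def_on_def)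
  obtain w where w: "\<forall>i\<in>K. w i \<in> coord_space ?S"
    "\<forall>i\<in>K. \<forall>l\<in>K. bform ?S A (w i) (w l) = (if i = l then 1 else 0)"
    "\<And>u. u\<in>coord_space ?S \<Longrightarrow> (\<forall>v\<in>coord_space J. bform ?S A v u = 0) \<Longrightarrow>
       (\<exists>c. u = (\<lambda>j. \<Sum>i\<in>K. c i * w i j))"
    using insert.IH insert.prems pos_def_on_subset[OF pdL _ fL, of ?S] by blast
  obtain z where z: "z \<in> coord_space ?L" "z j = 1"
    "\<And>u. u \<in> coord_space ?S \<Longrightarrow> bform ?L A u z = 0" "0 < bform ?L A z z"
    using pos_def_on_insert_obtain[OF fS jS pdL] by metis
  define d where "d = sqrt (bform ?L A z z)"
  have d: "d > 0" "d * d = bform ?L A z z" using z(4) by (auto simp: d_def)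
  define w' where "w' = w(j := (\<lambda>k. (1 / d) * z k))"
  have w'K: "w' i = w i" if "i \<in> K" for i using that insert.hyps by (auto simp: w'_def)
  have w'j: "w' j = (\<lambda>k. (1 / d) * z k)" by (simp add: w'_def)
  have wS: "w i \<in> coord_space ?L" if "i \<in> K" for i
    using w(1) that coord_space_mono[of ?S ?L] by blast
  have "\<forall>i\<in>insert j K. w' i \<in> coord_space ?L"
    using wS w'K w'j coord_space_scale[OF z(1), of "1 / d"] by auto
  moreover have "bform ?L A (w' i) (w' l) = (if i = l then 1 else 0)"
    if il: "i \<in> insert j K" "l \<in> insert j K" for i l
  proof -
    consider "i = j" "l = j" | "i = j" "l \<in> K" | "i \<in> K" "l = j" | "i \<in> K" "l \<in> K"
      using il by auto
    then show ?thesis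
    proof cases
      case 1
      then show ?thesis unfolding w'j 1 bform_scale_left bform_scale_right
        using d(1) by (simp add: d(2)[symmetric])
    next
      case 2
      then have "l \<noteq> i" using insert.hyps by auto
      have "bform ?L A (w' i) (w' l) = (1 / d) * bform ?L A (w l) z"
        unfolding 2(1) w'K[OF 2(2)] w'j bform_scale_left
        using bform_sym[OF sym, where J = ?L and u = z and v = "w l"] by simp
      then show ?thesis using z(3) w(1) 2 \<open>l \<noteq> i\<close> by auto
    next
      case 3
      then have "l \<noteq> i" using insert.hyps by auto
      have "bform ?L A (w' i) (w' l) = (1 / d) * bform ?L A (w i) z"
        unfolding 3(2) w'K[OF 3(1)] w'j bform_scale_right by simp
      then show ?thesis using z(3) w(1) 3 \<open>l \<noteq> i\<close> by auto
    next
      case 4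
      then show ?thesis
        using w w'K bform_superset[OF fL, of ?S "w i" "w l" A] by (auto simp: subset_insertI)
    qed
  qed
  moreover have "\<exists>c. u = (\<lambda>m. \<Sum>i\<in>insert j K. c i * w' i m)"
    if u: "u \<in> coord_space ?L" "\<forall>v\<in>coord_space J. bform ?L A v u = 0" for u
  proof -
    \<comment> \<open>Removing the multiple of \<open>z\<close> that carries entry \<open>j\<close>
      leaves a vector on the old index set that is still orthogonal to
      \<open>coord_space J\<close>.\<close>
    define u' where "u' = (\<lambda>k. u k - u j * z k)"
    have "u' i = 0" if "i \<notin> ?S" for i
      using u(1) z(1,2) that by (cases "i = j") (auto simp: u'_def coord_space_def)
    then have u': "u' \<in> coord_space ?S" unfolding coord_space_def by blast
    have "bform ?S A v u' = 0" if v: "v \<in> coord_space J" for v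
    proof -
      have vS: "v \<in> coord_space ?S" using v coord_space_mono[of J ?S] by auto
      have "bform ?S A v u' = bform ?L A v u'"
        by (rule bform_superset[OF fL subset_insertI vS u', symmetric])
      also have "\<dots> = bform ?L A v u + (- u j) * bform ?L A v z"
        unfolding bform_scale_right[symmetric] bform_add_right[symmetric] by (simp add: u'_def)
      finally show ?thesis using u(2) v z(3)[OF vS] by simp
    qed
    then obtain c where c: "u' = (\<lambda>m. \<Sum>i\<in>K. c i * w i m)" using w(3)[OF u'] by blast
    have "u = (\<lambda>m. \<Sum>i\<in>insert j K. (c(j := u j * d)) i * w' i m)"
    proof
      fix m
      have "(\<Sum>i\<in>insert j K. (c(j := u j * d)) i * w' i m) =
          u j * d * w' j m + (\<Sum>i\<in>K. (c(j := u j * d)) i * w' i m)"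
        using insert.hyps by simp
      also have "(\<Sum>i\<in>K. (c(j := u j * d)) i * w' i m) = (\<Sum>i\<in>K. c i * w i m)"
        using insert.hyps w'K by (intro sum.cong) auto
      also have "\<dots> = u' m" by (simp add: c)
      also have "u j * d * w' j m = u j * z m" using d by (simp add: w'j)
      finally show "u m = (\<Sum>i\<in>insert j K. (c(j := u j * d)) i * w' i m)"
        by (simp add: u'_def)
    qed
    then show ?thesis by blast
  qed
  ultimately show ?case unfolding L by blast
qed

section \<open>Nets for the orthogonal complement of a submodel\<close>

text \<open>Scaling \<open>z\<close> to length \<open>r\<close> and rounding the entries towards
  zero gives a grid point that cannot leave the ball; the inner product with \<open>z\<close> loses
  at most the spacing times the l1 norm of \<open>z\<close>.\<close>

lemma direction_grid:
  fixes r \<eta> :: real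
  assumes "finite K" "K \<noteq> {}" "0 < \<eta>" "\<eta> \<le> 1" "0 < r"
  obtains G :: "(nat \<Rightarrow> real) set" where "finite G"
    "real (card G) \<le> (2 * sqrt (real (card K)) / \<eta> + 1) ^ card K"
    "\<And>a. a \<in> G \<Longrightarrow> (\<Sum>i\<in>K. (a i)\<^sup>2) \<le> r\<^sup>2"
    "\<And>z. r\<^sup>2 < (\<Sum>i\<in>K. (z i)\<^sup>2) \<Longrightarrow> \<exists>a\<in>G. (1 - \<eta>) * r\<^sup>2 \<le> (\<Sum>i\<in>K. a i * z i)"
proof -
  define k where "k = card K"
  have k: "k > 0" using assms by (simp add: k_def card_gt_0_iff)
  \<comment> \<open>The l1 norm is at most \<open>sqrt k\<close> times the Euclidean norm
    \<open>s\<close>, so with this spacing the loss is at most the fraction \<eta> of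
    \<open>r * s\<close>.\<close>
  define h where "h = \<eta> * r / sqrt k"
  have h: "h > 0" using assms k by (simp add: h_def)
  have rh: "r / h = sqrt k / \<eta>" using assms k by (simp add: h_def field_simps)
  define m where "m = \<lfloor>r / h\<rfloor>"
  have m: "0 \<le> m" using assms h by (simp add: m_def)
  define F where "F = (K \<rightarrow>\<^sub>E {-m..m})"
  define G where "G = {a \<in> (\<lambda>g i. h * of_int (g i)) ` F. (\<Sum>i\<in>K. (a i)\<^sup>2) \<le> r\<^sup>2}"
  have finF: "finite F" unfolding F_def using assms(1) by (intro finite_PiE) auto
  have "card G \<le> card ((\<lambda>g i. h * of_int (g i) :: real) ` F)"
    unfolding G_def using finF by (intro card_mono) auto
  also have "\<dots> \<le> card F" by (rule card_image_le[OF finF])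
  also have "card F = nat (2 * m + 1) ^ k"
    unfolding F_def using assms(1) by (simp add: card_PiE k_def)
  finally have "real (card G) \<le> real (nat (2 * m + 1) ^ k)"
    by (rule of_nat_mono)
  also have "\<dots> = real (nat (2 * m + 1)) ^ k" by (rule of_nat_power)
  also have "real (nat (2 * m + 1)) = 2 * of_int m + 1" using m by simp
  also have "(2 * of_int m + 1) ^ k \<le> (2 * (sqrt k / \<eta>) + 1) ^ k"
  proof (rule power_mono)
    have "of_int m \<le> r / h" unfolding m_def by (rule of_int_floor_le)
    then show "2 * of_int m + 1 \<le> 2 * (sqrt k / \<eta>) + 1" unfolding rh by simp
  qed (use m in simp)
  finally have card: "real (card G) \<le> (2 * sqrt k / \<eta> + 1) ^ k" by simp
  have "\<exists>a\<in>G. (1 - \<eta>) * r\<^sup>2 \<le> (\<Sum>i\<in>K. a i * z i)" if z: "r\<^sup>2 < (\<Sum>i\<in>K. (z i)\<^sup>2)" for z :: "nat \<Rightarrow> real"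
  proof -
    define s where "s = L2_set z K"
    have s2: "s\<^sup>2 = (\<Sum>i\<in>K. (z i)\<^sup>2)" by (simp add: s_def L2_set_def sum_nonneg)
    have "r\<^sup>2 < s\<^sup>2" using z s2 by simp
    then have "r < s" by (rule power2_less_imp_less) (simp add: s_def)
    then have s: "0 < s" "r < s" using assms by auto
    define t where "t i = r * \<bar>z i\<bar> / s" for i
    have t0: "0 \<le> t i" for i using assms s by (simp add: t_def)
    have zs: "\<bar>z i\<bar> \<le> s" if "i \<in> K" for i
      using member_le_L2_set[OF assms(1) that, of "\<lambda>i. \<bar>z i\<bar>"]
      unfolding s_def L2_set_def power2_abs .
    have tr: "t i \<le> r" if "i \<in> K" for i
      using zs[OF that] assms s by (simp add: t_def field_simps)
    define g0 where "g0 i = \<lfloor>t i / h\<rfloor>" for i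
    have g0: "0 \<le> g0 i" for i using t0 h by (simp add: g0_def)
    have g0m: "g0 i \<le> m" if "i \<in> K" for i
      unfolding g0_def m_def using tr[OF that] h by (intro floor_mono divide_right_mono) auto
    have up: "h * of_int (g0 i) \<le> t i" for i
      using of_int_floor_le[of "t i / h"] h by (simp only: g0_def pos_le_divide_eq mult.commute)
    have low: "t i - h \<le> h * of_int (g0 i)" for i
    proof -
      have "t i / h - 1 \<le> of_int (g0 i)" unfolding g0_def by linarith
      then have "h * (t i / h - 1) \<le> h * of_int (g0 i)" using h by (intro mult_left_mono) auto
      then show ?thesis using h by (simp add: algebra_simps)
    qed
    define g where "g = restrict (\<lambda>i. if 0 \<le> z i then g0 i else - g0 i) K"
    define a where "a = (\<lambda>i. h * of_int (g i))"
    have gF: "g \<in> F"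
    proof -
      have "(if 0 \<le> z i then g0 i else - g0 i) \<in> {-m..m}" if "i \<in> K" for i
        using g0[of i] g0m[OF that] m by auto
      then show ?thesis unfolding F_def g_def by (intro restrict_PiE_iff[THEN iffD2]) auto
    qed
    have a2: "(a i)\<^sup>2 = (h * of_int (g0 i))\<^sup>2" if "i \<in> K" for i
      using that by (simp add: a_def g_def power_mult_distrib)
    have az: "a i * z i = h * of_int (g0 i) * \<bar>z i\<bar>" if "i \<in> K" for i
      using that by (simp add: a_def g_def)
    have "(\<Sum>i\<in>K. (a i)\<^sup>2) \<le> (\<Sum>i\<in>K. (t i)\<^sup>2)"
      using a2 up g0 h by (intro sum_mono) (auto intro!: power_mono)
    also have "\<dots> = (r / s)\<^sup>2 * (\<Sum>i\<in>K. (z i)\<^sup>2)"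
      by (simp add: t_def sum_distrib_left power_mult_distrib power_divide)
    also have "\<dots> = r\<^sup>2" using s by (simp add: s2[symmetric] power_divide)
    finally have aG: "a \<in> G" using gF by (auto simp: G_def a_def)
    have "(\<Sum>i\<in>K. \<bar>z i\<bar>) \<le> L2_set (\<lambda>_. 1) K * L2_set z K"
      using L2_set_mult_ineq[where f = "\<lambda>_. 1" and g = z and A = K] by simp
    also have "\<dots> = sqrt k * s" by (simp add: L2_set_def s_def k_def)
    finally have l1: "(\<Sum>i\<in>K. \<bar>z i\<bar>) \<le> sqrt k * s" .
    have "(1 - \<eta>) * r\<^sup>2 \<le> (1 - \<eta>) * (r * s)"
      using assms s by (intro mult_left_mono) (auto simp: power2_eq_square)
    also have "\<dots> = r * s - h * (sqrt k * s)"
      using k by (simp add: h_def field_simps)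
    also have "\<dots> \<le> r * s - h * (\<Sum>i\<in>K. \<bar>z i\<bar>)"
      using l1 h by simp
    also have "r * s = (\<Sum>i\<in>K. t i * \<bar>z i\<bar>)"
    proof -
      have "(\<Sum>i\<in>K. t i * \<bar>z i\<bar>) = (r / s) * (\<Sum>i\<in>K. (z i)\<^sup>2)"
        by (simp add: t_def sum_distrib_left power2_eq_square mult.assoc)
      also have "\<dots> = r * s" unfolding s2[symmetric] using s by (simp add: power2_eq_square)
      finally show ?thesis by simp
    qed
    also have "(\<Sum>i\<in>K. t i * \<bar>z i\<bar>) - h * (\<Sum>i\<in>K. \<bar>z i\<bar>) = (\<Sum>i\<in>K. (t i - h) * \<bar>z i\<bar>)"
      by (simp add: algebra_simps sum_subtractf sum_distrib_left)
    also have "\<dots> \<le> (\<Sum>i\<in>K. a i * z i)"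
      using az low by (intro sum_mono) (auto intro!: mult_right_mono)
    finally show ?thesis using aG by blast
  qed
  note near = this
  show ?thesis
  proof (rule that)
    show "finite G" using finF by (simp add: G_def)
    show "real (card G) \<le> (2 * sqrt (real (card K)) / \<eta> + 1) ^ card K"
      using card by (simp add: k_def)
    show "(\<Sum>i\<in>K. (a i)\<^sup>2) \<le> r\<^sup>2" if "a \<in> G" for a
      using that by (simp add: G_def)
  qed (rule near)
qed

text \<open>\<open>S\<close> is quantified after \<open>G\<close>: the net is fixed before the score
  is seen, as a union bound requires. If \<open>S\<close> stays below the threshold on the net, its
  coefficient vector in the orthonormal basis has length at most \<open>r\<close>, and completing
  the square gives the conclusion.\<close>

lemma complement_net:
  fixes r \<eta> :: real
  assumes "finite K" "K \<noteq> {}" "finite J" "J \<inter> K = {}" "pos_def_on (J \<union> K) A"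
    "0 < \<eta>" "\<eta> \<le> 1" "0 < r"
  obtains G :: "(nat \<Rightarrow> real) set" where "finite G" "G \<subseteq> coord_space (J \<union> K)"
    "real (card G) \<le> (2 * sqrt (real (card K)) / \<eta> + 1) ^ card K"
    "\<And>u. u \<in> G \<Longrightarrow> bform (J \<union> K) A u u \<le> r\<^sup>2"
    "\<And>S w. (\<And>c v. S (\<lambda>j. \<Sum>i\<in>K. c i * v i j) = (\<Sum>i\<in>K. c i * (S (v i) :: real))) \<Longrightarrow>
       (\<And>u. u \<in> G \<Longrightarrow> S u < (1 - \<eta>) * r\<^sup>2) \<Longrightarrow> w \<in> coord_space (J \<union> K) \<Longrightarrow>
       (\<And>v. v \<in> coord_space J \<Longrightarrow> bform (J \<union> K) A v w = 0) \<Longrightarrow>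
       S w - bform (J \<union> K) A w w / 2 \<le> r\<^sup>2 / 2"
proof -
  let ?L = "J \<union> K"
  obtain e where e: "\<And>i. i \<in> K \<Longrightarrow> e i \<in> coord_space ?L"
    "\<And>i l. i \<in> K \<Longrightarrow> l \<in> K \<Longrightarrow> bform ?L A (e i) (e l) = (if i = l then 1 else 0)"
    "\<And>u. u\<in>coord_space ?L \<Longrightarrow> (\<And>v. v\<in>coord_space J \<Longrightarrow> bform ?L A v u = 0) \<Longrightarrow>
       (\<exists>c. u = (\<lambda>j. \<Sum>i\<in>K. c i * e i j))"
    using orthonormal_basis_of_complement[OF assms(1,3,4,5)] by blast
  define comb where "comb c = (\<lambda>j. \<Sum>i\<in>K. c i * e i j)" for c
  obtain G0 :: "(nat \<Rightarrow> real) set" where G0: "finite G0"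
    "real (card G0) \<le> (2 * sqrt (real (card K)) / \<eta> + 1) ^ card K"
    "\<And>a. a \<in> G0 \<Longrightarrow> (\<Sum>i\<in>K. (a i)\<^sup>2) \<le> r\<^sup>2"
    "\<And>z. r\<^sup>2 < (\<Sum>i\<in>K. (z i)\<^sup>2) \<Longrightarrow> \<exists>a\<in>G0. (1 - \<eta>) * r\<^sup>2 \<le> (\<Sum>i\<in>K. a i * z i)"
    using direction_grid[OF assms(1,2,6,7,8)] by blast
  have norm: "bform ?L A (comb c) (comb c) = (\<Sum>i\<in>K. (c i)\<^sup>2)" for c
  proof -
    have "bform ?L A (comb c) (comb c) = (\<Sum>i\<in>K. c i * (\<Sum>l\<in>K. c l * bform ?L A (e i) (e l)))"
      unfolding comb_def bform_sum_left bform_sum_right ..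
    also have "\<dots> = (\<Sum>i\<in>K. c i * (\<Sum>l\<in>K. if i = l then c l else 0))"
      using e(2) by (intro sum.cong refl arg_cong2[where f="(*)"]) auto
    also have "\<dots> = (\<Sum>i\<in>K. (c i)\<^sup>2)" using assms(1) by (simp add: power2_eq_square)
    finally show ?thesis .
  qed
  show ?thesis
  proof (rule that[of "comb ` G0"])
    show "finite (comb ` G0)" using G0 by simp
    show "comb ` G0 \<subseteq> coord_space ?L"
      unfolding comb_def using e(1) by (auto intro!: coord_space_sum)
    show "real (card (comb ` G0)) \<le> (2 * sqrt (real (card K)) / \<eta> + 1) ^ card K"
      using G0(2) card_image_le[OF G0(1), of comb] by linarith
    show "bform ?L A u u \<le> r\<^sup>2" if "u \<in> comb ` G0" for u
      using that G0(3) norm by auto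
    fix S :: "(nat \<Rightarrow> real) \<Rightarrow> real" and w
    assume S: "\<And>c v. S (\<lambda>j. \<Sum>i\<in>K. c i * v i j) = (\<Sum>i\<in>K. c i * S (v i))"
      and G: "\<And>u. u \<in> comb ` G0 \<Longrightarrow> S u < (1 - \<eta>) * r\<^sup>2"
      and w: "w \<in> coord_space ?L" "\<And>v. v \<in> coord_space J \<Longrightarrow> bform ?L A v w = 0"
    obtain c where c: "w = comb c" using e(3)[OF w] by (auto simp: comb_def)
    define z where "z i = S (e i)" for i
    have Sc: "S (comb a) = (\<Sum>i\<in>K. a i * z i)" for a
      unfolding comb_def z_def by (rule S)
    have "(\<Sum>i\<in>K. (z i)\<^sup>2) \<le> r\<^sup>2"
    proof (rule ccontr)
      assume "\<not> ?thesis"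
      then obtain a where "a \<in> G0" "(1 - \<eta>) * r\<^sup>2 \<le> (\<Sum>i\<in>K. a i * z i)" using G0(4)[of z] by auto
      then show False using G[of "comb a"] Sc[of a] by auto
    qed
    moreover have "c i * z i - (c i)\<^sup>2 / 2 \<le> (z i)\<^sup>2 / 2" for i
      using zero_le_power2[of "c i - z i"] by (simp add: power2_diff)
    then have "(\<Sum>i\<in>K. c i * z i - (c i)\<^sup>2 / 2) \<le> (\<Sum>i\<in>K. (z i)\<^sup>2 / 2)" by (intro sum_mono)
    ultimately show "S w - bform ?L A w w / 2 \<le> r\<^sup>2 / 2"
      unfolding c norm Sc by (simp add: sum_subtractf sum_divide_distrib[symmetric])
  qed
qed

section \<open>Exponential families\<close>

lemma exp_family_integrable:
  assumes "exp_family \<mu> b"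
  shows "integrable \<mu> (\<lambda>y. exp (y * \<theta>))" "(\<integral>y. exp (y * \<theta>) \<partial>\<mu>) = exp (b \<theta>)"
proof -
  have [measurable_cong]: "sets \<mu> = sets borel" using assms by (simp add: exp_family_def)
  have nn: "(\<integral>\<^sup>+ y. ennreal (exp (y * \<theta>)) \<partial>\<mu>) = ennreal (exp (b \<theta>))"
    using assms by (simp add: exp_family_def)
  show "integrable \<mu> (\<lambda>y. exp (y * \<theta>))"
    by (rule integrableI_nonneg) (use nn in auto)
  show "(\<integral>y. exp (y * \<theta>) \<partial>\<mu>) = exp (b \<theta>)"
    by (rule integral_eq_nn_integral[THEN trans]) (use nn in auto)
qed

text \<open>The exponential is expanded under the integral. Its partial sums are dominated by the
  sum of the exponentials at \<theta> and at minus \<theta>, both integrable since every real number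
  is a natural parameter. The coefficients are moments divided by factorials.\<close>

lemma exp_family_power_series:
  assumes "exp_family \<mu> b"
  obtains c where "\<And>\<theta>. summable (\<lambda>k. c k * \<theta> ^ k)" "\<And>\<theta>. exp (b \<theta>) = (\<Sum>k. c k * \<theta> ^ k)"
proof -
  have [measurable_cong]: "sets \<mu> = sets borel" using assms by (simp add: exp_family_def)
  note int = exp_family_integrable[OF assms]
  define c where "c k = (\<integral>y. y ^ k / fact k \<partial>\<mu>)" for k :: nat
  have sums: "(\<lambda>k. c k * \<theta> ^ k) sums exp (b \<theta>)" for \<theta>
  proof -
    define f where "f k y = (y * \<theta>) ^ k / fact k" for k :: nat and y :: real
    have fsums: "(\<lambda>k. f k y) sums exp (y * \<theta>)" for y
      using exp_converges[of "y * \<theta>"] by (simp add: f_def divide_inverse mult.commute scaleR_conv_of_real)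
    have nsums: "(\<lambda>k. norm (f k y)) sums exp \<bar>y * \<theta>\<bar>" for y
      using exp_converges[of "\<bar>y * \<theta>\<bar>"]
      by (simp add: f_def divide_inverse mult.commute scaleR_conv_of_real abs_mult power_abs)
    have dom: "integrable \<mu> (\<lambda>y. exp (y * \<theta>) + exp (y * (- \<theta>)))"
      using int(1)[of \<theta>] int(1)[of "- \<theta>"] by (rule Bochner_Integration.integrable_add)
    have expabs: "exp \<bar>y * \<theta>\<bar> \<le> exp (y * \<theta>) + exp (y * (- \<theta>))" for y
      by (auto simp: abs_if)
    have part: "(\<Sum>k<n. norm (f k y)) \<le> exp (y * \<theta>) + exp (y * (- \<theta>))" for n y
      using sum_le_suminf[OF sums_summable[OF nsums], of "{..<n}" y] sums_unique[OF nsums, of y] expabs[of y]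
      by auto
    have meas: "f k \<in> borel_measurable \<mu>" for k unfolding f_def by measurable
    have intf: "integrable \<mu> (f k)" for k
    proof (rule Bochner_Integration.integrable_bound[OF dom meas])
      have "norm (f k y) \<le> norm (exp (y * \<theta>) + exp (y * (- \<theta>)))" for y
      proof -
        have "norm (f k y) \<le> (\<Sum>k<Suc k. norm (f k y))"
          by (simp add: sum_nonneg)
        also have "\<dots> \<le> exp (y * \<theta>) + exp (y * (- \<theta>))" by (rule part)
        finally show ?thesis by simp
      qed
      then show "AE y in \<mu>. norm (f k y) \<le> norm (exp (y * \<theta>) + exp (y * (- \<theta>)))" by simp
    qed
    have "(\<lambda>k. \<integral>y. f k y \<partial>\<mu>) sums (\<integral>y. (\<Sum>k. f k y) \<partial>\<mu>)"
    proof (rule sums_integral[OF intf])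
      show "AE y in \<mu>. summable (\<lambda>k. norm (f k y))"
        using nsums by (auto dest: sums_summable)
      show "summable (\<lambda>k. \<integral>y. norm (f k y) \<partial>\<mu>)"
      proof (rule summableI_nonneg_bounded)
        show "0 \<le> (\<integral>y. norm (f k y) \<partial>\<mu>)" for k by simp
        fix n
        have "(\<Sum>k<n. \<integral>y. norm (f k y) \<partial>\<mu>) = (\<integral>y. (\<Sum>k<n. norm (f k y)) \<partial>\<mu>)"
          using intf by (intro Bochner_Integration.integral_sum[symmetric]) auto
        also have "\<dots> \<le> (\<integral>y. exp (y * \<theta>) + exp (y * (- \<theta>)) \<partial>\<mu>)"
          using intf dom part by (intro integral_mono) auto
        finally show "(\<Sum>k<n. \<integral>y. norm (f k y) \<partial>\<mu>) \<le> (\<integral>y. exp (y * \<theta>) + exp (y * (- \<theta>)) \<partial>\<mu>)" .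
      qed
    qed
    moreover have "(\<integral>y. (\<Sum>k. f k y) \<partial>\<mu>) = exp (b \<theta>)"
      using int(2) by (simp only: sums_unique[OF fsums, symmetric])
    moreover have "(\<integral>y. f k y \<partial>\<mu>) = c k * \<theta> ^ k" for k
    proof -
      have "f k = (\<lambda>y. \<theta> ^ k * (y ^ k / fact k))"
        by (simp add: f_def power_mult_distrib fun_eq_iff)
      then show ?thesis by (simp add: c_def mult.commute)
    qed
    ultimately show ?thesis by simp
  qed
  show ?thesis
    by (rule that[of c]) (use sums in \<open>auto dest: sums_summable sums_unique\<close>)
qed

text \<open>\<open>b\<close> is the logarithm of a positive power series that converges everywhere.
  The series is differentiated three times because continuity of \<open>Z2\<close> comes from its
  derivative \<open>Z3\<close>.\<close>

lemma exp_family_smooth: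
  assumes "exp_family \<mu> b"
  obtains b' b'' where "\<And>x. (b has_real_derivative b' x) (at x)"
    "\<And>x. (b' has_real_derivative b'' x) (at x)" "continuous_on UNIV b''"
proof -
  obtain c where c: "\<And>\<theta>. summable (\<lambda>k. c k * \<theta> ^ k)" "\<And>\<theta>. exp (b \<theta>) = (\<Sum>k. c k * \<theta> ^ k)"
    using exp_family_power_series[OF assms] by blast
  define Z where "Z = (\<lambda>\<theta>. \<Sum>k. c k * \<theta> ^ k)"
  define Z1 where "Z1 = (\<lambda>\<theta>. \<Sum>k. diffs c k * \<theta> ^ k)"
  define Z2 where "Z2 = (\<lambda>\<theta>. \<Sum>k. diffs (diffs c) k * \<theta> ^ k)"
  define Z3 where "Z3 = (\<lambda>\<theta>. \<Sum>k. diffs (diffs (diffs c)) k * \<theta> ^ k)"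
  note s1 = termdiff_converges_all[OF c(1)]
  note s2 = termdiff_converges_all[OF s1]
  have DZ: "(Z has_real_derivative Z1 x) (at x)" for x
    unfolding Z_def Z1_def by (rule termdiffs_strong_converges_everywhere[OF c(1)])
  have DZ1: "(Z1 has_real_derivative Z2 x) (at x)" for x
    unfolding Z1_def Z2_def by (rule termdiffs_strong_converges_everywhere[OF s1])
  have DZ2: "(Z2 has_real_derivative Z3 x) (at x)" for x
    unfolding Z2_def Z3_def by (rule termdiffs_strong_converges_everywhere[OF s2])
  have Z: "Z x = exp (b x)" for x using c by (simp add: Z_def)
  have Zpos: "Z x > 0" for x by (simp add: Z)
  have b: "b = (\<lambda>x. ln (Z x))" by (simp add: Z fun_eq_iff)
  have ct: "continuous_on UNIV Z" "continuous_on UNIV Z1" "continuous_on UNIV Z2"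
    using DZ DZ1 DZ2 by (auto intro!: DERIV_continuous_on)
  show ?thesis
  proof
    show "(b has_real_derivative Z1 x / Z x) (at x)" for x
      unfolding b using Zpos[of x] by (auto intro!: derivative_eq_intros DZ)
    show "((\<lambda>x. Z1 x / Z x) has_real_derivative (Z2 x * Z x - Z1 x * Z1 x) / (Z x * Z x)) (at x)" for x
      using Zpos[of x] by (auto intro!: derivative_eq_intros DZ DZ1)
    show "continuous_on UNIV (\<lambda>x. (Z2 x * Z x - Z1 x * Z1 x) / (Z x * Z x))"
      using Zpos by (intro continuous_intros ct) (simp add: less_imp_neq[symmetric])
  qed
qed

lemma exp_family_deriv:
  assumes "exp_family \<mu> b"
  shows "(b has_real_derivative deriv b x) (at x)"
    "(deriv b has_real_derivative deriv (deriv b) x) (at x)"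
    "continuous_on UNIV (deriv (deriv b))"
proof -
  obtain b' b'' where d: "\<And>x. (b has_real_derivative b' x) (at x)"
    "\<And>x. (b' has_real_derivative b'' x) (at x)" "continuous_on UNIV b''"
    using exp_family_smooth[OF assms] by blast
  have 1: "deriv b = b'" using d DERIV_imp_deriv by blast
  have 2: "deriv b' = b''" using d DERIV_imp_deriv by blast
  show "(b has_real_derivative deriv b x) (at x)"
    "(deriv b has_real_derivative deriv (deriv b) x) (at x)"
    "continuous_on UNIV (deriv (deriv b))"
    using d by (simp_all add: 1 2)
qed

text \<open>Multiplying the density by \<open>exp (t * y)\<close> merely shifts the natural
  parameter, so the moment generating function is a quotient of normalising constants.\<close>

lemma exp_family_mgf:
  assumes "exp_family \<mu> b" "distributed M \<mu> Z (\<lambda>y. ennreal (exp (y * \<theta> - b \<theta>)))"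
  shows "(\<integral>\<^sup>+\<omega>. ennreal (exp (t * Z \<omega>)) \<partial>M) = ennreal (exp (b (\<theta> + t) - b \<theta>))"
proof -
  have [measurable_cong]: "sets \<mu> = sets borel" using assms by (simp add: exp_family_def)
  have "(\<integral>\<^sup>+\<omega>. ennreal (exp (t * Z \<omega>)) \<partial>M) =
      (\<integral>\<^sup>+y. ennreal (exp (y * \<theta> - b \<theta>)) * ennreal (exp (t * y)) \<partial>\<mu>)"
    by (rule distributed_nn_integral[OF assms(2), symmetric]) measurable
  also have "\<dots> = (\<integral>\<^sup>+y. ennreal (exp (- b \<theta>)) * ennreal (exp (y * (\<theta> + t))) \<partial>\<mu>)"
    by (intro nn_integral_cong)
      (simp add: ennreal_mult[symmetric] mult_exp_exp algebra_simps)
  also have "\<dots> = ennreal (exp (- b \<theta>)) * (\<integral>\<^sup>+y. ennreal (exp (y * (\<theta> + t))) \<partial>\<mu>)"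
    by (rule nn_integral_cmult) measurable
  also have "\<dots> = ennreal (exp (- b \<theta>)) * ennreal (exp (b (\<theta> + t)))"
    using assms(1) by (simp add: exp_family_def)
  also have "\<dots> = ennreal (exp (b (\<theta> + t) - b \<theta>))"
    by (simp add: ennreal_mult[symmetric] mult_exp_exp)
  finally show ?thesis .
qed

section \<open>Likelihood geometry\<close>

lemma lin_pred_add: "lin_pred p X i (\<lambda>j. u j + v j) = lin_pred p X i u + lin_pred p X i v"
  by (simp add: lin_pred_def algebra_simps sum.distrib)

lemma lin_pred_scale: "lin_pred p X i (\<lambda>j. a * u j) = a * lin_pred p X i u"
  by (simp add: lin_pred_def algebra_simps sum_distrib_left)

lemma lin_pred_zero [simp]: "lin_pred p X i (\<lambda>_. 0) = 0"
  by (simp add: lin_pred_def)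

lemma bform_neg_hess:
  "bform {1..p} (neg_hess n p X b \<beta>) u v =
     (\<Sum>i\<in>{1..n}. lin_pred p X i u * lin_pred p X i v * deriv (deriv b) (lin_pred p X i \<beta>))"
proof -
  have "bform {1..p} (neg_hess n p X b \<beta>) u v =
     (\<Sum>j\<in>{1..p}. \<Sum>k\<in>{1..p}. \<Sum>i\<in>{1..n}.
        X i j * u j * (X i k * v k) * deriv (deriv b) (lin_pred p X i \<beta>))"
    by (simp add: bform_def neg_hess_def sum_distrib_left sum_distrib_right algebra_simps)
  also have "\<dots> = (\<Sum>i\<in>{1..n}. \<Sum>j\<in>{1..p}. \<Sum>k\<in>{1..p}.
        X i j * u j * (X i k * v k) * deriv (deriv b) (lin_pred p X i \<beta>))"
    by (subst (2) sum.swap, subst sum.swap) (rule refl)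
  also have "\<dots> = (\<Sum>i\<in>{1..n}. lin_pred p X i u * lin_pred p X i v * deriv (deriv b) (lin_pred p X i \<beta>))"
    unfolding lin_pred_def[of p X _ u] lin_pred_def[of p X _ v] sum_product
      sum_distrib_right sum_distrib_left
    by (intro sum.cong refl sum.swap)
  finally show ?thesis .
qed

lemma neg_hess_sym: "neg_hess n p X b \<beta> j k = neg_hess n p X b \<beta> k j"
  by (simp add: neg_hess_def mult.commute mult.left_commute)

lemma L2_set_coord_space:
  assumes "u \<in> coord_space J" "finite L" "J \<subseteq> L"
  shows "L2_set u L = L2_set u J"
proof -
  have "(\<Sum>i\<in>L. (u i)\<^sup>2) = (\<Sum>i\<in>J. (u i)\<^sup>2)"
    using assms by (intro sum.mono_neutral_right) (auto simp: coord_space_def)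
  then show ?thesis by (simp add: L2_set_def)
qed

lemma L2_set_scale: "L2_set (\<lambda>j. a * u j) J = \<bar>a\<bar> * L2_set u J"
  by (simp add: L2_set_def power_mult_distrib sum_distrib_left[symmetric] real_sqrt_mult)

lemma L2_set_eq_0_coord_space:
  assumes "u \<in> coord_space J" "finite J" "L2_set u J = 0"
  shows "u = (\<lambda>_. 0)"
  using assms by (auto simp: L2_set_eq_0_iff coord_space_def)

lemma bform_scalar_matrix:
  assumes "finite J"
  shows "bform J (scalar_matrix c) v v = c * (L2_set v J)\<^sup>2"
proof -
  have "bform J (scalar_matrix c) v v = (\<Sum>j\<in>J. \<Sum>k\<in>J. if j = k then c * (v k)\<^sup>2 else 0)"
    unfolding bform_def
    by (intro sum.cong refl) (auto simp: scalar_matrix_def power2_eq_square)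
  also have "\<dots> = c * (L2_set v J)\<^sup>2"
    using assms by (simp add: L2_set_def sum_nonneg sum_distrib_left)
  finally show ?thesis .
qed

lemma loewner_le_bform:
  "loewner_le J A B \<longleftrightarrow> (\<forall>v\<in>coord_space J. bform J A v v \<le> bform J B v v)"
proof -
  have "(\<Sum>j\<in>J. \<Sum>k\<in>J. v j * (B j k - A j k) * v k) = bform J B v v - bform J A v v" for v
    by (simp add: bform_def algebra_simps sum_subtractf)
  then show ?thesis by (simp add: loewner_le_def)
qed

lemma bform_scaled_matrix: "bform J (\<lambda>j k. c * A j k) u v = c * bform J A u v"
  by (simp add: bform_def sum_distrib_left algebra_simps)

lemma bform_diff_matrix: "bform J (\<lambda>j k. A j k - B j k) u v = bform J A u v - bform J B u v"
  by (simp add: bform_def algebra_simps sum_subtractf)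

text \<open>The supremum in \<open>spectral_norm\<close> can be used only once its range is known to
  be bounded above; Cauchy-Schwarz in each row supplies the bound, and \<open>v\<close> is scaled to
  norm 1.\<close>

lemma bform_le_spectral_norm:
  assumes "finite J" "v \<in> coord_space J"
  shows "\<bar>bform J A v v\<bar> \<le> spectral_norm J A * (L2_set v J)\<^sup>2"
proof (cases "v = (\<lambda>_. 0)")
  case True
  then show ?thesis by (simp add: L2_set_def)
next
  case False
  define s where "s = L2_set v J"
  have s: "s > 0"
    unfolding s_def using L2_set_eq_0_coord_space[OF assms(2,1)] False L2_set_nonneg[of v J]
    by (metis antisym_conv1 not_less)
  define B where "B = {v \<in> coord_space J. L2_set v J \<le> 1}"
  define Av where "Av v = L2_set (\<lambda>j. \<Sum>k\<in>J. A j k * v k) J" for v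
  have bdd: "bdd_above (Av ` B)"
  proof (rule bdd_aboveI2)
    fix u assume u: "u \<in> B"
    have "Av u \<le> L2_set (\<lambda>j. L2_set (A j) J) J"
      unfolding Av_def L2_set_def[of _ J]
    proof (intro real_sqrt_le_mono sum_mono)
      fix j
      have "\<bar>\<Sum>k\<in>J. A j k * u k\<bar> \<le> (\<Sum>k\<in>J. \<bar>A j k\<bar> * \<bar>u k\<bar>)"
        by (rule order_trans[OF sum_abs]) (simp add: abs_mult)
      also have "\<dots> \<le> L2_set (A j) J * L2_set u J" by (rule L2_set_mult_ineq)
      also have "\<dots> \<le> L2_set (A j) J" using u by (intro mult_left_le) (auto simp: B_def)
      finally have "\<bar>\<Sum>k\<in>J. A j k * u k\<bar> \<le> \<bar>L2_set (A j) J\<bar>" by simp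
      then show "(\<Sum>k\<in>J. A j k * u k)\<^sup>2 \<le> (sqrt (\<Sum>i\<in>J. (A j i)\<^sup>2))\<^sup>2"
        unfolding L2_set_def[symmetric] by (rule abs_le_square_iff[THEN iffD1])
    qed
    then show "Av u \<le> L2_set (\<lambda>j. L2_set (A j) J) J" .
  qed
  define u where "u = (\<lambda>j. (1 / s) * v j)"
  have "L2_set u J = 1" unfolding u_def L2_set_scale using s by (simp add: s_def)
  then have uB: "u \<in> B" using coord_space_scale[OF assms(2), of "1 / s"] by (simp add: B_def u_def)
  have "Av u = Av v / s"
  proof -
    have "(\<lambda>j. \<Sum>k\<in>J. A j k * u k) = (\<lambda>j. (1 / s) * (\<Sum>k\<in>J. A j k * v k))"
      by (simp add: u_def sum_distrib_left fun_eq_iff algebra_simps)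
    then show ?thesis unfolding Av_def using L2_set_scale[of "1 / s"] s by simp
  qed
  moreover have "Av u \<le> spectral_norm J A"
    using cSUP_upper[OF uB bdd] by (simp add: spectral_norm_def Av_def B_def)
  ultimately have le: "Av v \<le> spectral_norm J A * s" using s by (simp add: pos_divide_le_eq)
  have "\<bar>bform J A v v\<bar> \<le> (\<Sum>j\<in>J. \<bar>v j\<bar> * \<bar>\<Sum>k\<in>J. A j k * v k\<bar>)"
    unfolding bform_alt by (rule order_trans[OF sum_abs]) (simp add: abs_mult)
  also have "\<dots> \<le> s * Av v" unfolding s_def Av_def by (rule L2_set_mult_ineq)
  also have "\<dots> \<le> s * (spectral_norm J A * s)" using le s by (intro mult_left_mono) auto
  finally show ?thesis by (simp add: s_def power2_eq_square algebra_simps)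
qed

text \<open>Tychonoff's theorem in the product topology on \<open>nat \<Rightarrow> real\<close>.
  Existence and measurability of the estimators both rest on this compactness.\<close>

lemma compact_box:
  "compact {\<beta> :: nat \<Rightarrow> real. \<forall>j. \<beta> j \<in> (if j \<in> J then {-B..B} else {0})}"
proof -
  let ?S = "\<lambda>j. if j \<in> J then {-B..B} else {0 :: real}"
  have "compactin (product_topology (\<lambda>_. euclidean) UNIV) (PiE UNIV ?S)"
    by (subst compactin_PiE) auto
  then have "compact (PiE UNIV ?S)"
    by (simp add: euclidean_product_topology compactin_euclidean_iff)
  also have "PiE UNIV ?S = {\<beta>. \<forall>j. \<beta> j \<in> ?S j}"
    unfolding PiE_UNIV_domain Pi_def by simp
  finally show ?thesis .
qed

lemma continuous_on_lin_pred: "continuous_on S (lin_pred p X i)"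
proof -
  have "continuous_on UNIV (lin_pred p X i)"
    unfolding lin_pred_def by (intro continuous_intros continuous_on_product_coordinates)
  then show ?thesis by (rule continuous_on_subset) auto
qed

lemma closed_coord_space: "closed (coord_space J)"
proof -
  have "coord_space J = (\<Inter>j\<in>-J. {\<beta>. \<beta> j = 0})" by (auto simp: coord_space_def)
  moreover have "closed {\<beta> :: nat \<Rightarrow> real. \<beta> j = 0}" for j
    by (intro closed_Collect_eq continuous_on_product_coordinates continuous_on_const)
  ultimately show ?thesis by auto
qed

text \<open>First-order optimality without derivatives: at \<open>t = g / D\<close>, with
  \<open>D\<close> larger than both \<open>C\<close> and the modulus of \<open>g\<close>, a nonzero
  linear term would exceed the quadratic one.\<close>

lemma linear_le_quadratic_imp_zero:
  fixes g C :: real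
  assumes "\<And>t. \<bar>t\<bar> \<le> 1 \<Longrightarrow> t * g \<le> C * t\<^sup>2"
  shows "g = 0"
proof (rule ccontr)
  assume "g \<noteq> 0"
  define D where "D = \<bar>C\<bar> + \<bar>g\<bar> + 1"
  have D: "D > 0" "\<bar>g\<bar> < D" "C < D" unfolding D_def by linarith+
  define t where "t = g / D"
  have "\<bar>t\<bar> \<le> 1" using D by (simp add: t_def)
  then have "t * g \<le> C * t\<^sup>2" by (rule assms)
  then have "g\<^sup>2 / D \<le> C * g\<^sup>2 / D\<^sup>2" by (simp add: t_def power2_eq_square)
  then have "g\<^sup>2 * D \<le> C * g\<^sup>2" using D by (simp add: field_simps power2_eq_square)
  then have "D \<le> C" using \<open>g \<noteq> 0\<close> by (simp add: mult.commute)
  then show False using D by simp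
qed

definition bregman ::
  "nat \<Rightarrow> nat \<Rightarrow> (nat \<Rightarrow> nat \<Rightarrow> real) \<Rightarrow> (real \<Rightarrow> real) \<Rightarrow> (nat \<Rightarrow> real) \<Rightarrow> (nat \<Rightarrow> real) \<Rightarrow> real" where
  "bregman n p X b \<beta> d = (\<Sum>i\<in>{1..n}. b (lin_pred p X i \<beta> + lin_pred p X i d) - b (lin_pred p X i \<beta>)
     - deriv b (lin_pred p X i \<beta>) * lin_pred p X i d)"

definition score ::
  "nat \<Rightarrow> nat \<Rightarrow> (nat \<Rightarrow> nat \<Rightarrow> real) \<Rightarrow> (real \<Rightarrow> real) \<Rightarrow> (nat \<Rightarrow> real) \<Rightarrow> (nat \<Rightarrow> real) \<Rightarrow> (nat \<Rightarrow> real) \<Rightarrow> real" where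
  "score n p X b y \<beta> d = (\<Sum>i\<in>{1..n}. (y i - deriv b (lin_pred p X i \<beta>)) * lin_pred p X i d)"

lemma score_scale: "score n p X b y \<beta> (\<lambda>j. a * u j) = a * score n p X b y \<beta> u"
  by (simp add: score_def lin_pred_scale sum_distrib_left algebra_simps)

lemma score_add: "score n p X b y \<beta> (\<lambda>j. u j + v j) = score n p X b y \<beta> u + score n p X b y \<beta> v"
  by (simp add: score_def lin_pred_add sum.distrib distrib_left)

lemma score_sum:
  "score n p X b y \<beta> (\<lambda>j. \<Sum>l\<in>I. c l * v l j) = (\<Sum>l\<in>I. c l * score n p X b y \<beta> (v l))"
proof (induction I rule: infinite_finite_induct)
  case (insert x F)
  then show ?case by (simp add: score_add score_scale)
qed (simp_all add: score_def)

text \<open>The log-likelihood is linear in the responses apart from the cumulant terms, so this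
  expansion is exact: all randomness in the increment sits in the score, and the Bregman term is
  deterministic.\<close>

lemma log_lik_add:
  "log_lik n p X b y (\<lambda>j. \<beta> j + d j) = log_lik n p X b y \<beta> + score n p X b y \<beta> d - bregman n p X b \<beta> d"
  by (simp add: log_lik_def score_def bregman_def lin_pred_add algebra_simps sum.distrib sum_subtractf)

lemma is_mle_log_lik:
  "is_mle n p X b y J \<beta> \<longleftrightarrow> \<beta> \<in> coord_space J \<and>
     (\<forall>\<beta>'\<in>coord_space J. log_lik n p X b y \<beta>' \<le> log_lik n p X b y \<beta>)"
  by (auto simp: is_mle_def is_arg_max_def lik_def not_less)

text \<open>One sample size, with no probability space: responses enter the lemmas as an arbitrary
  vector \<open>y\<close>, which makes the comparison of models deterministic. Of the exponential
  family only the smoothness of \<open>b\<close> is recorded.\<close>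

locale regular_glm =
  fixes n p q :: nat and X :: "nat \<Rightarrow> nat \<Rightarrow> real" and b :: "real \<Rightarrow> real" and \<beta>0 :: "nat \<Rightarrow> real"
    and c_lower c_upper :: "real \<Rightarrow> real" and c_change a\<^sub>0 :: real
  assumes n: "1 \<le> n" and q: "1 \<le> q"
    and b: "\<And>x. (b has_real_derivative deriv b x) (at x)"
      "\<And>x. (deriv b has_real_derivative deriv (deriv b) x) (at x)"
      "continuous_on UNIV (deriv (deriv b))"
    and \<beta>0: "\<beta>0 \<in> coord_space {1..p}" "card (support \<beta>0) \<le> q" "L2_set \<beta>0 {1..p} \<le> a\<^sub>0"
    and a0: "0 < a\<^sub>0"
    and c_lower: "\<And>t. t \<ge> 0 \<Longrightarrow> c_lower t > 0" "antimono_on {0..} c_lower"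
    and c_upper: "\<And>t. t \<ge> 0 \<Longrightarrow> c_upper t > 0" "mono_on {0..} c_upper"
    and c_change: "0 < c_change"
    and regular: "\<And>J. J \<in> submodels p (2 * q) \<Longrightarrow> support \<beta>0 \<subseteq> J \<Longrightarrow>
      hess_regular n p X b c_lower c_upper c_change J"
begin

abbreviation "J0 \<equiv> support \<beta>0"
abbreviation "lp \<equiv> lin_pred p X"
abbreviation "nrm u \<equiv> L2_set u {1..p}"
abbreviation "hess \<beta> \<equiv> neg_hess n p X b \<beta>"
abbreviation "qf \<beta> u \<equiv> bform {1..p} (neg_hess n p X b \<beta>) u u"
abbreviation "breg \<equiv> bregman n p X b"
abbreviation "sc y \<equiv> score n p X b y"
abbreviation "ll y \<equiv> log_lik n p X b y"

text \<open>The models in which the curvature is controlled. The size \<open>2 * q\<close> leaves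
  room for the union of \<open>J0\<close> with any candidate.\<close>

definition admissible :: "nat set \<Rightarrow> bool" where
  "admissible J \<longleftrightarrow> J \<in> submodels p (2 * q) \<and> J0 \<subseteq> J"

lemma J0_subset: "J0 \<subseteq> {1..p}"
  using \<beta>0 by (auto simp: support_def coord_space_def)

lemma finite_J0: "finite J0"
  using J0_subset finite_subset by blast

lemma \<beta>0_coord: "J0 \<subseteq> J \<Longrightarrow> \<beta>0 \<in> coord_space J"
  by (auto simp: support_def coord_space_def)

lemma submodelsD: "J \<in> submodels p m \<Longrightarrow> J \<subseteq> {1..p} \<and> finite J \<and> card J \<le> m"
  by (auto simp: submodels_def intro: finite_subset)

lemma admissibleD: "admissible J \<Longrightarrow> J \<subseteq> {1..p} \<and> finite J \<and> J0 \<subseteq> J"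
  using submodelsD by (auto simp: admissible_def)

lemma J0_submodel: "J0 \<in> submodels p q"
  using \<beta>0 J0_subset by (simp add: submodels_def)

lemma admissible_union: "J \<in> submodels p q \<Longrightarrow> admissible (J0 \<union> J)"
  using \<beta>0 J0_subset card_Un_le[of J0 J] by (auto simp: admissible_def submodels_def)

lemma admissible_insert: "j \<in> {1..p} \<Longrightarrow> admissible (insert j J0)"
  using admissible_union[of "{j}"] q by (simp add: submodels_def)

lemma nrm_coord: "admissible J \<Longrightarrow> u \<in> coord_space J \<Longrightarrow> L2_set u J = nrm u"
  using L2_set_coord_space[of u J "{1..p}"] admissibleD by auto

lemma nrm_add: "nrm (\<lambda>j. u j + v j) \<le> nrm u + nrm v"
  by (rule L2_set_triangle_ineq)

lemma c_lower_anti: "0 \<le> s \<Longrightarrow> s \<le> t \<Longrightarrow> c_lower t \<le> c_lower s"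
  using c_lower(2) by (auto simp: monotone_on_def)

lemma c_upper_mono: "0 \<le> s \<Longrightarrow> s \<le> t \<Longrightarrow> c_upper s \<le> c_upper t"
  using c_upper(2) by (auto simp: monotone_on_def)

lemma qf_bounds:
  assumes "admissible J" "\<beta> \<in> coord_space J" "u \<in> coord_space J"
  shows "real n * c_lower (nrm \<beta>) * (nrm u)\<^sup>2 \<le> qf \<beta> u"
    "qf \<beta> u \<le> real n * c_upper (nrm \<beta>) * (nrm u)\<^sup>2"
proof -
  note J = admissibleD[OF assms(1)]
  have "hess_regular n p X b c_lower c_upper c_change J"
    using regular assms by (auto simp: admissible_def)
  then have *: "bform J (scalar_matrix (c_lower (L2_set \<beta> J))) u u \<le> bform J (\<lambda>j k. 1 / real n * hess \<beta> j k) u u"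
    "bform J (\<lambda>j k. 1 / real n * hess \<beta> j k) u u \<le> bform J (scalar_matrix (c_upper (L2_set \<beta> J))) u u"
    using assms by (auto simp: hess_regular_def loewner_le_bform)
  have "bform J (hess \<beta>) u u = qf \<beta> u"
    using bform_superset[of "{1..p}" J u u "hess \<beta>"] J assms by auto
  then show "real n * c_lower (nrm \<beta>) * (nrm u)\<^sup>2 \<le> qf \<beta> u"
    "qf \<beta> u \<le> real n * c_upper (nrm \<beta>) * (nrm u)\<^sup>2"
    using * J assms n unfolding bform_scaled_matrix
    by (auto simp: bform_scalar_matrix nrm_coord field_simps)
qed

lemma qf_lipschitz:
  assumes "admissible J" "\<beta> \<in> coord_space J" "\<beta>' \<in> coord_space J" "u \<in> coord_space J"
  shows "\<bar>qf \<beta> u - qf \<beta>' u\<bar> \<le> real n * c_change * nrm (\<lambda>j. \<beta> j - \<beta>' j) * (nrm u)\<^sup>2"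
proof -
  note J = admissibleD[OF assms(1)]
  have "hess_regular n p X b c_lower c_upper c_change J"
    using regular assms by (auto simp: admissible_def)
  then have "1 / real n * spectral_norm J (\<lambda>j k. hess \<beta> j k - hess \<beta>' j k)
          \<le> c_change * L2_set (\<lambda>j. \<beta> j - \<beta>' j) J"
    using assms unfolding hess_regular_def by blast
  then have 1: "spectral_norm J (\<lambda>j k. hess \<beta> j k - hess \<beta>' j k) \<le> real n * c_change * nrm (\<lambda>j. \<beta> j - \<beta>' j)"
    using n nrm_coord[OF assms(1) coord_space_diff[OF assms(2,3)]] by (simp add: field_simps)
  have "qf \<beta> u - qf \<beta>' u = bform J (\<lambda>j k. hess \<beta> j k - hess \<beta>' j k) u u"
    using bform_superset[of "{1..p}" J u u] J assms by (simp add: bform_diff_matrix)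
  then have "\<bar>qf \<beta> u - qf \<beta>' u\<bar> \<le> spectral_norm J (\<lambda>j k. hess \<beta> j k - hess \<beta>' j k) * (nrm u)\<^sup>2"
    using bform_le_spectral_norm[of J u "\<lambda>j k. hess \<beta> j k - hess \<beta>' j k"] J assms nrm_coord by auto
  also have "\<dots> \<le> real n * c_change * nrm (\<lambda>j. \<beta> j - \<beta>' j) * (nrm u)\<^sup>2"
    using 1 by (intro mult_right_mono) auto
  finally show ?thesis .
qed

lemma pos_def_hess:
  assumes "admissible J" "\<beta> \<in> coord_space J"
  shows "pos_def_on J (hess \<beta>)"
  unfolding pos_def_on_def
proof (intro conjI allI ballI impI)
  show "hess \<beta> j k = hess \<beta> k j" for j k by (rule neg_hess_sym)
  note J = admissibleD[OF assms(1)]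
  fix u assume u: "u \<in> coord_space J" "u \<noteq> (\<lambda>_. 0)"
  then have "nrm u \<noteq> 0"
    using L2_set_eq_0_coord_space[of u J] nrm_coord[OF assms(1) u(1)] J by auto
  then have "0 < real n * c_lower (nrm \<beta>) * (nrm u)\<^sup>2"
    using n c_lower(1)[of "nrm \<beta>"] by simp
  also have "\<dots> \<le> qf \<beta> u" using qf_bounds assms u by blast
  finally show "0 < bform J (hess \<beta>) u u"
    using bform_superset[of "{1..p}" J u u "hess \<beta>"] J u by auto
qed

text \<open>Lagrange remainder of second order along the segment in direction \<open>d\<close>: the
  second derivative of the cumulant sum there is the quadratic form of the Hessian.\<close>

lemma bregman_taylor:
  obtains \<xi> where "0 < \<xi>" "\<xi> < 1" "breg \<beta> d = qf (\<lambda>j. \<beta> j + \<xi> * d j) d / 2"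
proof -
  define f0 where "f0 t = (\<Sum>i\<in>{1..n}. b (lp i \<beta> + t * lp i d))" for t
  define f1 where "f1 t = (\<Sum>i\<in>{1..n}. deriv b (lp i \<beta> + t * lp i d) * lp i d)" for t
  define f2 where "f2 t = (\<Sum>i\<in>{1..n}. deriv (deriv b) (lp i \<beta> + t * lp i d) * lp i d * lp i d)" for t
  define diff where "diff m = (if m = 0 then f0 else if m = 1 then f1 else f2)" for m :: nat
  have D0: "(f0 has_real_derivative f1 t) (at t)" for t
    unfolding f0_def f1_def
    by (rule DERIV_sum) (auto intro!: derivative_eq_intros DERIV_chain2[OF b(1)])
  have D1: "(f1 has_real_derivative f2 t) (at t)" for t
    unfolding f1_def f2_def
    by (rule DERIV_sum) (auto intro!: derivative_eq_intros DERIV_chain2[OF b(2)])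
  have "\<exists>t>0. t < 1 \<and> f0 1 = (\<Sum>m<2. diff m 0 / fact m * 1 ^ m) + diff 2 t / fact 2 * 1 ^ 2"
    by (rule Maclaurin) (auto simp: diff_def D0 D1 less_2_cases_iff)
  then obtain t where t: "0 < t" "t < 1" "f0 1 = f0 0 + f1 0 + f2 t / 2"
    by (auto simp: diff_def numeral_2_eq_2)
  have "breg \<beta> d = f0 1 - f0 0 - f1 0"
    by (simp add: bregman_def f0_def f1_def sum_subtractf)
  also have "\<dots> = f2 t / 2" using t by simp
  also have "f2 t = qf (\<lambda>j. \<beta> j + t * d j) d"
    unfolding bform_neg_hess f2_def lin_pred_add lin_pred_scale
    by (intro sum.cong refl) (simp add: mult.commute mult.left_commute)
  finally show ?thesis using t that by blast
qed

lemma nrm_segment: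
  assumes "0 < \<xi>" "\<xi> < 1" "nrm \<beta> \<le> r" "nrm (\<lambda>j. \<beta> j + d j) \<le> r"
  shows "nrm (\<lambda>j. \<beta> j + \<xi> * d j) \<le> r"
proof -
  have "(\<lambda>j. \<beta> j + \<xi> * d j) = (\<lambda>j. (1 - \<xi>) * \<beta> j + \<xi> * (\<beta> j + d j))"
    by (simp add: algebra_simps)
  then have "nrm (\<lambda>j. \<beta> j + \<xi> * d j) \<le> nrm (\<lambda>j. (1 - \<xi>) * \<beta> j) + nrm (\<lambda>j. \<xi> * (\<beta> j + d j))"
    using nrm_add by metis
  also have "\<dots> = (1 - \<xi>) * nrm \<beta> + \<xi> * nrm (\<lambda>j. \<beta> j + d j)"
    unfolding L2_set_scale using assms by simp
  also have "\<dots> \<le> (1 - \<xi>) * r + \<xi> * r"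
    using assms by (intro add_mono mult_left_mono) auto
  finally show ?thesis by (simp add: algebra_simps)
qed

lemma bregman_bounds:
  assumes "admissible J" "\<beta> \<in> coord_space J" "d \<in> coord_space J"
    "nrm \<beta> \<le> r" "nrm (\<lambda>j. \<beta> j + d j) \<le> r"
  shows "real n * c_lower r * (nrm d)\<^sup>2 / 2 \<le> breg \<beta> d"
    "breg \<beta> d \<le> real n * c_upper r * (nrm d)\<^sup>2 / 2"
proof -
  obtain \<xi> where xi: "0 < \<xi>" "\<xi> < 1" "breg \<beta> d = qf (\<lambda>j. \<beta> j + \<xi> * d j) d / 2"
    using bregman_taylor by metis
  define \<beta>' where "\<beta>' = (\<lambda>j. \<beta> j + \<xi> * d j)"
  have cs: "\<beta>' \<in> coord_space J"
    using coord_space_add[OF assms(2) coord_space_scale[OF assms(3)]] by (simp add: \<beta>'_def)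
  have nr: "nrm \<beta>' \<le> r" unfolding \<beta>'_def using nrm_segment assms xi by blast
  have "real n * c_lower r * (nrm d)\<^sup>2 \<le> real n * c_lower (nrm \<beta>') * (nrm d)\<^sup>2"
    using c_lower_anti[OF _ nr] by (intro mult_right_mono mult_left_mono) auto
  then show "real n * c_lower r * (nrm d)\<^sup>2 / 2 \<le> breg \<beta> d"
    using qf_bounds(1)[OF assms(1) cs assms(3)] xi(3) by (simp add: \<beta>'_def)
  have "real n * c_upper (nrm \<beta>') * (nrm d)\<^sup>2 \<le> real n * c_upper r * (nrm d)\<^sup>2"
    using c_upper_mono[OF _ nr] by (intro mult_right_mono mult_left_mono) auto
  then show "breg \<beta> d \<le> real n * c_upper r * (nrm d)\<^sup>2 / 2"
    using qf_bounds(2)[OF assms(1) cs assms(3)] xi(3) by (simp add: \<beta>'_def)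
qed

lemma bregman_quadratic:
  assumes "admissible J" "\<beta> \<in> coord_space J" "d \<in> coord_space J"
  shows "\<bar>breg \<beta> d - qf \<beta> d / 2\<bar> \<le> real n * c_change * nrm d ^ 3 / 2"
proof -
  obtain \<xi> where xi: "0 < \<xi>" "\<xi> < 1" "breg \<beta> d = qf (\<lambda>j. \<beta> j + \<xi> * d j) d / 2"
    using bregman_taylor by metis
  define \<beta>' where "\<beta>' = (\<lambda>j. \<beta> j + \<xi> * d j)"
  have cs: "\<beta>' \<in> coord_space J"
    using coord_space_add[OF assms(2) coord_space_scale[OF assms(3)]] by (simp add: \<beta>'_def)
  have "nrm (\<lambda>j. \<beta>' j - \<beta> j) = \<xi> * nrm d"
    unfolding \<beta>'_def using L2_set_scale[of \<xi> d] xi by simp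
  also have "\<dots> \<le> nrm d" using xi by (intro mult_left_le_one_le) auto
  finally have "real n * c_change * nrm (\<lambda>j. \<beta>' j - \<beta> j) * (nrm d)\<^sup>2 \<le> real n * c_change * nrm d * (nrm d)\<^sup>2"
    using c_change by (intro mult_right_mono mult_left_mono) auto
  then have "\<bar>qf \<beta>' d - qf \<beta> d\<bar> \<le> real n * c_change * nrm d ^ 3"
    using qf_lipschitz[OF assms(1) cs assms(2,3)] by (simp add: power3_eq_cube power2_eq_square mult.assoc)
  moreover have "breg \<beta> d - qf \<beta> d / 2 = (qf \<beta>' d - qf \<beta> d) / 2"
    unfolding xi(3) \<beta>'_def by (simp add: diff_divide_distrib)
  ultimately show ?thesis by (simp only: abs_divide) simp
qed

lemma bregman_nonneg:
  assumes "admissible J" "\<beta> \<in> coord_space J" "d \<in> coord_space J"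
  shows "0 \<le> breg \<beta> d" "breg \<beta> d = 0 \<Longrightarrow> d = (\<lambda>_. 0)"
proof -
  define r where "r = max (nrm \<beta>) (nrm (\<lambda>j. \<beta> j + d j))"
  have r: "c_lower r > 0" using c_lower(1)[of r] by (simp add: r_def le_max_iff_disj)
  have le: "real n * c_lower r * (nrm d)\<^sup>2 / 2 \<le> breg \<beta> d"
    by (rule bregman_bounds[OF assms]) (auto simp: r_def)
  moreover have "0 \<le> real n * c_lower r * (nrm d)\<^sup>2 / 2" using r by simp
  ultimately show "0 \<le> breg \<beta> d" by linarith
  assume "breg \<beta> d = 0"
  then have "nrm d = 0" using le r n by (auto simp: mult_le_0_iff)
  then show "d = (\<lambda>_. 0)"
    using L2_set_eq_0_coord_space[OF assms(3)] nrm_coord[OF assms(1,3)] admissibleD[OF assms(1)] by auto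
qed

lemma coord_space_union: "u \<in> coord_space J \<Longrightarrow> u \<in> coord_space (J0 \<union> J)"
  using coord_space_mono[of J "J0 \<union> J"] by auto

text \<open>Necessity comes from perturbing along \<open>t * d\<close>, where the Bregman term is at
  most quadratic in \<open>t\<close>; sufficiency from its being nonnegative. As \<open>J\<close>
  may miss true covariates, both facts are taken from \<open>J0 \<union> J\<close>.\<close>

lemma is_mle_iff_score:
  assumes "J \<in> submodels p q"
  shows "is_mle n p X b y J \<beta> \<longleftrightarrow> \<beta> \<in> coord_space J \<and> (\<forall>d\<in>coord_space J. sc y \<beta> d = 0)"
proof -
  note K = admissible_union[OF assms]
  show ?thesis
  proof (intro iffI conjI ballI; (elim conjE)?)
    assume m: "is_mle n p X b y J \<beta>"
    then show \<beta>: "\<beta> \<in> coord_space J" by (simp add: is_mle_log_lik)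
    fix d assume d: "d \<in> coord_space J"
    define r where "r = nrm \<beta> + nrm d"
    show "sc y \<beta> d = 0"
    proof (rule linear_le_quadratic_imp_zero)
      fix t :: real assume t: "\<bar>t\<bar> \<le> 1"
      define e where "e = (\<lambda>j. t * d j)"
      have e: "e \<in> coord_space J" using d by (simp add: e_def coord_space_scale)
      have ne: "nrm e = \<bar>t\<bar> * nrm d" by (simp add: e_def L2_set_scale)
      have "nrm e \<le> nrm d" unfolding ne using t by (intro mult_left_le_one_le) auto
      then have "nrm (\<lambda>j. \<beta> j + e j) \<le> r" using nrm_add[of \<beta> e] by (simp add: r_def)
      then have "breg \<beta> e \<le> real n * c_upper r * (nrm e)\<^sup>2 / 2"
        by (intro bregman_bounds[OF K] coord_space_union \<beta> e) (auto simp: r_def)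
      moreover have "ll y (\<lambda>j. \<beta> j + e j) \<le> ll y \<beta>"
        using m coord_space_add[OF \<beta> e] by (auto simp: is_mle_log_lik)
      then have "t * sc y \<beta> d \<le> breg \<beta> e"
        unfolding log_lik_add by (simp add: e_def score_scale)
      ultimately show "t * sc y \<beta> d \<le> (real n * c_upper r * (nrm d)\<^sup>2 / 2) * t\<^sup>2"
        unfolding ne power_mult_distrib power2_abs by (simp add: mult_ac)
    qed
  next
    assume \<beta>: "\<beta> \<in> coord_space J" and s: "\<forall>d\<in>coord_space J. sc y \<beta> d = 0"
    have "ll y \<beta>' \<le> ll y \<beta>" if "\<beta>' \<in> coord_space J" for \<beta>'
    proof -
      define d where "d = (\<lambda>j. \<beta>' j - \<beta> j)"
      have d: "d \<in> coord_space J" using \<beta> that by (simp add: d_def coord_space_diff)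
      have "\<beta>' = (\<lambda>j. \<beta> j + d j)" by (simp add: d_def)
      then show ?thesis
        using s d bregman_nonneg(1)[OF K coord_space_union[OF \<beta>] coord_space_union[OF d]]
        by (simp add: log_lik_add)
    qed
    then show "is_mle n p X b y J \<beta>" using \<beta> by (simp add: is_mle_log_lik)
  qed
qed

lemma is_mle_unique:
  assumes "J \<in> submodels p q" "is_mle n p X b y J \<beta>" "is_mle n p X b y J \<beta>'"
  shows "\<beta> = \<beta>'"
proof -
  note K = admissible_union[OF assms(1)]
  have cs: "\<beta> \<in> coord_space J" "\<beta>' \<in> coord_space J" using assms by (auto simp: is_mle_log_lik)
  define d where "d = (\<lambda>j. \<beta>' j - \<beta> j)"
  have d: "d \<in> coord_space J" using cs by (simp add: d_def coord_space_diff)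
  have eq: "\<beta>' = (\<lambda>j. \<beta> j + d j)" by (simp add: d_def)
  have "ll y \<beta>' = ll y \<beta>" using assms cs by (intro antisym) (auto simp: is_mle_log_lik)
  moreover have "sc y \<beta> d = 0" using assms d is_mle_iff_score[OF assms(1)] by blast
  ultimately have "breg \<beta> d = 0" unfolding eq log_lik_add by simp
  then have "d = (\<lambda>_. 0)"
    by (rule bregman_nonneg(2)[OF K coord_space_union[OF cs(1)] coord_space_union[OF d]])
  then show ?thesis by (simp add: eq)
qed

lemma mle_exists_iff:
  assumes "J \<in> submodels p q"
  shows "mle_exists n p X b y J \<longleftrightarrow> (\<exists>\<beta>. is_mle n p X b y J \<beta>)"
  using is_mle_unique[OF assms] unfolding mle_exists_def by blast

lemma mle_eqI:
  assumes "J \<in> submodels p q" "is_mle n p X b y J \<beta>"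
  shows "mle n p X b y J = \<beta>"
  unfolding mle_def using is_mle_unique[OF assms(1)] assms(2) by blast

lemma continuous_on_log_lik: "continuous_on S (ll y)"
proof -
  have cb: "continuous_on UNIV b" using b(1) by (auto intro!: DERIV_continuous_on)
  show ?thesis
    unfolding log_lik_def
    by (intro continuous_intros continuous_on_lin_pred continuous_on_compose2[OF cb]) auto
qed

end

text \<open>Outside the ball of this radius around the true parameter, the lower bound on the Hessian puts
  the log-likelihood below its value at \<open>0\<close>, which belongs to every submodel.\<close>

definition mle_radius :: "(real \<Rightarrow> real) \<Rightarrow> (real \<Rightarrow> real) \<Rightarrow> real \<Rightarrow> real" where
  "mle_radius c_lower c_upper a = 2 + a + 2 * c_upper a * a\<^sup>2 / c_lower (a + 1)"

context regular_glm
begin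

abbreviation "rad \<equiv> mle_radius c_lower c_upper a\<^sub>0"
text \<open>Curvature bounds on the ball of radius \<open>a\<^sub>0 + rad\<close>, which contains
  all estimators once the score is small. They depend neither on the sample size nor on the
  submodel.\<close>

abbreviation "lam \<equiv> c_lower (a\<^sub>0 + rad)"
abbreviation "Lam \<equiv> c_upper (a\<^sub>0 + rad)"

lemma rad_ge: "2 + a\<^sub>0 \<le> rad"
  using a0 c_lower(1)[of "a\<^sub>0 + 1"] c_upper(1)[of a\<^sub>0] by (simp add: mle_radius_def)

lemma lam_pos: "0 < lam" and Lam_pos: "0 < Lam"
  using rad_ge a0 by (auto intro!: c_lower(1) c_upper(1))

text \<open>\<open>c_lower\<close> may tend to zero, so the quadratic bound is too weak far out.
  Convexity replaces it: curvature in the ball of radius \<open>a\<^sub>0 + 1\<close> produces a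
  slope of order \<open>n\<close> at distance 1, and along a ray the slope never decreases.\<close>

lemma bregman_far:
  assumes "admissible K" "u \<in> coord_space K" "1 \<le> nrm u"
  shows "real n * c_lower (a\<^sub>0 + 1) * nrm u / 2 \<le> breg \<beta>0 u"
proof -
  define T where "T = nrm u"
  define d where "d = (\<lambda>j. (1 / T) * u j)"
  have T: "1 \<le> T" using assms by (simp add: T_def)
  have nd: "nrm d = 1" unfolding d_def L2_set_scale T_def[symmetric] using T by simp
  have d: "d \<in> coord_space K" using assms(2) unfolding d_def by (rule coord_space_scale)
  have u: "u = (\<lambda>j. T * d j)" using T by (simp add: d_def fun_eq_iff)
  define \<beta>1 where "\<beta>1 = (\<lambda>j. \<beta>0 j + d j)"
  have \<beta>0K: "\<beta>0 \<in> coord_space K" using \<beta>0_coord admissibleD[OF assms(1)] by blast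
  have \<beta>1K: "\<beta>1 \<in> coord_space K" using coord_space_add[OF \<beta>0K d] by (simp add: \<beta>1_def)
  have n1: "nrm \<beta>1 \<le> a\<^sub>0 + 1" using nrm_add[of \<beta>0 d] nd \<beta>0 by (simp add: \<beta>1_def)
  have n0: "nrm \<beta>0 \<le> a\<^sub>0 + 1" using \<beta>0 by simp
  let ?m = "real n * c_lower (a\<^sub>0 + 1) / 2"
  define d1 where "d1 = (\<lambda>j. (- 1) * d j)"
  define d2 where "d2 = (\<lambda>j. (T - 1) * d j)"
  have dK: "d1 \<in> coord_space K" "d2 \<in> coord_space K"
    unfolding d1_def d2_def by (rule coord_space_scale[OF d])+
  \<comment> \<open>Three-point identity. The last bracket is the symmetrised divergence, that is,
    the difference of the slopes at \<open>\<beta>1\<close> and \<open>\<beta>0\<close> along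
    \<open>d\<close>.\<close>
  have "breg \<beta>0 u = breg \<beta>0 d + breg \<beta>1 d2 + (T - 1) * (breg \<beta>0 d + breg \<beta>1 d1)"
    unfolding bregman_def sum_distrib_left sum.distrib[symmetric] u d1_def d2_def \<beta>1_def
      lin_pred_scale lin_pred_add
    by (intro sum.cong refl) (simp add: algebra_simps)
  moreover have "?m \<le> breg \<beta>0 d"
    using bregman_bounds(1)[OF assms(1) \<beta>0K d n0] n1 nd by (simp add: \<beta>1_def)
  moreover have "0 \<le> breg \<beta>1 d2"
    by (rule bregman_nonneg(1)[OF assms(1) \<beta>1K dK(2)])
  moreover have "?m \<le> breg \<beta>1 d1"
  proof -
    have "(\<lambda>j. \<beta>1 j + d1 j) = \<beta>0" by (simp add: \<beta>1_def d1_def)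
    moreover have "nrm d1 = 1" unfolding d1_def L2_set_scale using nd by simp
    ultimately show ?thesis
      using bregman_bounds(1)[OF assms(1) \<beta>1K dK(1) n1] n0 by simp
  qed
  moreover have "(T - 1) * (?m + ?m) \<le> (T - 1) * (breg \<beta>0 d + breg \<beta>1 d1)"
    using T calculation by (intro mult_left_mono) auto
  moreover have "0 \<le> ?m" using a0 c_lower(1)[of "a\<^sub>0 + 1"] by simp
  moreover have "?m * T \<le> ?m + (T - 1) * (?m + ?m)"
    using mult_left_mono[OF T \<open>0 \<le> ?m\<close>] by (simp add: algebra_simps)
  ultimately have "?m * T \<le> breg \<beta>0 u" by linarith
  then show ?thesis by (simp add: T_def)
qed

text \<open>Good event for the score, as a property of a fixed \<open>y\<close>: its consequences
  for all submodels can be drawn simultaneously and without probability.\<close>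

definition score_bounded :: "(nat \<Rightarrow> real) \<Rightarrow> real \<Rightarrow> bool" where
  "score_bounded y \<sigma> \<longleftrightarrow> (\<forall>K u. admissible K \<longrightarrow> u \<in> coord_space K \<longrightarrow> \<bar>sc y \<beta>0 u\<bar> \<le> \<sigma> * nrm u)"

text \<open>A maximiser over the compact part of the submodel near the true parameter is global:
  outside that part the linear growth of the Bregman term is at least twice the score, and the
  log-likelihood falls below its value at zero.\<close>

lemma mle_exists_near:
  assumes "score_bounded y \<sigma>" "4 * \<sigma> \<le> real n * c_lower (a\<^sub>0 + 1)" "J \<in> submodels p q"
  shows "\<exists>\<beta>. is_mle n p X b y J \<beta> \<and> nrm (\<lambda>j. \<beta> j - \<beta>0 j) \<le> rad"
proof -
  define K where "K = J0 \<union> J"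
  have K: "admissible K" using admissible_union[OF assms(3)] by (simp add: K_def)
  have \<beta>0K: "\<beta>0 \<in> coord_space K" by (rule \<beta>0_coord) (simp add: K_def)
  have fJ: "finite J" "J \<subseteq> {1..p}" using submodelsD[OF assms(3)] by auto
  let ?l = "c_lower (a\<^sub>0 + 1)"
  have l: "0 < ?l" using a0 by (intro c_lower(1)) auto
  have sb: "\<bar>sc y \<beta>0 u\<bar> \<le> real n * ?l / 4 * nrm u" if "u \<in> coord_space K" for u
  proof -
    have "\<bar>sc y \<beta>0 u\<bar> \<le> \<sigma> * nrm u" using assms(1) K that by (simp add: score_bounded_def)
    also have "\<dots> \<le> real n * ?l / 4 * nrm u" using assms(2) by (intro mult_right_mono) auto
    finally show ?thesis .
  qed
  define S where "S = {\<beta> \<in> coord_space J. nrm (\<lambda>j. \<beta> j - \<beta>0 j) \<le> rad}"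
  define B where "B = {\<beta> :: nat \<Rightarrow> real. \<forall>j. \<beta> j \<in> (if j \<in> J then {-(a\<^sub>0 + rad)..a\<^sub>0 + rad} else {0})}"
  have "S \<subseteq> B"
  proof
    fix \<beta> assume \<beta>: "\<beta> \<in> S"
    have "\<bar>\<beta> j\<bar> \<le> a\<^sub>0 + rad" if "j \<in> J" for j
    proof -
      have j: "j \<in> {1..p}" using that fJ by auto
      have "nrm \<beta> \<le> nrm (\<lambda>j. \<beta> j - \<beta>0 j) + nrm \<beta>0"
        using nrm_add[of "\<lambda>j. \<beta> j - \<beta>0 j" \<beta>0] by simp
      then have "nrm \<beta> \<le> rad + a\<^sub>0" using \<beta> \<beta>0 by (simp add: S_def)
      moreover have "\<bar>\<beta> j\<bar> \<le> nrm \<beta>"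
        using member_le_L2_set[of "{1..p}" j "\<lambda>i. \<bar>\<beta> i\<bar>"] j by (simp add: L2_set_def)
      ultimately show ?thesis by simp
    qed
    then show "\<beta> \<in> B" using \<beta> by (fastforce simp: B_def S_def coord_space_def abs_le_iff)
  qed
  moreover have "closed S"
  proof -
    have "continuous_on UNIV (\<lambda>\<beta>. nrm (\<lambda>j. \<beta> j - \<beta>0 j))"
      unfolding L2_set_def by (intro continuous_intros continuous_on_product_coordinates)
    then have "closed {\<beta>. nrm (\<lambda>j. \<beta> j - \<beta>0 j) \<le> rad}"
      by (intro closed_Collect_le continuous_on_const)
    then show ?thesis unfolding S_def using closed_coord_space[of J] by (simp add: closed_Int Collect_conj_eq)
  qed
  moreover have "compact B" unfolding B_def by (rule compact_box)
  ultimately have "compact S"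
    by (metis compact_Int_closed inf.absorb_iff2)
  moreover have zS: "(\<lambda>_. 0) \<in> S"
    using \<beta>0(3) rad_ge L2_set_scale[of "-1" \<beta>0 "{1..p}"] by (simp add: S_def)
  ultimately obtain \<beta>h where \<beta>h: "\<beta>h \<in> S" "\<And>\<beta>. \<beta> \<in> S \<Longrightarrow> ll y \<beta> \<le> ll y \<beta>h"
    using continuous_attains_sup[of S "ll y"] continuous_on_log_lik by blast
  have low: "ll y \<beta>0 - real n * ?l / 4 * a\<^sub>0 - real n * c_upper a\<^sub>0 * a\<^sub>0\<^sup>2 / 2 \<le> ll y (\<lambda>_. 0)"
  proof -
    define d where "d = (\<lambda>j. (- 1) * \<beta>0 j)"
    have d: "d \<in> coord_space K" using \<beta>0K unfolding d_def by (rule coord_space_scale)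
    have nd: "nrm d \<le> a\<^sub>0" unfolding d_def L2_set_scale using \<beta>0 by simp
    have z: "(\<lambda>j. \<beta>0 j + d j) = (\<lambda>_. 0)" by (simp add: d_def)
    have "breg \<beta>0 d \<le> real n * c_upper a\<^sub>0 * (nrm d)\<^sup>2 / 2"
      by (rule bregman_bounds(2)[OF K \<beta>0K d \<beta>0(3)]) (use a0 in \<open>simp add: z L2_set_def\<close>)
    also have "\<dots> \<le> real n * c_upper a\<^sub>0 * a\<^sub>0\<^sup>2 / 2"
      using nd a0 c_upper(1)[of a\<^sub>0]
      by (intro divide_right_mono mult_left_mono power_mono) auto
    finally have 1: "breg \<beta>0 d \<le> real n * c_upper a\<^sub>0 * a\<^sub>0\<^sup>2 / 2" .
    have "real n * ?l / 4 * nrm d \<le> real n * ?l / 4 * a\<^sub>0" using nd l by (intro mult_left_mono) auto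
    then have 2: "- (real n * ?l / 4 * a\<^sub>0) \<le> sc y \<beta>0 d" using sb[OF d] by linarith
    show ?thesis using log_lik_add[of n p X b y \<beta>0 d] 1 2 unfolding z by linarith
  qed
  have "ll y \<beta> \<le> ll y \<beta>h" if \<beta>: "\<beta> \<in> coord_space J" for \<beta>
  proof (cases "\<beta> \<in> S")
    case True
    then show ?thesis by (rule \<beta>h)
  next
    case False
    define u where "u = (\<lambda>j. \<beta> j - \<beta>0 j)"
    have u: "u \<in> coord_space K"
      using coord_space_diff[OF coord_space_union[OF \<beta>] \<beta>0K[unfolded K_def]] by (simp add: u_def K_def)
    have nu: "rad < nrm u" using False \<beta> by (simp add: S_def u_def)
    have "ll y \<beta> = ll y \<beta>0 + sc y \<beta>0 u - breg \<beta>0 u"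
      using log_lik_add[of n p X b y \<beta>0 u] by (simp add: u_def)
    also have "\<dots> \<le> ll y \<beta>0 + real n * ?l / 4 * nrm u - real n * ?l * nrm u / 2"
      using sb[OF u] bregman_far[OF K u] nu rad_ge a0 by linarith
    also have "\<dots> = ll y \<beta>0 - real n * ?l / 4 * nrm u" by (simp add: algebra_simps)
    also have "\<dots> \<le> ll y \<beta>0 - real n * ?l / 4 * rad"
      using nu l by (intro diff_left_mono mult_left_mono) auto
    \<comment> \<open>The form of \<open>mle_radius\<close> comes from this line: the last two terms
      are the loss at zero found in \<open>low\<close>, and the first is to spare.\<close>
    also have "real n * ?l / 4 * rad =
        real n * ?l / 2 + real n * ?l / 4 * a\<^sub>0 + real n * c_upper a\<^sub>0 * a\<^sub>0\<^sup>2 / 2"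
      using l by (simp add: mle_radius_def field_simps)
    also have "ll y \<beta>0 - \<dots> \<le> ll y (\<lambda>_. 0)"
    proof -
      have "0 \<le> real n * ?l / 2" using l by simp
      then show ?thesis using low by linarith
    qed
    also have "\<dots> \<le> ll y \<beta>h" by (rule \<beta>h(2)[OF zS])
    finally show ?thesis .
  qed
  then show ?thesis using \<beta>h(1) by (auto simp: is_mle_log_lik S_def)
qed

lemma mle_near:
  assumes "score_bounded y \<sigma>" "4 * \<sigma> \<le> real n * c_lower (a\<^sub>0 + 1)" "J \<in> submodels p q"
  defines "\<beta>h \<equiv> mle n p X b y J"
  shows "mle_exists n p X b y J" "is_mle n p X b y J \<beta>h" "\<beta>h \<in> coord_space J"
    "nrm (\<lambda>j. \<beta>h j - \<beta>0 j) \<le> rad" "nrm \<beta>h \<le> a\<^sub>0 + rad"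
proof -
  obtain \<beta> where \<beta>: "is_mle n p X b y J \<beta>" "nrm (\<lambda>j. \<beta> j - \<beta>0 j) \<le> rad"
    using mle_exists_near[OF assms(1-3)] by blast
  have eq: "\<beta>h = \<beta>" unfolding \<beta>h_def by (rule mle_eqI[OF assms(3) \<beta>(1)])
  show "mle_exists n p X b y J" using mle_exists_iff[OF assms(3)] \<beta> by blast
  show "is_mle n p X b y J \<beta>h" "\<beta>h \<in> coord_space J" "nrm (\<lambda>j. \<beta>h j - \<beta>0 j) \<le> rad"
    using \<beta> by (auto simp: eq is_mle_log_lik)
  show "nrm \<beta>h \<le> a\<^sub>0 + rad"
    using nrm_add[of "\<lambda>j. \<beta>h j - \<beta>0 j" \<beta>0] \<beta> \<beta>0 by (simp add: eq)
qed

lemma log_lik_upper: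
  assumes "score_bounded y \<sigma>" "admissible K" "\<beta> \<in> coord_space K" "nrm \<beta> \<le> a\<^sub>0 + rad"
  shows "ll y \<beta> \<le> ll y \<beta>0 + \<sigma> * nrm (\<lambda>j. \<beta> j - \<beta>0 j)
     - real n * lam / 2 * (nrm (\<lambda>j. \<beta> j - \<beta>0 j))\<^sup>2"
proof -
  define u where "u = (\<lambda>j. \<beta> j - \<beta>0 j)"
  have \<beta>0K: "\<beta>0 \<in> coord_space K" using \<beta>0_coord admissibleD[OF assms(2)] by blast
  have u: "u \<in> coord_space K" using coord_space_diff[OF assms(3) \<beta>0K] by (simp add: u_def)
  have eq: "(\<lambda>j. \<beta>0 j + u j) = \<beta>" by (simp add: u_def)
  have "real n * lam * (nrm u)\<^sup>2 / 2 \<le> breg \<beta>0 u"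
    by (rule bregman_bounds(1)[OF assms(2) \<beta>0K u]) (use \<beta>0 rad_ge a0 assms(4) eq in auto)
  moreover have "\<bar>sc y \<beta>0 u\<bar> \<le> \<sigma> * nrm u" using assms(1,2) u by (simp add: score_bounded_def)
  ultimately show ?thesis
    using log_lik_add[of n p X b y \<beta>0 u] unfolding eq u_def[symmetric] by simp
qed

text \<open>The true parameter is itself a candidate in the submodel, so the quadratic loss cannot
  exceed the gain from the score; dividing by the distance gives the rate.\<close>

lemma mle_close:
  assumes "score_bounded y \<sigma>" "4 * \<sigma> \<le> real n * c_lower (a\<^sub>0 + 1)" "J \<in> submodels p q" "J0 \<subseteq> J" "0 \<le> \<sigma>"
  shows "nrm (\<lambda>j. mle n p X b y J j - \<beta>0 j) \<le> 2 * \<sigma> / (real n * lam)"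
proof -
  note m = mle_near[OF assms(1-3)]
  let ?u = "\<lambda>j. mle n p X b y J j - \<beta>0 j"
  have "admissible J" using admissible_union[OF assms(3)] assms(4) by (simp add: Un_absorb1)
  from log_lik_upper[OF assms(1) this m(3,5)]
  have "ll y (mle n p X b y J) \<le> ll y \<beta>0 + \<sigma> * nrm ?u - real n * lam / 2 * (nrm ?u)\<^sup>2" .
  moreover have "ll y \<beta>0 \<le> ll y (mle n p X b y J)"
    using m(2) \<beta>0_coord[OF assms(4)] by (auto simp: is_mle_log_lik)
  ultimately have le: "(real n * lam / 2 * nrm ?u) * nrm ?u \<le> \<sigma> * nrm ?u"
    by (simp add: power2_eq_square)
  show ?thesis
  proof (cases "nrm ?u = 0")
    case True
    then show ?thesis unfolding True using lam_pos assms(5) by simp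
  next
    case False
    then have "0 < nrm ?u" using L2_set_nonneg[of ?u "{1..p}"] by linarith
    then have "real n * lam / 2 * nrm ?u \<le> \<sigma>" using le by simp
    then show ?thesis using n lam_pos by (simp add: field_simps)
  qed
qed

text \<open>The estimator vanishes at a missed covariate and hence stays at distance at least
  \<open>s\<close> from the true parameter; at such distances the score takes back at most half of
  the quadratic loss.\<close>

lemma log_lik_missing_signal:
  assumes "score_bounded y \<sigma>" "4 * \<sigma> \<le> real n * c_lower (a\<^sub>0 + 1)" "J \<in> submodels p q"
    "\<not> J0 \<subseteq> J" "0 \<le> s" "\<And>j. j \<in> J0 \<Longrightarrow> s \<le> \<bar>\<beta>0 j\<bar>" "4 * \<sigma> \<le> real n * lam * s"
  shows "ll y (mle n p X b y J) \<le> ll y \<beta>0 - real n * lam * s\<^sup>2 / 4"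
proof -
  note m = mle_near[OF assms(1-3)]
  let ?u = "\<lambda>j. mle n p X b y J j - \<beta>0 j"
  obtain j where j: "j \<in> J0" "j \<notin> J" using assms(4) by blast
  then have "j \<in> {1..p}" using J0_subset by blast
  then have "\<bar>?u j\<bar> \<le> nrm ?u"
    using member_le_L2_set[of "{1..p}" j "\<lambda>i. \<bar>?u i\<bar>"] by (simp add: L2_set_def)
  moreover have "mle n p X b y J j = 0" using m(3) j by (simp add: coord_space_def)
  ultimately have su: "s \<le> nrm ?u" using assms(6)[OF j(1)] by simp
  have "\<sigma> \<le> real n * lam * s / 4" using assms(7) by simp
  also have "\<dots> \<le> real n * lam * nrm ?u / 4" using su lam_pos by (intro divide_right_mono mult_left_mono) auto
  finally have "\<sigma> * nrm ?u \<le> real n * lam * nrm ?u / 4 * nrm ?u" by (intro mult_right_mono) auto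
  then have 1: "\<sigma> * nrm ?u \<le> real n * lam / 4 * (nrm ?u)\<^sup>2" by (simp add: power2_eq_square)
  have "ll y (mle n p X b y J) \<le> ll y \<beta>0 + \<sigma> * nrm ?u - real n * lam / 2 * (nrm ?u)\<^sup>2"
    by (rule log_lik_upper[OF assms(1) admissible_union[OF assms(3)] coord_space_union[OF m(3)] m(5)])
  also have "\<dots> \<le> ll y \<beta>0 - real n * lam / 4 * (nrm ?u)\<^sup>2" using 1 by simp
  also have "\<dots> \<le> ll y \<beta>0 - real n * lam / 4 * s\<^sup>2"
    using su assms(5) lam_pos by (intro diff_left_mono mult_left_mono power_mono) auto
  finally show ?thesis by simp
qed

text \<open>The displacement splits orthogonally for the Hessian at the true parameter, and the
  quadratic approximation splits with it. The part in \<open>J0\<close> competes with the estimator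
  for \<open>J0\<close>, the other part is bounded by \<open>x\<close>. Each of the two passages
  between Bregman term and quadratic form costs half of the cubic term.\<close>

lemma log_lik_overfit:
  assumes "score_bounded y \<sigma>" "4 * \<sigma> \<le> real n * c_lower (a\<^sub>0 + 1)" "J \<in> submodels p q"
    "J0 \<subseteq> J" "0 \<le> \<sigma>"
    "\<And>w. w \<in> coord_space J \<Longrightarrow> (\<And>v. v \<in> coord_space J0 \<Longrightarrow> bform {1..p} (hess \<beta>0) v w = 0) \<Longrightarrow>
       sc y \<beta>0 w - qf \<beta>0 w / 2 \<le> x"
  defines "\<delta> \<equiv> 2 * \<sigma> / (real n * lam)"
  shows "ll y (mle n p X b y J) \<le> ll y (mle n p X b y J0) + x + real n * c_change * \<delta> ^ 3"
proof -
  note m = mle_near[OF assms(1-3)]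
  note m0 = mle_near[OF assms(1,2) J0_submodel]
  define u where "u = (\<lambda>j. mle n p X b y J j - \<beta>0 j)"
  have adJ: "admissible J" using admissible_union[OF assms(3)] assms(4) by (simp add: Un_absorb1)
  note J = admissibleD[OF adJ]
  have \<beta>0J: "\<beta>0 \<in> coord_space J" and \<beta>00: "\<beta>0 \<in> coord_space J0" by (auto intro!: \<beta>0_coord assms(4))
  have ad0: "admissible J0" using admissible_union[OF J0_submodel] by simp
  have u: "u \<in> coord_space J" unfolding u_def by (rule coord_space_diff[OF m(3) \<beta>0J])
  have nu: "nrm u \<le> \<delta>" unfolding u_def \<delta>_def by (rule mle_close[OF assms(1-5)])
  have \<delta>0: "0 \<le> \<delta>" using assms(5) lam_pos by (simp add: \<delta>_def)
  have cub: "real n * c_change * nrm d ^ 3 / 2 \<le> real n * c_change * \<delta> ^ 3 / 2" if "nrm d \<le> \<delta>" for d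
    using that c_change by (intro divide_right_mono mult_left_mono power_mono) auto
  have "ll y (mle n p X b y J) = ll y \<beta>0 + sc y \<beta>0 u - breg \<beta>0 u"
    using log_lik_add[of n p X b y \<beta>0 u] by (simp add: u_def)
  also have "\<dots> \<le> ll y \<beta>0 + (sc y \<beta>0 u - qf \<beta>0 u / 2) + real n * c_change * \<delta> ^ 3 / 2"
    using bregman_quadratic[OF adJ \<beta>0J u] cub[OF nu] by linarith
  finally have 1: "ll y (mle n p X b y J) \<le> \<dots>" .
  have pd: "pos_def_on J (hess \<beta>0)" by (rule pos_def_hess[OF adJ \<beta>0J])
  obtain v w where vw: "v \<in> coord_space J0" "w \<in> coord_space J" "u = (\<lambda>j. v j + w j)"
    "\<And>i. i \<in> J0 \<Longrightarrow> (\<Sum>k\<in>J. hess \<beta>0 i k * w k) = 0"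
    using orthogonal_decomposition[OF _ assms(4) pd u] J by metis
  have vJ: "v \<in> coord_space J" using vw(1) coord_space_mono[OF assms(4)] by blast
  have orth: "bform {1..p} (hess \<beta>0) v' w = 0" if "v' \<in> coord_space J0" for v'
  proof -
    have v'J: "v' \<in> coord_space J" using that coord_space_mono[OF assms(4)] by blast
    have "bform J (hess \<beta>0) v' w = 0"
      by (rule orthogonal_to_coord_space[OF _ assms(4) vw(2) that vw(4)]) (use J in auto)
    then show ?thesis using bform_superset[of "{1..p}" J v' w] J vw(2) v'J by auto
  qed
  have qsum: "qf \<beta>0 u = qf \<beta>0 v + qf \<beta>0 w"
  proof -
    have "bform {1..p} (hess \<beta>0) w v = bform {1..p} (hess \<beta>0) v w"
      by (rule bform_sym) (rule neg_hess_sym)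
    then show ?thesis unfolding vw(3) bform_add_left bform_add_right using orth[OF vw(1)] by simp
  qed
  have 2: "sc y \<beta>0 w - qf \<beta>0 w / 2 \<le> x" by (rule assms(6)[OF vw(2) orth])
  have 3: "sc y \<beta>0 v - qf \<beta>0 v / 2 \<le> ll y (mle n p X b y J0) - ll y \<beta>0 + real n * c_change * \<delta> ^ 3 / 2"
  proof (cases "nrm v \<le> \<delta>")
    case True
    have "ll y (\<lambda>j. \<beta>0 j + v j) \<le> ll y (mle n p X b y J0)"
      using m0(2) coord_space_add[OF \<beta>00 vw(1)] by (auto simp: is_mle_log_lik)
    then show ?thesis
      using bregman_quadratic[OF ad0 \<beta>00 vw(1)] cub[OF True] unfolding log_lik_add by linarith
  next
    \<comment> \<open>The projection may be longer than \<open>\<delta>\<close>, where the cubic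
      term is not controlled. By the choice of \<open>\<delta>\<close>, half of the quadratic form
      then already outweighs the score.\<close>
    case False
    have "real n * lam * (nrm v)\<^sup>2 \<le> real n * c_lower (nrm \<beta>0) * (nrm v)\<^sup>2"
      using \<beta>0 rad_ge a0 by (intro mult_right_mono mult_left_mono c_lower_anti) auto
    also have "\<dots> \<le> qf \<beta>0 v" by (rule qf_bounds(1)[OF ad0 \<beta>00 vw(1)])
    finally have q: "real n * lam * (nrm v)\<^sup>2 \<le> qf \<beta>0 v" .
    have "2 * \<sigma> = \<delta> * (real n * lam)" using n lam_pos by (simp add: \<delta>_def)
    also have "\<dots> \<le> nrm v * (real n * lam)" using False lam_pos by (intro mult_right_mono) auto
    finally have "2 * \<sigma> * nrm v \<le> nrm v * (real n * lam) * nrm v" by (intro mult_right_mono) auto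
    then have "2 * (\<sigma> * nrm v) \<le> qf \<beta>0 v" using q by (simp add: power2_eq_square mult_ac)
    moreover have "\<bar>sc y \<beta>0 v\<bar> \<le> \<sigma> * nrm v" using assms(1) ad0 vw(1) by (simp add: score_bounded_def)
    moreover have "ll y \<beta>0 \<le> ll y (mle n p X b y J0)"
      using m0(2) \<beta>00 by (auto simp: is_mle_log_lik)
    moreover have "0 \<le> real n * c_change * \<delta> ^ 3 / 2" using \<delta>0 c_change by simp
    ultimately show ?thesis by linarith
  qed
  have "sc y \<beta>0 u = sc y \<beta>0 v + sc y \<beta>0 w" unfolding vw(3) by (rule score_add)
  then show ?thesis using 1 2 3 qsum by linarith
qed

lemma qf_lower_lam:
  assumes "admissible K" "\<beta> \<in> coord_space K" "nrm \<beta> \<le> a\<^sub>0 + rad" "u \<in> coord_space K"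
  shows "real n * lam * (nrm u)\<^sup>2 \<le> qf \<beta> u" "qf \<beta> u \<le> real n * Lam * (nrm u)\<^sup>2"
proof -
  have "real n * lam * (nrm u)\<^sup>2 \<le> real n * c_lower (nrm \<beta>) * (nrm u)\<^sup>2"
    using assms(3) by (intro mult_right_mono mult_left_mono c_lower_anti) auto
  then show "real n * lam * (nrm u)\<^sup>2 \<le> qf \<beta> u" using qf_bounds(1)[OF assms(1,2,4)] by linarith
  have "real n * c_upper (nrm \<beta>) * (nrm u)\<^sup>2 \<le> real n * Lam * (nrm u)\<^sup>2"
    using assms(3) by (intro mult_right_mono mult_left_mono c_upper_mono) auto
  then show "qf \<beta> u \<le> real n * Lam * (nrm u)\<^sup>2" using qf_bounds(2)[OF assms(1,2,4)] by linarith
qed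

lemma subdet_mle_lower:
  assumes "J \<in> submodels p q" "\<beta> \<in> coord_space J" "nrm \<beta> \<le> a\<^sub>0 + rad"
  shows "(real n * lam) ^ card J \<le> subdet J (hess \<beta>)"
proof -
  note K = admissible_union[OF assms(1)]
  note J = submodelsD[OF assms(1)]
  have pd: "pos_def_on J (hess \<beta>)"
    by (rule pos_def_on_subset[OF pos_def_hess[OF K coord_space_union[OF assms(2)]]])
      (use J finite_J0 in auto)
  have "(real n * lam) ^ card (J - {}) * subdet {} (hess \<beta>) \<le> subdet J (hess \<beta>)"
  proof (rule subdet_lower[OF _ _ pd])
    fix u assume u: "u \<in> coord_space J"
    have "real n * lam * (nrm u)\<^sup>2 \<le> qf \<beta> u"
      by (rule qf_lower_lam(1)[OF K coord_space_union[OF assms(2)] assms(3) coord_space_union[OF u]])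
    then show "real n * lam * (L2_set u J)\<^sup>2 \<le> bform J (hess \<beta>) u u"
      using bform_superset[of "{1..p}" J u u] L2_set_coord_space[of u J "{1..p}"] u J by auto
  qed (use J lam_pos in auto)
  then show ?thesis by simp
qed

lemma subdet_mle_upper:
  assumes "\<beta> \<in> coord_space J0" "nrm \<beta> \<le> a\<^sub>0 + rad"
  shows "subdet J0 (hess \<beta>) \<le> (real n * Lam) ^ card J0" "0 < subdet J0 (hess \<beta>)"
proof -
  have ad0: "admissible J0" using admissible_union[OF J0_submodel] by simp
  note pd = pos_def_hess[OF ad0 assms(1)]
  show "0 < subdet J0 (hess \<beta>)" by (rule subdet_pos[OF finite_J0 pd])
  show "subdet J0 (hess \<beta>) \<le> (real n * Lam) ^ card J0"
  proof (rule subdet_upper[OF finite_J0 pd])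
    fix u assume u: "u \<in> coord_space J0"
    have "qf \<beta> u \<le> real n * Lam * (nrm u)\<^sup>2" by (rule qf_lower_lam(2)[OF ad0 assms u])
    then show "bform J0 (hess \<beta>) u u \<le> real n * Lam * (L2_set u J0)\<^sup>2"
      using bform_superset[of "{1..p}" J0 u u] nrm_coord[OF ad0 u] u J0_subset by auto
  qed
qed

text \<open>The Hessians are taken at two different estimators. Both are within
  \<open>\<delta>\<close> of the true parameter, so on \<open>J0\<close> one form exceeds the other
  at most by the relative amount \<open>2 * c_change * \<delta> / lam\<close>. The exponent
  \<open>card J0\<close> is why \<open>q * \<delta>\<close> has to tend to zero.\<close>

lemma subdet_overfit:
  assumes "J \<in> submodels p q" "J0 \<subseteq> J" "\<beta> \<in> coord_space J" "\<beta>' \<in> coord_space J0"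
    "nrm \<beta> \<le> a\<^sub>0 + rad" "nrm (\<lambda>j. \<beta> j - \<beta>0 j) \<le> \<delta>" "nrm (\<lambda>j. \<beta>' j - \<beta>0 j) \<le> \<delta>"
  shows "(real n * lam) ^ card (J - J0) * subdet J0 (hess \<beta>') \<le>
    (1 + 2 * c_change * \<delta> / lam) ^ card J0 * subdet J (hess \<beta>)"
proof -
  have adJ: "admissible J" using admissible_union[OF assms(1)] assms(2) by (simp add: Un_absorb1)
  have ad0: "admissible J0" using admissible_union[OF J0_submodel] by simp
  note J = admissibleD[OF adJ]
  note pdJ = pos_def_hess[OF adJ assms(3)]
  have pd0: "pos_def_on J0 (hess \<beta>)" by (rule pos_def_on_subset[OF pdJ]) (use J in auto)
  note pd' = pos_def_hess[OF ad0 assms(4)]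
  have \<beta>'J: "\<beta>' \<in> coord_space J" using assms(4) coord_space_mono[OF assms(2)] by blast
  have \<delta>: "0 \<le> \<delta>" using assms(6) L2_set_nonneg[of "\<lambda>j. \<beta> j - \<beta>0 j" "{1..p}"] by linarith
  let ?t = "1 + 2 * c_change * \<delta> / lam"
  have t: "0 \<le> ?t" using c_change \<delta> lam_pos by simp
  have "nrm (\<lambda>j. \<beta>' j - \<beta> j) \<le> nrm (\<lambda>j. \<beta>' j - \<beta>0 j) + nrm (\<lambda>j. (- 1) * (\<beta> j - \<beta>0 j))"
    using nrm_add[of "\<lambda>j. \<beta>' j - \<beta>0 j" "\<lambda>j. (- 1) * (\<beta> j - \<beta>0 j)"] by simp
  also have "\<dots> \<le> 2 * \<delta>" unfolding L2_set_scale using assms(6,7) by simp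
  finally have dist: "nrm (\<lambda>j. \<beta>' j - \<beta> j) \<le> 2 * \<delta>" .
  have 1: "(real n * lam) ^ card (J - J0) * subdet J0 (hess \<beta>) \<le> subdet J (hess \<beta>)"
  proof (rule subdet_lower[OF _ assms(2) pdJ])
    fix u assume u: "u \<in> coord_space J"
    have "real n * lam * (nrm u)\<^sup>2 \<le> qf \<beta> u"
      by (rule qf_lower_lam(1)[OF adJ assms(3,5) u])
    then show "real n * lam * (L2_set u J)\<^sup>2 \<le> bform J (hess \<beta>) u u"
      using bform_superset[of "{1..p}" J u u] nrm_coord[OF adJ u] u J by auto
  qed (use J lam_pos in auto)
  have 2: "subdet J0 (hess \<beta>') \<le> ?t ^ card J0 * subdet J0 (hess \<beta>)"
  proof (rule subdet_mono[OF finite_J0 pd' pd0 t])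
    fix u assume u: "u \<in> coord_space J0"
    then have uJ: "u \<in> coord_space J" using coord_space_mono[OF assms(2)] by blast
    have "qf \<beta>' u - qf \<beta> u \<le> real n * c_change * nrm (\<lambda>j. \<beta>' j - \<beta> j) * (nrm u)\<^sup>2"
      using qf_lipschitz[OF adJ \<beta>'J assms(3) uJ] by linarith
    also have "\<dots> \<le> real n * c_change * (2 * \<delta>) * (nrm u)\<^sup>2"
      using dist c_change by (intro mult_right_mono mult_left_mono) auto
    also have "\<dots> = 2 * c_change * \<delta> / lam * (real n * lam * (nrm u)\<^sup>2)" using lam_pos by simp
    also have "\<dots> \<le> 2 * c_change * \<delta> / lam * qf \<beta> u"
      using qf_lower_lam(1)[OF adJ assms(3,5) uJ] c_change \<delta> lam_pos by (intro mult_left_mono) auto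
    finally have "qf \<beta>' u \<le> ?t * qf \<beta> u" by (simp add: distrib_right)
    then show "bform J0 (hess \<beta>') u u \<le> ?t * bform J0 (hess \<beta>) u u"
      using bform_superset[of "{1..p}" J0 u u] u J0_subset by auto
  qed
  have "(real n * lam) ^ card (J - J0) * subdet J0 (hess \<beta>') \<le>
      ?t ^ card J0 * ((real n * lam) ^ card (J - J0) * subdet J0 (hess \<beta>))"
    using mult_left_mono[OF 2, of "(real n * lam) ^ card (J - J0)"] lam_pos by (simp add: mult_ac)
  also have "\<dots> \<le> ?t ^ card J0 * subdet J (hess \<beta>)"
    using 1 t by (intro mult_left_mono) auto
  finally show ?thesis .
qed

end

section \<open>Comparison of Laplace scores\<close>

lemma argmax_singleton_iff:
  fixes L :: "'a \<Rightarrow> real"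
  assumes "a \<in> S"
  shows "{x. is_arg_max L (\<lambda>x. x \<in> S) x} = {a} \<longleftrightarrow> (\<forall>x\<in>S - {a}. L x < L a)"
proof
  assume *: "{x. is_arg_max L (\<lambda>x. x \<in> S) x} = {a}"
  then have a: "\<And>x. x \<in> S \<Longrightarrow> L x \<le> L a" by (auto simp: is_arg_max_def not_less set_eq_iff)
  show "\<forall>x\<in>S - {a}. L x < L a"
  proof (rule ballI, rule ccontr)
    fix x assume x: "x \<in> S - {a}" "\<not> L x < L a"
    then have "is_arg_max L (\<lambda>x. x \<in> S) x" using a by (fastforce simp: is_arg_max_def not_less)
    then show False using * x by blast
  qed
next
  assume *: "\<forall>x\<in>S - {a}. L x < L a"
  have "is_arg_max L (\<lambda>x. x \<in> S) x \<longleftrightarrow> x = a" for x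
  proof
    show "x = a" if "is_arg_max L (\<lambda>x. x \<in> S) x"
      using that * assms unfolding is_arg_max_def by blast
    have "L y \<le> L a" if "y \<in> S" for y
      using * that by (cases "y = a") (auto intro: less_imp_le)
    then show "is_arg_max L (\<lambda>x. x \<in> S) x" if "x = a"
      using assms that by (auto simp: is_arg_max_def not_less)
  qed
  then show "{x. is_arg_max L (\<lambda>x. x \<in> S) x} = {a}" by simp
qed

lemma binomial_le_power: "n choose k \<le> n ^ k"
proof -
  have "(n choose k) * 1 \<le> (n choose k) * fact k" by (intro mult_le_mono) auto
  also have "\<dots> \<le> n ^ k" by (rule binomial_fact_pow)
  finally show ?thesis by simp
qed

text \<open>The ratio of consecutive binomial coefficients is \<open>(p - m) / (m + 1)\<close>,
  which is at least \<open>(p - q) / q\<close> as long as \<open>m < q\<close>.\<close>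

lemma binomial_add_ge:
  assumes "s + k \<le> q" "q \<le> p" "0 < q"
  shows "((real p - real q) / real q) ^ k * real (p choose s) \<le> real (p choose (s + k))"
  using assms(1)
proof (induction k)
  case (Suc k)
  define m where "m = s + k"
  have m: "Suc m \<le> q" using Suc.prems by (simp add: m_def)
  have "Suc m * (p choose Suc m) = (p - m) * (p choose m)"
    by (simp only: binomial_absorption binomial_absorb_comp)
  then have "real (Suc m * (p choose Suc m)) = real ((p - m) * (p choose m))" by simp
  then have eq: "real (Suc m) * real (p choose Suc m) = (real p - real m) * real (p choose m)"
    using m assms by (simp only: of_nat_mult of_nat_diff)
  have IH: "((real p - real q) / real q) ^ k * real (p choose s) \<le> real (p choose m)"
    using Suc by (simp add: m_def)
  have "(real p - real q) * real (p choose m) \<le> (real p - real m) * real (p choose m)"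
    using m by (intro mult_right_mono) auto
  also have "\<dots> \<le> real q * real (p choose Suc m)" unfolding eq[symmetric]
    using m by (intro mult_right_mono) auto
  finally have step: "(real p - real q) / real q * real (p choose m) \<le> real (p choose Suc m)"
    using assms(3) by (simp add: field_simps)
  have "((real p - real q) / real q) ^ Suc k * real (p choose s) =
      (real p - real q) / real q * (((real p - real q) / real q) ^ k * real (p choose s))" by simp
  also have "\<dots> \<le> (real p - real q) / real q * real (p choose m)"
    using IH assms by (intro mult_left_mono) auto
  also note step
  finally show ?case by (simp add: m_def)
qed simp

context regular_glm
begin

lemma Laplace_gen_mle:
  "Laplace_gen \<gamma> n p X b f y J = real (p choose card J) powr (- \<gamma>) *
     (exp (ll y (mle n p X b y J)) * f J (mle n p X b y J) *
       sqrt ((2 * pi) ^ card J / subdet J (hess (mle n p X b y J))))"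
  by (simp add: Laplace_gen_def Laplace_def lik_def Let_def)

lemma card_submodel_le: "J \<in> submodels p q \<Longrightarrow> card J \<le> p"
  using card_mono[of "{1..p}" J] submodelsD by auto

text \<open>Meant for the comparison with models that miss a covariate, where losses of order
  \<open>q * ln p\<close> and \<open>q * ln n\<close> are affordable; hence the crude bounds for the
  binomial factor and the determinant.\<close>

lemma Laplace_gen_truth_lower:
  fixes \<gamma> F4 :: real
  assumes "score_bounded y \<sigma>" "4 * \<sigma> \<le> real n * c_lower (a\<^sub>0 + 1)" "1 \<le> p" "0 \<le> \<gamma>"
    "0 < F4" "F4 \<le> f J0 (mle n p X b y J0)"
  shows "exp (- \<gamma> * q * ln p + ll y \<beta>0 + ln F4 - q / 2 * ln (real n * Lam + 1))
     \<le> Laplace_gen \<gamma> n p X b f y J0"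
proof -
  note m0 = mle_near[OF assms(1,2) J0_submodel]
  let ?D = "subdet J0 (hess (mle n p X b y J0))"
  let ?N = "real n * Lam"
  have N: "0 < ?N" using n Lam_pos by simp
  note D = subdet_mle_upper[OF m0(3,5)]
  have c: "exp (- \<gamma> * q * ln p) \<le> real (p choose card J0) powr (- \<gamma>)"
  proof -
    have pos: "0 < p choose card J0" using card_submodel_le[OF J0_submodel] by simp
    have "real (p choose card J0) \<le> real (p ^ card J0)" using binomial_le_power by (intro of_nat_mono)
    also have "\<dots> \<le> real (p ^ q)" using assms(3) \<beta>0(2) by (intro of_nat_mono power_increasing) auto
    finally have "real (p ^ q) powr (- \<gamma>) \<le> real (p choose card J0) powr (- \<gamma>)"
      using pos assms(4) by (intro powr_mono2') auto
    moreover have "real (p ^ q) powr (- \<gamma>) = exp (- \<gamma> * q * ln p)"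
      using assms(3) by (simp add: powr_def ln_realpow)
    ultimately show ?thesis by simp
  qed
  have s: "exp (- (q / 2 * ln (?N + 1))) \<le> sqrt ((2 * pi) ^ card J0 / ?D)"
  proof -
    have "exp (- (q / 2 * ln (?N + 1))) = (?N + 1) powr (- (q / 2))"
      using N by (simp add: powr_def)
    also have "\<dots> = sqrt ((?N + 1) powr (- real q))"
      by (simp add: powr_half_sqrt[symmetric] powr_powr)
    also have "(?N + 1) powr (- real q) = (1 / (?N + 1)) ^ q"
      using N by (simp add: powr_minus powr_realpow power_one_over divide_inverse power_inverse)
    \<comment> \<open>The added 1 keeps this base at most 1, so that the exponent \<open>q\<close>
      may be lowered to \<open>card J0\<close>.\<close>
    also have "\<dots> \<le> (1 / (?N + 1)) ^ card J0"
      using N \<beta>0(2) by (intro power_decreasing) auto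
    also have "\<dots> \<le> (2 * pi / ?N) ^ card J0"
    proof (intro power_mono frac_le)
      show "1 \<le> 2 * pi" using pi_gt3 by simp
    qed (use N in auto)
    also have "\<dots> = (2 * pi) ^ card J0 / ?N ^ card J0" by (rule power_divide)
    also have "\<dots> \<le> (2 * pi) ^ card J0 / ?D" using D by (intro divide_left_mono) auto
    finally show ?thesis by simp
  qed
  have e: "exp (ll y \<beta>0) \<le> exp (ll y (mle n p X b y J0))"
    using m0(2) \<beta>0_coord[of J0] by (auto simp: is_mle_log_lik)
  have "exp (- \<gamma> * q * ln p + ll y \<beta>0 + ln F4 - q / 2 * ln (?N + 1)) =
     exp (- \<gamma> * q * ln p) * (exp (ll y \<beta>0) * F4 * exp (- (q / 2 * ln (?N + 1))))"
    using assms(5) by (simp only: exp_add diff_conv_add_uminus exp_ln mult.assoc)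
  also have "\<dots> \<le> Laplace_gen \<gamma> n p X b f y J0"
    unfolding Laplace_gen_mle
    using c s e assms(5,6) by (intro mult_mono) auto
  finally show ?thesis .
qed

text \<open>For \<open>J\<close> the binomial factor is at most 1, and so is the determinant factor,
  by \<open>2 * pi \<le> real n * lam\<close>. The loss in the likelihood must then pay for
  everything that was given away in the lower bound for the truth.\<close>

lemma Laplace_gen_missing_signal:
  fixes \<gamma> F3 F4 s :: real
  assumes "score_bounded y \<sigma>" "4 * \<sigma> \<le> real n * c_lower (a\<^sub>0 + 1)" "J \<in> submodels p q"
    "\<not> J0 \<subseteq> J" "0 \<le> s" "\<And>j. j \<in> J0 \<Longrightarrow> s \<le> \<bar>\<beta>0 j\<bar>" "4 * \<sigma> \<le> real n * lam * s"
    "1 \<le> p" "0 \<le> \<gamma>" "2 * pi \<le> real n * lam"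
    "0 < F3" "f J (mle n p X b y J) \<le> F3" "0 < F4" "F4 \<le> f J0 (mle n p X b y J0)"
    "ln F3 + \<gamma> * q * ln p + q / 2 * ln (real n * Lam + 1) < ln F4 + real n * lam * s\<^sup>2 / 4"
  shows "Laplace_gen \<gamma> n p X b f y J < Laplace_gen \<gamma> n p X b f y J0"
proof -
  note m = mle_near[OF assms(1-3)]
  let ?D = "subdet J (hess (mle n p X b y J))"
  have D: "(2 * pi) ^ card J \<le> ?D"
  proof -
    have "(2 * pi) ^ card J \<le> (real n * lam) ^ card J" using assms(10) by (intro power_mono) auto
    also have "\<dots> \<le> ?D" by (rule subdet_mle_lower[OF assms(3) m(3,5)])
    finally show ?thesis .
  qed
  have D0: "0 < ?D" using D by (rule less_le_trans[rotated]) simp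
  have sq: "sqrt ((2 * pi) ^ card J / ?D) \<le> 1" using D D0 by simp
  have sq0: "0 \<le> sqrt ((2 * pi) ^ card J / ?D)" using D0 by simp
  have pos: "1 \<le> p choose card J" using card_submodel_le[OF assms(3)] by (simp add: Suc_le_eq)
  have c: "real (p choose card J) powr (- \<gamma>) \<le> 1"
  proof -
    have "real (p choose card J) powr (- \<gamma>) \<le> 1 powr (- \<gamma>)"
      using pos assms(9) by (intro powr_mono2') auto
    then show ?thesis by simp
  qed
  have e: "exp (ll y (mle n p X b y J)) \<le> exp (ll y \<beta>0 - real n * lam * s\<^sup>2 / 4)"
    using log_lik_missing_signal[OF assms(1-7)] by simp
  have "exp (ll y (mle n p X b y J)) * f J (mle n p X b y J) * sqrt ((2 * pi) ^ card J / ?D)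
      \<le> exp (ll y (mle n p X b y J)) * F3 * sqrt ((2 * pi) ^ card J / ?D)"
    using assms(12) sq0 by (intro mult_right_mono mult_left_mono) auto
  also have "\<dots> \<le> exp (ll y \<beta>0 - real n * lam * s\<^sup>2 / 4) * F3 * 1"
    using e sq assms(11) sq0 by (intro mult_mono) auto
  finally have "Laplace_gen \<gamma> n p X b f y J \<le>
      real (p choose card J) powr (- \<gamma>) * (exp (ll y \<beta>0 - real n * lam * s\<^sup>2 / 4) * F3)"
    unfolding Laplace_gen_mle by (intro mult_left_mono) auto
  also have "\<dots> \<le> 1 * (exp (ll y \<beta>0 - real n * lam * s\<^sup>2 / 4) * F3)"
    using c assms(11) by (intro mult_right_mono) auto
  also have "\<dots> = exp (ll y \<beta>0 - real n * lam * s\<^sup>2 / 4 + ln F3)" using assms(11) by (simp add: exp_add)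
  also have "\<dots> < exp (- \<gamma> * q * ln p + ll y \<beta>0 + ln F4 - q / 2 * ln (real n * Lam + 1))"
    using assms(15) by simp
  also have "\<dots> \<le> Laplace_gen \<gamma> n p X b f y J0"
    by (rule Laplace_gen_truth_lower[where \<sigma> = \<sigma>]) (use assms in auto)
  finally show ?thesis .
qed

text \<open>Here \<open>J\<close> is compared with the actual value of the criterion at
  \<open>J0\<close>, not with a lower bound: the factors shared by both models can be larger than
  the difference that decides, so they have to cancel.\<close>

lemma Laplace_gen_overfit:
  fixes \<gamma> F3 F4 x :: real
  assumes "score_bounded y \<sigma>" "4 * \<sigma> \<le> real n * c_lower (a\<^sub>0 + 1)" "J \<in> submodels p q"
    "J0 \<subseteq> J" "0 \<le> \<sigma>"
    "\<And>w. w \<in> coord_space J \<Longrightarrow> (\<And>v. v \<in> coord_space J0 \<Longrightarrow> bform {1..p} (hess \<beta>0) v w = 0) \<Longrightarrow>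
       sc y \<beta>0 w - qf \<beta>0 w / 2 \<le> x"
    "q < p" "0 \<le> \<gamma>"
    "0 < F3" "f J (mle n p X b y J) \<le> F3" "0 < F4" "F4 \<le> f J0 (mle n p X b y J0)"
  defines "\<delta> \<equiv> 2 * \<sigma> / (real n * lam)" and "k \<equiv> card (J - J0)"
  assumes num: "x + real n * c_change * \<delta> ^ 3 + ln F3 + q / 2 * ln (1 + 2 * c_change * \<delta> / lam)
     < ln F4 + k / 2 * ln (real n * lam / (2 * pi)) + \<gamma> * k * ln ((real p - real q) / real q)"
  shows "Laplace_gen \<gamma> n p X b f y J < Laplace_gen \<gamma> n p X b f y J0"
proof -
  note m = mle_near[OF assms(1-3)]
  note m0 = mle_near[OF assms(1,2) J0_submodel]
  let ?b = "mle n p X b y J" and ?bz = "mle n p X b y J0"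
  let ?D = "subdet J (hess ?b)" and ?Dz = "subdet J0 (hess ?bz)"
  let ?t = "1 + 2 * c_change * \<delta> / lam"
  let ?N = "real n * lam"
  let ?s = "card J0"
  let ?r = "(real p - real q) / real q"
  have N: "0 < ?N" using n lam_pos by simp
  have \<delta>: "0 \<le> \<delta>" using assms(5) N by (simp add: \<delta>_def)
  have t: "1 \<le> ?t" using \<delta> c_change lam_pos by simp
  have r: "0 < ?r" using assms(7) q by simp
  have cardJ: "card J = ?s + k"
    using card_Un_disjoint[of J0 "J - J0"] submodelsD[OF assms(3)] finite_J0 assms(4)
    by (simp add: k_def Un_absorb1)
  have skq: "?s + k \<le> q" using submodelsD[OF assms(3)] cardJ by simp
  have D0: "0 < ?Dz" by (rule subdet_mle_upper(2)[OF m0(3,5)])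
  have cmp: "?N ^ k * ?Dz \<le> ?t ^ ?s * ?D"
    unfolding k_def
    using mle_close[OF assms(1-5)] mle_close[OF assms(1,2) J0_submodel _ assms(5)]
    by (intro subdet_overfit[OF assms(3,4) m(3) m0(3) m(5)]) (auto simp: \<delta>_def)
  have D: "0 < ?D"
  proof -
    have "0 < ?N ^ k * ?Dz" using N D0 by simp
    then have "0 < ?t ^ ?s * ?D" using cmp by linarith
    then show ?thesis using t by (simp add: zero_less_mult_iff)
  qed
  have ts: "?t ^ ?s \<le> ?t ^ q" using t \<beta>0(2) by (rule power_increasing[rotated])
  have dets: "(2 * pi) ^ card J / ?D \<le> (2 * pi) ^ ?s / ?Dz * (?t ^ q * (2 * pi / ?N) ^ k)"
  proof -
    have "?N ^ k * ?Dz \<le> ?t ^ q * ?D" using cmp ts D by (meson mult_right_mono less_imp_le order_trans)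
    moreover have "1 / d \<le> c / a" if "0 < a" "0 < d" "a \<le> c * d" for a c d :: real
      using that by (simp add: field_simps)
    ultimately have "1 / ?D \<le> ?t ^ q / (?N ^ k * ?Dz)" using D D0 N by simp
    then have "(2 * pi) ^ card J * (1 / ?D) \<le> (2 * pi) ^ card J * (?t ^ q / (?N ^ k * ?Dz))"
      by (intro mult_left_mono) auto
    also have "\<dots> = (2 * pi) ^ ?s / ?Dz * (?t ^ q * (2 * pi / ?N) ^ k)"
      unfolding cardJ power_add power_divide by (simp only: times_divide_times_eq times_divide_eq_right
        times_divide_eq_left divide_divide_eq_left mult_ac)
    finally show ?thesis by simp
  qed
  have sq: "sqrt ((2 * pi) ^ card J / ?D) \<le>
      sqrt ((2 * pi) ^ ?s / ?Dz) * exp (q / 2 * ln ?t - k / 2 * ln (?N / (2 * pi)))"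
  proof -
    have "?t ^ q * (2 * pi / ?N) ^ k = exp (q * ln ?t + k * ln (2 * pi / ?N))"
      using t N by (simp add: exp_add exp_of_nat_mult)
    also have "ln (2 * pi / ?N) = - ln (?N / (2 * pi))"
      using N by (simp add: ln_div)
    also have "sqrt (exp (q * ln ?t + k * (- ln (?N / (2 * pi))))) =
        exp (q / 2 * ln ?t - k / 2 * ln (?N / (2 * pi)))"
      by (rule real_sqrt_unique) (auto simp: exp_double[symmetric] algebra_simps)
    finally have "sqrt (?t ^ q * (2 * pi / ?N) ^ k) = exp (q / 2 * ln ?t - k / 2 * ln (?N / (2 * pi)))" .
    moreover have "sqrt ((2 * pi) ^ card J / ?D) \<le> sqrt ((2 * pi) ^ ?s / ?Dz * (?t ^ q * (2 * pi / ?N) ^ k))"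
      using dets by (rule real_sqrt_le_mono)
    ultimately show ?thesis by (simp only: real_sqrt_mult)
  qed
  have c: "real (p choose card J) powr (- \<gamma>) \<le> real (p choose ?s) powr (- \<gamma>) * exp (- (\<gamma> * k * ln ?r))"
  proof -
    have "?r ^ k * real (p choose ?s) \<le> real (p choose (?s + k))"
      using skq assms(7) q by (intro binomial_add_ge) auto
    moreover have "0 < p choose ?s" using card_submodel_le[OF J0_submodel] by simp
    ultimately have "real (p choose card J) powr (- \<gamma>) \<le> (?r ^ k * real (p choose ?s)) powr (- \<gamma>)"
      unfolding cardJ using assms(7,8) q by (intro powr_mono2') (auto intro!: mult_pos_pos)
    also have "\<dots> = real (p choose ?s) powr (- \<gamma>) * (?r ^ k) powr (- \<gamma>)"
      using r by (simp add: powr_mult)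
    also have "(?r ^ k) powr (- \<gamma>) = exp (- (\<gamma> * k * ln ?r))"
      using r assms(7) q by (simp add: powr_def ln_realpow)
    finally show ?thesis .
  qed
  have e: "exp (ll y ?b) \<le> exp (ll y ?bz) * exp (x + real n * c_change * \<delta> ^ 3)"
    using log_lik_overfit[OF assms(1-6)] by (simp add: exp_add[symmetric] \<delta>_def)
  have L0: "0 < Laplace_gen \<gamma> n p X b f y J0"
    unfolding Laplace_gen_mle
    using assms(11,12) D0 card_submodel_le[OF J0_submodel]
    by (intro mult_pos_pos) auto
  let ?E = "x + real n * c_change * \<delta> ^ 3 + ln F3 + q / 2 * ln ?t - ln F4
    - k / 2 * ln (?N / (2 * pi)) - \<gamma> * k * ln ?r"
  have "exp (ll y ?b) * f J ?b * sqrt ((2 * pi) ^ card J / ?D) \<le>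
      exp (ll y ?b) * F3 * sqrt ((2 * pi) ^ card J / ?D)"
    using assms(10) D by (intro mult_right_mono mult_left_mono) auto
  also have "\<dots> \<le> (exp (ll y ?bz) * exp (x + real n * c_change * \<delta> ^ 3)) * F3 *
     (sqrt ((2 * pi) ^ ?s / ?Dz) * exp (q / 2 * ln ?t - k / 2 * ln (?N / (2 * pi))))"
    using e sq assms(9) D by (intro mult_mono) auto
  finally have "Laplace_gen \<gamma> n p X b f y J \<le> (real (p choose ?s) powr (- \<gamma>) * exp (- (\<gamma> * k * ln ?r))) *
     ((exp (ll y ?bz) * exp (x + real n * c_change * \<delta> ^ 3)) * F3 *
     (sqrt ((2 * pi) ^ ?s / ?Dz) * exp (q / 2 * ln ?t - k / 2 * ln (?N / (2 * pi)))))"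
    (is "_ \<le> ?A * ?B")
  proof -
    assume le: "exp (ll y ?b) * f J ?b * sqrt ((2 * pi) ^ card J / ?D) \<le> ?B"
    have B: "0 \<le> ?B" using assms(9) D0 by simp
    have "Laplace_gen \<gamma> n p X b f y J \<le> real (p choose card J) powr (- \<gamma>) * ?B"
      unfolding Laplace_gen_mle by (rule mult_left_mono[OF le]) simp
    also have "\<dots> \<le> ?A * ?B" by (rule mult_right_mono[OF c B])
    finally show ?thesis .
  qed
  also have "?A * ?B = real (p choose ?s) powr (- \<gamma>) * (exp (ll y ?bz) * F4 * sqrt ((2 * pi) ^ ?s / ?Dz)) * exp ?E"
  proof -
    have "exp ?E = exp (x + real n * c_change * \<delta> ^ 3) * F3 * exp (q / 2 * ln ?t - k / 2 * ln (?N / (2 * pi)))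
        * exp (- (\<gamma> * k * ln ?r)) / F4"
    proof -
      have "?E = (x + real n * c_change * \<delta> ^ 3) + ln F3 + (q / 2 * ln ?t - k / 2 * ln (?N / (2 * pi)))
        + (- (\<gamma> * k * ln ?r)) - ln F4" by simp
      then show ?thesis using assms(9,11) by (simp only: exp_add exp_diff exp_ln)
    qed
    then show ?thesis using assms(11) by simp
  qed
  also have "\<dots> \<le> Laplace_gen \<gamma> n p X b f y J0 * exp ?E"
    unfolding Laplace_gen_mle
    using assms(12) D0 by (intro mult_right_mono mult_left_mono) auto
  also have "\<dots> < Laplace_gen \<gamma> n p X b f y J0 * 1"
    using L0 num by (intro mult_strict_left_mono) auto
  finally show ?thesis by simp
qed

end

section \<open>Measurability\<close>

text \<open>Leibniz's formula makes the determinant a polynomial in the entries.\<close>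

lemma measurable_subdet:
  assumes "\<And>j k. (\<lambda>\<omega>. A \<omega> j k) \<in> borel_measurable M"
  shows "(\<lambda>\<omega>. subdet J (A \<omega>)) \<in> borel_measurable M"
proof -
  let ?n = "card J" and ?l = "\<lambda>r. sorted_list_of_set J ! r"
  have "subdet J B = (\<Sum>p | p permutes {0..<?n}. signof p * (\<Prod>i = 0..<?n. B (?l i) (?l (p i))))" for B
  proof -
    have "subdet J B = (\<Sum>p | p permutes {0..<?n}. signof p * (\<Prod>i = 0..<?n.
        Matrix.mat ?n ?n (\<lambda>(r, s). B (?l r) (?l s)) $$ (i, p i)))"
      unfolding subdet_def by (rule det_def') simp
    also have "\<dots> = (\<Sum>p | p permutes {0..<?n}. signof p * (\<Prod>i = 0..<?n. B (?l i) (?l (p i))))"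
    proof (intro sum.cong prod.cong refl arg_cong2[where f = "(*)"])
      fix p i assume "p \<in> {p. p permutes {0..<?n}}" "i \<in> {0..<?n}"
      then have "p i < ?n" "i < ?n" using permutes_in_image[of p "{0..<?n}" i] by auto
      then show "Matrix.mat ?n ?n (\<lambda>(r, s). B (?l r) (?l s)) $$ (i, p i) = B (?l i) (?l (p i))" by simp
    qed
    finally show ?thesis .
  qed
  then show ?thesis using assms by simp
qed

lemma lin_pred_unit: "j \<in> {1..p} \<Longrightarrow> lin_pred p X i (\<lambda>k. if k = j then 1 else 0) = X i j"
  by (simp add: lin_pred_def if_distrib[of "\<lambda>x. _ * x"] cong: if_cong)

lemma score_coord:
  "score n p X b y \<beta> d = (\<Sum>j\<in>{1..p}. d j * ((\<Sum>i\<in>{1..n}. X i j * y i) -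
     (\<Sum>i\<in>{1..n}. X i j * deriv b (lin_pred p X i \<beta>))))"
proof -
  have "score n p X b y \<beta> d = (\<Sum>i\<in>{1..n}. \<Sum>j\<in>{1..p}. (y i - deriv b (lin_pred p X i \<beta>)) * (X i j * d j))"
    by (simp add: score_def lin_pred_def[of p X _ d] sum_distrib_left)
  also have "\<dots> = (\<Sum>j\<in>{1..p}. \<Sum>i\<in>{1..n}. (y i - deriv b (lin_pred p X i \<beta>)) * (X i j * d j))"
    by (rule sum.swap)
  also have "\<dots> = (\<Sum>j\<in>{1..p}. d j * ((\<Sum>i\<in>{1..n}. X i j * y i) -
     (\<Sum>i\<in>{1..n}. X i j * deriv b (lin_pred p X i \<beta>))))"
    unfolding sum_subtractf[symmetric] sum_distrib_left
    by (intro sum.cong refl) (simp add: algebra_simps)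
  finally show ?thesis .
qed

context regular_glm
begin

text \<open>Sufficient statistic of the submodel; \<open>mean_stat\<close> is its expectation in the
  exponential family. In these terms the score equations have the data on one side and the parameter
  on the other.\<close>

definition suff_stat :: "nat set \<Rightarrow> (nat \<Rightarrow> real) \<Rightarrow> nat \<Rightarrow> real" where
  "suff_stat J y = (\<lambda>j. if j \<in> J then \<Sum>i\<in>{1..n}. X i j * y i else 0)"

definition mean_stat :: "nat set \<Rightarrow> (nat \<Rightarrow> real) \<Rightarrow> nat \<Rightarrow> real" where
  "mean_stat J \<beta> = (\<lambda>j. if j \<in> J then \<Sum>i\<in>{1..n}. X i j * deriv b (lp i \<beta>) else 0)"

lemma is_mle_iff_stat:
  assumes "J \<in> submodels p q"
  shows "is_mle n p X b y J \<beta> \<longleftrightarrow> \<beta> \<in> coord_space J \<and> mean_stat J \<beta> = suff_stat J y"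
proof -
  have "(\<forall>d\<in>coord_space J. sc y \<beta> d = 0) \<longleftrightarrow> mean_stat J \<beta> = suff_stat J y"
  proof
    assume *: "\<forall>d\<in>coord_space J. sc y \<beta> d = 0"
    show "mean_stat J \<beta> = suff_stat J y"
    proof
      fix j
      show "mean_stat J \<beta> j = suff_stat J y j"
      proof (cases "j \<in> J")
        case True
        define e :: "nat \<Rightarrow> real" where "e = (\<lambda>k. if k = j then 1 else 0)"
        have "e \<in> coord_space J" using True by (auto simp: e_def coord_space_def)
        then have "sc y \<beta> e = 0" using * by blast
        then have "(\<Sum>i\<in>{1..n}. (y i - deriv b (lp i \<beta>)) * X i j) = 0"
          using True submodelsD[OF assms] by (auto simp: score_def e_def lin_pred_unit subset_iff)
        then show ?thesis using True
          by (simp add: suff_stat_def mean_stat_def algebra_simps sum_subtractf)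
      qed (simp add: suff_stat_def mean_stat_def)
    qed
  next
    assume *: "mean_stat J \<beta> = suff_stat J y"
    show "\<forall>d\<in>coord_space J. sc y \<beta> d = 0"
    proof
      fix d assume d: "d \<in> coord_space J"
      show "sc y \<beta> d = 0"
        unfolding score_coord
      proof (rule sum.neutral, rule ballI)
        fix j
        show "d j * ((\<Sum>i\<in>{1..n}. X i j * y i) - (\<Sum>i\<in>{1..n}. X i j * deriv b (lp i \<beta>))) = 0"
          using d fun_cong[OF *, of j] by (cases "j \<in> J") (auto simp: suff_stat_def mean_stat_def coord_space_def)
      qed
    qed
  qed
  then show ?thesis using is_mle_iff_score[OF assms] by blast
qed

lemma continuous_on_mean_stat: "continuous_on S (mean_stat J)"
proof (rule continuous_on_coordinatewise_then_product)
  fix j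
  have cb: "continuous_on UNIV (deriv b)" using b(2) by (auto intro!: DERIV_continuous_on)
  show "continuous_on S (\<lambda>\<beta>. mean_stat J \<beta> j)"
    unfolding mean_stat_def
    by (cases "j \<in> J") (auto intro!: continuous_intros continuous_on_lin_pred continuous_on_compose2[OF cb])
qed

text \<open>The estimator is given only implicitly, but the event says that the sufficient statistic
  lies in the image of a closed part of \<open>coord_space J\<close> under the continuous map
  \<open>mean_stat J\<close>. That part is a countable union of compact sets, hence so is its image,
  which is therefore Borel.\<close>

lemma sets_mle_in_closed:
  assumes J: "J \<in> submodels p q" and C: "closed C"
    and Y: "\<And>i. i \<in> {1..n} \<Longrightarrow> Y i \<in> borel_measurable M"
  shows "{\<omega> \<in> space M. \<exists>\<beta>. is_mle n p X b (\<lambda>i. Y i \<omega>) J \<beta> \<and> \<beta> \<in> C} \<in> sets M"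
proof -
  define B where "B m = {\<beta> :: nat \<Rightarrow> real. \<forall>j. \<beta> j \<in> (if j \<in> J then {- real m..real m} else {0})}" for m :: nat
  define T where "T \<omega> = suff_stat J (\<lambda>i. Y i \<omega>)" for \<omega>
  have T: "T \<in> borel_measurable M"
  proof (rule measurable_coordinatewise_then_product)
    fix j
    show "(\<lambda>\<omega>. T \<omega> j) \<in> borel_measurable M"
      unfolding T_def suff_stat_def using Y by (cases "j \<in> J") auto
  qed
  have cs: "coord_space J = (\<Union>m. B m)"
  proof (rule Set.set_eqI, rule iffI)
    fix \<beta> assume \<beta>: "\<beta> \<in> coord_space J"
    obtain m :: nat where m: "L2_set \<beta> J \<le> real m" using real_arch_simple by blast
    have "\<bar>\<beta> j\<bar> \<le> real m" if "j \<in> J" for j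
      using member_le_L2_set[of J j "\<lambda>i. \<bar>\<beta> i\<bar>"] that submodelsD[OF J] m by (auto simp: L2_set_def)
    then have "\<beta> \<in> B m" using \<beta> by (fastforce simp: B_def coord_space_def abs_le_iff)
    then show "\<beta> \<in> (\<Union>m. B m)" by blast
  next
    fix \<beta> assume "\<beta> \<in> (\<Union>m. B m)"
    then obtain m where m: "\<beta> j \<in> (if j \<in> J then {- real m..real m} else {0})" for j
      by (auto simp: B_def)
    have "\<beta> j = 0" if "j \<notin> J" for j using m[of j] that by simp
    then show "\<beta> \<in> coord_space J" by (simp add: coord_space_def)
  qed
  have "{\<omega> \<in> space M. \<exists>\<beta>. is_mle n p X b (\<lambda>i. Y i \<omega>) J \<beta> \<and> \<beta> \<in> C} =
      (\<Union>m. T -` (mean_stat J ` (B m \<inter> C)) \<inter> space M)"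
  proof -
    have "(\<exists>\<beta>. is_mle n p X b (\<lambda>i. Y i \<omega>) J \<beta> \<and> \<beta> \<in> C) \<longleftrightarrow>
        (\<exists>m. T \<omega> \<in> mean_stat J ` (B m \<inter> C))" for \<omega>
    proof
      assume "\<exists>\<beta>. is_mle n p X b (\<lambda>i. Y i \<omega>) J \<beta> \<and> \<beta> \<in> C"
      then obtain \<beta> m where "\<beta> \<in> B m" "\<beta> \<in> C" "T \<omega> = mean_stat J \<beta>"
        unfolding is_mle_iff_stat[OF J] cs T_def by auto
      then show "\<exists>m. T \<omega> \<in> mean_stat J ` (B m \<inter> C)" by blast
    next
      assume "\<exists>m. T \<omega> \<in> mean_stat J ` (B m \<inter> C)"
      then obtain \<beta> m where "\<beta> \<in> B m" "\<beta> \<in> C" "T \<omega> = mean_stat J \<beta>" by blast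
      then show "\<exists>\<beta>. is_mle n p X b (\<lambda>i. Y i \<omega>) J \<beta> \<and> \<beta> \<in> C"
        unfolding is_mle_iff_stat[OF J] cs T_def by auto
    qed
    then show ?thesis by auto
  qed
  moreover have "mean_stat J ` (B m \<inter> C) \<in> sets borel" for m
  proof -
    have "compact (B m \<inter> C)" unfolding B_def by (intro compact_Int_closed compact_box C)
    then have "compact (mean_stat J ` (B m \<inter> C))"
      by (intro compact_continuous_image continuous_on_mean_stat)
    then show ?thesis by (intro borel_closed compact_imp_closed)
  qed
  ultimately show ?thesis using T by (auto intro!: sets.countable_UN measurable_sets)
qed

text \<open>\<open>mle\<close> is a definite description, unspecified where no estimator exists; the
  default zero gives a function that is measurable everywhere.\<close>

definition mle_or_zero :: "nat set \<Rightarrow> (nat \<Rightarrow> real) \<Rightarrow> nat \<Rightarrow> real" where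
  "mle_or_zero J y = (if mle_exists n p X b y J then mle n p X b y J else (\<lambda>_. 0))"

lemma mle_is_mle: "mle_exists n p X b y J \<Longrightarrow> is_mle n p X b y J (mle n p X b y J)"

  unfolding mle_exists_def mle_def by (rule theI'[of "is_mle n p X b y J"])

lemma sets_mle_exists:
  assumes "J \<in> submodels p q" "\<And>i. i \<in> {1..n} \<Longrightarrow> Y i \<in> borel_measurable M"
  shows "{\<omega> \<in> space M. mle_exists n p X b (\<lambda>i. Y i \<omega>) J} \<in> sets M"
  using sets_mle_in_closed[OF assms(1) closed_UNIV assms(2)] by (simp add: mle_exists_iff[OF assms(1)])

lemma measurable_mle_or_zero:
  assumes "J \<in> submodels p q" "\<And>i. i \<in> {1..n} \<Longrightarrow> Y i \<in> borel_measurable M"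
  shows "(\<lambda>\<omega>. mle_or_zero J (\<lambda>i. Y i \<omega>) j) \<in> borel_measurable M"
proof (subst borel_measurable_iff_le, rule allI)
  fix c :: real
  let ?E = "{\<omega> \<in> space M. mle_exists n p X b (\<lambda>i. Y i \<omega>) J}"
  let ?C = "{\<omega> \<in> space M. \<exists>\<beta>. is_mle n p X b (\<lambda>i. Y i \<omega>) J \<beta> \<and> \<beta> \<in> {\<beta>. \<beta> j \<le> c}}"
  have cl: "closed {\<beta> :: nat \<Rightarrow> real. \<beta> j \<le> c}"
    by (intro closed_Collect_le continuous_on_product_coordinates continuous_on_const)
  have "?C \<in> sets M" by (rule sets_mle_in_closed[OF assms(1) cl assms(2)])
  moreover have "?E \<in> sets M" by (rule sets_mle_exists[OF assms])
  moreover have "{\<omega> \<in> space M. mle_or_zero J (\<lambda>i. Y i \<omega>) j \<le> c} =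
      ?C \<union> (if 0 \<le> c then space M - ?E else {})"
  proof (rule Set.set_eqI)
    fix \<omega>
    let ?y = "\<lambda>i. Y i \<omega>"
    show "\<omega> \<in> {\<omega> \<in> space M. mle_or_zero J (\<lambda>i. Y i \<omega>) j \<le> c} \<longleftrightarrow>
      \<omega> \<in> ?C \<union> (if 0 \<le> c then space M - ?E else {})"
    proof (cases "mle_exists n p X b ?y J")
      case True
      have "is_mle n p X b ?y J \<beta> \<longleftrightarrow> \<beta> = mle n p X b ?y J" for \<beta>
        using mle_is_mle[OF True] mle_eqI[OF assms(1)] by blast
      then show ?thesis using True by (auto simp: mle_or_zero_def)
    next
      case False
      then have "\<not> is_mle n p X b ?y J \<beta>" for \<beta> using mle_exists_iff[OF assms(1)] by blast
      then show ?thesis using False by (auto simp: mle_or_zero_def)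
    qed
  qed
  ultimately show "{\<omega> \<in> space M. mle_or_zero J (\<lambda>i. Y i \<omega>) j \<le> c} \<in> sets M" by simp
qed

lemma mle_or_zero_coord: "mle_or_zero J y \<in> coord_space J"
  using mle_is_mle[of y J] by (auto simp: mle_or_zero_def is_mle_log_lik)

text \<open>A measurable version \<open>L\<close> is provided, since the criterion is unspecified
  where the estimator does not exist. The prior is measurable on the product space over
  \<open>J\<close>, which the estimator enters through its restriction.\<close>

lemma measurable_Laplace:
  assumes J: "J \<in> submodels p q" and Y: "\<And>i. i \<in> {1..n} \<Longrightarrow> Y i \<in> borel_measurable M"
    and f: "prior_density J (f J)"
  shows "\<exists>L\<in>borel_measurable M. \<forall>\<omega>\<in>space M. mle_exists n p X b (\<lambda>i. Y i \<omega>) J \<longrightarrow>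
    Laplace_gen \<gamma> n p X b f (\<lambda>i. Y i \<omega>) J = L \<omega>"
proof -
  define Z where "Z \<omega> = mle_or_zero J (\<lambda>i. Y i \<omega>)" for \<omega>
  have Zm: "(\<lambda>\<omega>. Z \<omega> j) \<in> borel_measurable M" for j
    unfolding Z_def by (rule measurable_mle_or_zero[OF J Y])
  have Zlp: "(\<lambda>\<omega>. lp i (Z \<omega>)) \<in> borel_measurable M" for i
    unfolding lin_pred_def using Zm by simp
  have cb: "continuous_on UNIV b" using b(1) by (auto intro!: DERIV_continuous_on)
  have bm: "b \<in> borel_measurable borel" "deriv (deriv b) \<in> borel_measurable borel"
    using cb b(3) by (auto intro!: borel_measurable_continuous_onI)
  have ll: "(\<lambda>\<omega>. ll (\<lambda>i. Y i \<omega>) (Z \<omega>)) \<in> borel_measurable M"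
    unfolding log_lik_def using Y Zlp measurable_compose[OF Zlp bm(1)]
    by (intro borel_measurable_sum borel_measurable_diff borel_measurable_times) auto
  have hm: "(\<lambda>\<omega>. hess (Z \<omega>) j k) \<in> borel_measurable M" for j k
    unfolding neg_hess_def using measurable_compose[OF Zlp bm(2)]
    by (intro borel_measurable_sum borel_measurable_times) auto
  have fm: "(\<lambda>\<omega>. f J (Z \<omega>)) \<in> borel_measurable M"
  proof -
    have "(\<lambda>\<omega>. restrict (Z \<omega>) J) \<in> measurable M (\<Pi>\<^sub>M j\<in>J. lborel)"
      using Zm by (intro measurable_restrict) (simp add: measurable_lborel1)
    moreover have "(\<lambda>x. f J (\<lambda>j. if j \<in> J then x j else 0)) \<in> borel_measurable (\<Pi>\<^sub>M j\<in>J. lborel)"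
      using f by (simp add: prior_density_def)
    ultimately have "(\<lambda>\<omega>. f J (\<lambda>j. if j \<in> J then restrict (Z \<omega>) J j else 0)) \<in> borel_measurable M"
      by (rule measurable_compose)
    moreover have "(\<lambda>j. if j \<in> J then restrict (Z \<omega>) J j else 0) = Z \<omega>" for \<omega>
      using mle_or_zero_coord[of J] by (auto simp: Z_def coord_space_def)
    ultimately show ?thesis by simp
  qed
  define L where "L \<omega> = real (p choose card J) powr (- \<gamma>) *
     (exp (ll (\<lambda>i. Y i \<omega>) (Z \<omega>)) * f J (Z \<omega>) * sqrt ((2 * pi) ^ card J / subdet J (hess (Z \<omega>))))" for \<omega>
  have "L \<in> borel_measurable M"
    unfolding L_def using ll fm measurable_subdet[OF hm] by measurable
  moreover have "Laplace_gen \<gamma> n p X b f (\<lambda>i. Y i \<omega>) J = L \<omega>" if "mle_exists n p X b (\<lambda>i. Y i \<omega>) J" for \<omega>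
    using that by (simp add: L_def Z_def mle_or_zero_def Laplace_gen_def Laplace_def lik_def Let_def)
  ultimately show ?thesis by blast
qed

text \<open>The probability of selection is bounded below through a subset, and monotonicity of the
  measure asks for a measurable superset.\<close>

lemma sets_selects_truth:
  assumes Y: "\<And>i. i \<in> {1..n} \<Longrightarrow> Y i \<in> borel_measurable M"
    and f: "\<And>J. J \<in> submodels p q \<Longrightarrow> prior_density J (f J)"
  shows "{\<omega> \<in> space M. selects_truth \<gamma> n p q X b f \<beta>0 (\<lambda>i. Y i \<omega>)} \<in> sets M"
proof -
  let ?S = "submodels p q"
  let ?y = "\<lambda>\<omega> i. Y i \<omega>"
  have fin: "finite ?S" by (rule finite_subset[of _ "Pow {1..p}"]) (auto simp: submodels_def)
  obtain L where L: "\<And>J. J \<in> ?S \<Longrightarrow> L J \<in> borel_measurable M"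
    "\<And>J \<omega>. J \<in> ?S \<Longrightarrow> \<omega> \<in> space M \<Longrightarrow> mle_exists n p X b (?y \<omega>) J \<Longrightarrow>
       Laplace_gen \<gamma> n p X b f (?y \<omega>) J = L J \<omega>"
  proof -
    have "\<forall>J\<in>?S. \<exists>L. L \<in> borel_measurable M \<and> (\<forall>\<omega>\<in>space M. mle_exists n p X b (?y \<omega>) J \<longrightarrow>
        Laplace_gen \<gamma> n p X b f (?y \<omega>) J = L \<omega>)"
    proof
      fix J assume J: "J \<in> ?S"
      show "\<exists>L. L \<in> borel_measurable M \<and> (\<forall>\<omega>\<in>space M. mle_exists n p X b (?y \<omega>) J \<longrightarrow>
        Laplace_gen \<gamma> n p X b f (?y \<omega>) J = L \<omega>)"
        using measurable_Laplace[where Y = Y and \<gamma> = \<gamma> and f = f, OF J Y f[OF J]] by blast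
    qed
    then show ?thesis using that by (auto dest!: bchoice)
  qed
  have "{\<omega> \<in> space M. selects_truth \<gamma> n p q X b f \<beta>0 (?y \<omega>)} =
      {\<omega> \<in> space M. (\<forall>J\<in>?S. \<omega> \<in> {\<omega> \<in> space M. mle_exists n p X b (?y \<omega>) J}) \<and>
        (\<forall>J\<in>?S. J \<noteq> J0 \<longrightarrow> L J \<omega> < L J0 \<omega>)}"
    unfolding selects_truth_def argmax_singleton_iff[OF J0_submodel]
    using L(2) J0_submodel by auto
  also have "\<dots> \<in> sets M"
  proof (intro sets.sets_Collect_conj sets.sets_Collect_finite_All')
    show "{\<omega> \<in> space M. \<omega> \<in> {\<omega> \<in> space M. mle_exists n p X b (?y \<omega>) J}} \<in> sets M" if "J \<in> ?S" for J
      using sets_mle_exists[OF that Y] by simp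
    show "{\<omega> \<in> space M. J \<noteq> J0 \<longrightarrow> L J \<omega> < L J0 \<omega>} \<in> sets M" if "J \<in> ?S" for J
      using L(1)[OF that] L(1)[OF J0_submodel] by measurable
  qed (use fin J0_submodel in auto)
  finally show ?thesis .
qed

end

section \<open>Deviation bounds\<close>

text \<open>Chernoff's bound with parameter 1, the free parameter being the length of
  \<open>u\<close>. Independence makes the moment generating function a product, and after centring
  it is exactly the exponential of the Bregman term.\<close>

lemma score_tail:
  assumes "glm_problem M Y \<mu> b n p q X \<beta>0"
  shows "measure M {\<omega> \<in> space M. t \<le> score n p X b (\<lambda>i. Y i \<omega>) \<beta>0 u} \<le> exp (bregman n p X b \<beta>0 u - t)"
proof -
  interpret prob_space M using assms by (simp add: glm_problem_def)
  let ?th = "\<lambda>i. lin_pred p X i \<beta>0" and ?v = "\<lambda>i. lin_pred p X i u"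
  have ind: "indep_vars (\<lambda>_. borel) Y {1..n}" using assms by (simp add: glm_problem_def)
  have Ym[measurable]: "Y i \<in> borel_measurable M" if "i \<in> {1..n}" for i
    using ind that by (simp add: indep_vars_def2)
  have mgf: "(\<integral>\<^sup>+\<omega>. ennreal (exp (?v i * Y i \<omega>)) \<partial>M) = ennreal (exp (b (?th i + ?v i) - b (?th i)))"
    if "i \<in> {1..n}" for i
    using assms that by (intro exp_family_mgf[where \<mu> = \<mu>]) (auto simp: glm_problem_def)
  let ?S = "\<lambda>\<omega>. score n p X b (\<lambda>i. Y i \<omega>) \<beta>0 u"
  have Sm: "?S \<in> borel_measurable M" unfolding score_def by measurable
  have "ennreal (prob {\<omega> \<in> space M. t \<le> ?S \<omega>}) = emeasure M {\<omega> \<in> space M. t \<le> ?S \<omega>}"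
    by (simp add: emeasure_eq_measure)
  also have "\<dots> \<le> ennreal (exp (- 1 * t)) * (\<integral>\<^sup>+\<omega>\<in>space M. exp (1 * ?S \<omega>) \<partial>M)"
    using Sm by (intro Chernoff_ineq_nn_integral_ge) auto
  also have "(\<integral>\<^sup>+\<omega>\<in>space M. exp (1 * ?S \<omega>) \<partial>M) =
      (\<integral>\<^sup>+\<omega>. ennreal (exp (- (\<Sum>i\<in>{1..n}. deriv b (?th i) * ?v i))) *
        (\<Prod>i\<in>{1..n}. ennreal (exp (?v i * Y i \<omega>))) \<partial>M)"
  proof (intro nn_integral_cong)
    fix \<omega> assume "\<omega> \<in> space M"
    have "?S \<omega> = - (\<Sum>i\<in>{1..n}. deriv b (?th i) * ?v i) + (\<Sum>i\<in>{1..n}. ?v i * Y i \<omega>)"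
      by (simp add: score_def algebra_simps sum_subtractf)
    then have "exp (?S \<omega>) = exp (- (\<Sum>i\<in>{1..n}. deriv b (?th i) * ?v i)) * (\<Prod>i\<in>{1..n}. exp (?v i * Y i \<omega>))"
      by (simp only: exp_add) (simp add: exp_sum)
    then show "ennreal (exp (1 * ?S \<omega>)) * indicator (space M) \<omega> =
        ennreal (exp (- (\<Sum>i\<in>{1..n}. deriv b (?th i) * ?v i))) * (\<Prod>i\<in>{1..n}. ennreal (exp (?v i * Y i \<omega>)))"
      using \<open>\<omega> \<in> space M\<close> by (simp add: ennreal_mult prod_ennreal prod_nonneg)
  qed
  also have "\<dots> = ennreal (exp (- (\<Sum>i\<in>{1..n}. deriv b (?th i) * ?v i))) *
        (\<integral>\<^sup>+\<omega>. (\<Prod>i\<in>{1..n}. ennreal (exp (?v i * Y i \<omega>))) \<partial>M)"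
    by (intro nn_integral_cmult borel_measurable_prod_ennreal) measurable
  also have "(\<integral>\<^sup>+\<omega>. (\<Prod>i\<in>{1..n}. ennreal (exp (?v i * Y i \<omega>))) \<partial>M) =
      (\<Prod>i\<in>{1..n}. \<integral>\<^sup>+\<omega>. ennreal (exp (?v i * Y i \<omega>)) \<partial>M)"
    by (intro indep_vars_nn_integral indep_vars_compose2[OF ind]) auto
  also have "\<dots> = (\<Prod>i\<in>{1..n}. ennreal (exp (b (?th i + ?v i) - b (?th i))))"
    using mgf by (intro prod.cong) auto
  also have "\<dots> = ennreal (exp (\<Sum>i\<in>{1..n}. b (?th i + ?v i) - b (?th i)))"
    by (simp add: prod_ennreal exp_sum)
  also have "ennreal (exp (- 1 * t)) * (ennreal (exp (- (\<Sum>i\<in>{1..n}. deriv b (?th i) * ?v i))) * \<dots>) =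
      ennreal (exp (bregman n p X b \<beta>0 u - t))"
    by (simp add: ennreal_mult[symmetric] mult_exp_exp bregman_def sum_subtractf sum.distrib algebra_simps)
  finally show ?thesis by simp
qed

lemma measurable_score:
  assumes "\<And>i. i \<in> {1..n} \<Longrightarrow> Y i \<in> borel_measurable M"
  shows "(\<lambda>\<omega>. score n p X b (\<lambda>i. Y i \<omega>) \<beta> u) \<in> borel_measurable M"
  unfolding score_def using assms by measurable

lemma glm_problem_measurable:
  assumes "glm_problem M Y \<mu> b n p q X \<beta>0" "i \<in> {1..n}"
  shows "Y i \<in> borel_measurable M"
proof -
  interpret prob_space M using assms by (simp add: glm_problem_def)
  show ?thesis using assms by (simp add: glm_problem_def indep_vars_def2)
qed

lemma power_le_exp_fact: "real k ^ k \<le> exp (real k) * fact k"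
proof -
  have "real k ^ k / fact k = (\<Sum>i\<in>{k}. inverse (fact i) *\<^sub>R real k ^ i)" by (simp add: divide_inverse)
  also have "\<dots> \<le> (\<Sum>i. inverse (fact i) *\<^sub>R real k ^ i)"
    by (rule sum_le_suminf[OF summable_exp_generic]) auto
  also have "\<dots> = exp (real k)" by (simp add: exp_def)
  finally show ?thesis by (simp add: divide_le_eq)
qed

text \<open>Estimating \<open>sqrt k\<close> by \<open>k\<close> bounds the grid by
  \<open>(3 * k / \<eta>) ^ k\<close>. As \<open>k ^ k\<close> is at most
  \<open>exp k * fact k\<close>, the factorial is absorbed by the binomial coefficient, and the loss
  is a constant per covariate.\<close>

lemma net_union_bound:
  fixes \<eta> a :: real
  assumes "0 < \<eta>" "\<eta> \<le> 1" "1 \<le> p" "1 \<le> k"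
  shows "real (p choose k) * ((2 * sqrt (real k) / \<eta> + 1) ^ k * exp (- a * k))
    \<le> (3 * exp 1 / \<eta> * real p * exp (- a)) ^ k"
proof -
  have "2 * sqrt (real k) / \<eta> + 1 \<le> 2 * real k / \<eta> + real k / \<eta>"
  proof (intro add_mono divide_right_mono mult_left_mono)
    have "sqrt (real k) \<le> sqrt (real k ^ 2)" using assms(4) by (intro real_sqrt_le_mono) (simp add: power2_eq_square)
    then show "sqrt (real k) \<le> real k" by simp
    show "1 \<le> real k / \<eta>" using assms by (simp add: field_simps)
  qed (use assms in auto)
  then have "2 * sqrt (real k) / \<eta> + 1 \<le> 3 / \<eta> * real k" by (simp add: field_simps)
  then have "(2 * sqrt (real k) / \<eta> + 1) ^ k \<le> (3 / \<eta> * real k) ^ k"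
    using assms by (intro power_mono) auto
  also have "\<dots> = (3 / \<eta>) ^ k * real k ^ k" by (rule power_mult_distrib)
  also have "\<dots> \<le> (3 / \<eta>) ^ k * (exp (real k) * fact k)"
    using assms by (intro mult_left_mono power_le_exp_fact) auto
  finally have 1: "(2 * sqrt (real k) / \<eta> + 1) ^ k \<le> (3 / \<eta>) ^ k * (exp (real k) * fact k)" .
  have "real ((p choose k) * fact k) \<le> real (p ^ k)" by (intro of_nat_mono binomial_fact_pow)
  then have 2: "real (p choose k) * fact k \<le> real p ^ k" by simp
  have "real (p choose k) * ((2 * sqrt (real k) / \<eta> + 1) ^ k * exp (- a * k)) \<le>
      real (p choose k) * (((3 / \<eta>) ^ k * (exp (real k) * fact k)) * exp (- a * k))"
    using 1 by (intro mult_left_mono mult_right_mono) auto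
  also have "\<dots> = (real (p choose k) * fact k) * ((3 / \<eta>) ^ k * exp (real k) * exp (- a * k))" by simp
  also have "\<dots> \<le> real p ^ k * ((3 / \<eta>) ^ k * exp (real k) * exp (- a * k))"
    using 2 assms by (intro mult_right_mono) auto
  also have "\<dots> = (3 * exp 1 / \<eta> * real p * exp (- a)) ^ k"
  proof -
    have "exp (real k) = exp 1 ^ k" "exp (- a * k) = exp (- a) ^ k"
      by (simp_all add: exp_of_nat_mult[symmetric] mult.commute)
    then show ?thesis by (simp add: power_mult_distrib power_divide)
  qed
  finally show ?thesis .
qed

context regular_glm
begin

abbreviation "evec j \<equiv> (\<lambda>k. if k = j then 1 else 0 :: real)"

text \<open>Cauchy-Schwarz over at most \<open>2 * q\<close> coordinates gives the factor
  \<open>sqrt (2 * q)\<close>.\<close>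

lemma score_bounded_coordinatewise:
  assumes "\<And>j. j \<in> {1..p} \<Longrightarrow> \<bar>sc y \<beta>0 (evec j)\<bar> \<le> \<tau>" "0 \<le> \<tau>"
  shows "score_bounded y (sqrt (2 * q) * \<tau>)"
  unfolding score_bounded_def
proof (intro allI impI)
  fix K u assume K: "admissible K" and u: "u \<in> coord_space K"
  define g where "g j = (\<Sum>i\<in>{1..n}. X i j * y i) - (\<Sum>i\<in>{1..n}. X i j * deriv b (lp i \<beta>0))" for j
  note K' = admissibleD[OF K]
  have cardK: "card K \<le> 2 * q" using K by (simp add: admissible_def submodels_def)
  have g: "\<bar>g j\<bar> \<le> \<tau>" if "j \<in> {1..p}" for j
  proof -
    have "sc y \<beta>0 (evec j) = (\<Sum>k\<in>{1..p}. if k = j then g j else 0)"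
      unfolding score_coord g_def by (intro sum.cong) auto
    also have "\<dots> = g j" using that by simp
    finally show ?thesis using assms(1)[OF that] by simp
  qed
  have "sc y \<beta>0 u = (\<Sum>j\<in>{1..p}. u j * g j)" unfolding score_coord g_def ..
  also have "\<dots> = (\<Sum>j\<in>K. u j * g j)"
    using K' u by (intro sum.mono_neutral_right) (auto simp: coord_space_def)
  also have "\<bar>\<dots>\<bar> \<le> (\<Sum>j\<in>K. \<bar>u j\<bar> * \<tau>)"
    using K' g by (intro order_trans[OF sum_abs] sum_mono) (auto simp: abs_mult intro!: mult_left_mono)
  also have "\<dots> = \<tau> * (\<Sum>j\<in>K. \<bar>1\<bar> * \<bar>u j\<bar>)" by (simp add: sum_distrib_left mult.commute)
  also have "\<dots> \<le> \<tau> * (L2_set (\<lambda>_. 1) K * L2_set u K)"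
    using assms(2) by (intro mult_left_mono L2_set_mult_ineq)
  also have "\<dots> \<le> \<tau> * (sqrt (2 * q) * L2_set u K)"
    using assms(2) cardK by (intro mult_left_mono mult_right_mono) (auto simp: L2_set_def sum_nonneg)
  finally show "\<bar>sc y \<beta>0 u\<bar> \<le> sqrt (2 * q) * \<tau> * nrm u"
    using nrm_coord[OF K u] by (simp add: mult_ac)
qed

lemma score_unit_tail:
  assumes glm: "glm_problem M Y \<mu> b n p q X \<beta>0"
    and j: "j \<in> {1..p}" and \<tau>: "0 \<le> \<tau>" "\<tau> \<le> real n * Lam"
  shows "measure M {\<omega> \<in> space M. \<tau> \<le> \<bar>sc (\<lambda>i. Y i \<omega>) \<beta>0 (evec j)\<bar>}
    \<le> 2 * exp (- (\<tau>\<^sup>2 / (2 * (real n * Lam))))"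
proof -
  interpret prob_space M using glm by (simp add: glm_problem_def)
  note Ym = glm_problem_measurable[OF glm]
  let ?N = "real n * Lam"
  have N: "0 < ?N" using n Lam_pos by simp
  \<comment> \<open>Minimiser of \<open>?N * t\<^sup>2 / 2 - t * \<tau>\<close>. It is at most 1 by
    the upper bound on \<tau>, so the shifted parameter stays in the ball where \<open>Lam\<close>
    bounds the Hessian.\<close>
  define t where "t = \<tau> / ?N"
  have t: "0 \<le> t" "t \<le> 1" using \<tau> N by (auto simp: t_def)
  note K = admissible_insert[OF j]
  have \<beta>0K: "\<beta>0 \<in> coord_space (insert j J0)" by (rule \<beta>0_coord) auto
  let ?S = "\<lambda>\<omega>. sc (\<lambda>i. Y i \<omega>) \<beta>0"
  have tail: "prob {\<omega> \<in> space M. \<tau> \<le> a * ?S \<omega> (evec j)} \<le> exp (- (\<tau>\<^sup>2 / (2 * ?N)))"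
    if a: "\<bar>a\<bar> = 1" for a :: real
  proof (cases "\<tau> = 0")
    case True
    then show ?thesis by simp
  next
    case False
    then have tpos: "0 < t" using \<tau> N by (simp add: t_def)
    define u where "u = (\<lambda>k. t * a * evec j k)"
    have e: "evec j \<in> coord_space (insert j J0)" by (simp add: coord_space_def)
    have u: "u \<in> coord_space (insert j J0)" unfolding u_def by (rule coord_space_scale[OF e])
    have ne: "nrm (evec j) = 1"
    proof -
      have "(\<Sum>i\<in>{1..p}. (evec j i)\<^sup>2) = (\<Sum>i\<in>{1..p}. if i = j then 1 else 0)" by (intro sum.cong) auto
      then show ?thesis using j by (simp add: L2_set_def)
    qed
    have nu: "nrm u = t" unfolding u_def L2_set_scale ne using t a by (simp add: abs_mult)
    have "breg \<beta>0 u \<le> ?N * (nrm u)\<^sup>2 / 2"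
      by (rule bregman_bounds(2)[OF K \<beta>0K u])
        (use \<beta>0 rad_ge a0 nrm_add[of \<beta>0 u] nu t in linarith)+
    also have "\<dots> = ?N * t\<^sup>2 / 2" by (simp only: nu)
    finally have br: "breg \<beta>0 u \<le> ?N * t\<^sup>2 / 2" .
    have "{\<omega> \<in> space M. \<tau> \<le> a * ?S \<omega> (evec j)} = {\<omega> \<in> space M. t * \<tau> \<le> ?S \<omega> u}"
      unfolding u_def score_scale using tpos by (auto simp: mult.assoc)
    then have "prob {\<omega> \<in> space M. \<tau> \<le> a * ?S \<omega> (evec j)} \<le> exp (breg \<beta>0 u - t * \<tau>)"
      using score_tail[OF glm, of "t * \<tau>" u] by simp
    also have "\<dots> \<le> exp (- (\<tau>\<^sup>2 / (2 * ?N)))"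
    proof -
      have "?N * t\<^sup>2 / 2 - t * \<tau> = - (\<tau>\<^sup>2 / (2 * ?N))"
        using N by (simp add: t_def power2_eq_square field_simps)
      then show ?thesis using br by simp
    qed
    finally show ?thesis .
  qed
  have "prob {\<omega> \<in> space M. \<tau> \<le> \<bar>?S \<omega> (evec j)\<bar>} \<le>
      prob ({\<omega> \<in> space M. \<tau> \<le> 1 * ?S \<omega> (evec j)} \<union> {\<omega> \<in> space M. \<tau> \<le> (- 1) * ?S \<omega> (evec j)})"
    using measurable_score[OF Ym] by (intro finite_measure_mono) (auto simp: abs_if split: if_splits)
  also have "\<dots> \<le> prob {\<omega> \<in> space M. \<tau> \<le> 1 * ?S \<omega> (evec j)} + prob {\<omega> \<in> space M. \<tau> \<le> (- 1) * ?S \<omega> (evec j)}"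
    using measurable_score[OF Ym] by (intro measure_Un_le) auto
  also have "\<dots> \<le> 2 * exp (- (\<tau>\<^sup>2 / (2 * ?N)))"
    using tail[of 1] tail[of "- 1"] by simp
  finally show ?thesis .
qed

text \<open>The supremum over \<open>w\<close> is half the squared norm of the score projected on
  the Hessian complement of \<open>J0\<close>, a statistic of chi-square type with
  \<open>card (J - J0)\<close> degrees of freedom. The supremum form spares the projection.\<close>

definition overfit_bounded :: "(nat \<Rightarrow> real) \<Rightarrow> real \<Rightarrow> bool" where
  "overfit_bounded y c \<longleftrightarrow> (\<forall>J\<in>submodels p q. J0 \<subset> J \<longrightarrow> (\<forall>w\<in>coord_space J.
     (\<forall>v\<in>coord_space J0. bform {1..p} (hess \<beta>0) v w = 0) \<longrightarrow>
     sc y \<beta>0 w - qf \<beta>0 w / 2 \<le> c * card (J - J0)))"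

text \<open>On the net the Bregman term is half the quadratic form up to a cubic remainder, which
  \<open>small\<close> keeps at most 1. With threshold \<open>(1 - \<eta>) * r\<^sup>2\<close> the
  exponent in the tail bound is therefore at most
  \<open>r\<^sup>2 / 2 + 1 - (1 - \<eta>) * r\<^sup>2\<close>.\<close>

lemma overfit_event:
  assumes glm: "glm_problem M Y \<mu> b n p q X \<beta>0"
    and J: "J \<in> submodels p q" "J0 \<subset> J" and \<eta>: "0 < \<eta>" "\<eta> \<le> 1" and r: "0 < r"
    and small: "real n * c_change * (r / sqrt (real n * lam)) ^ 3 \<le> 2"
  shows "\<exists>B\<in>sets M. measure M B \<le> (2 * sqrt (card (J - J0)) / \<eta> + 1) ^ card (J - J0) *
       exp (1 - (1 - 2 * \<eta>) * (r\<^sup>2 / 2)) \<and>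
     (\<forall>\<omega>\<in>space M - B. \<forall>w\<in>coord_space J.
       (\<forall>v\<in>coord_space J0. bform {1..p} (hess \<beta>0) v w = 0) \<longrightarrow>
       sc (\<lambda>i. Y i \<omega>) \<beta>0 w - qf \<beta>0 w / 2 \<le> r\<^sup>2 / 2)"
proof -
  interpret prob_space M using glm by (simp add: glm_problem_def)
  note Ym = glm_problem_measurable[OF glm]
  let ?K = "J - J0"
  have adJ: "admissible J" using admissible_union[OF J(1)] J(2) by (simp add: Un_absorb1 less_imp_le)
  note J' = admissibleD[OF adJ]
  have JK: "J0 \<union> ?K = J" using J(2) by auto
  have \<beta>0J: "\<beta>0 \<in> coord_space J" using \<beta>0_coord J' by blast
  have pd: "pos_def_on (J0 \<union> ?K) (hess \<beta>0)" unfolding JK by (rule pos_def_hess[OF adJ \<beta>0J])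
  have fK: "finite ?K" "?K \<noteq> {}" "J0 \<inter> ?K = {}" using J' J(2) by auto
  let ?S = "\<lambda>\<omega>. sc (\<lambda>i. Y i \<omega>) \<beta>0"
  have bfJ: "bform J (hess \<beta>0) u w = bform {1..p} (hess \<beta>0) u w" if "u \<in> coord_space J" "w \<in> coord_space J" for u w
    using bform_superset[of "{1..p}" J u w] J' that by simp
  show ?thesis
  proof (rule complement_net[OF fK(1,2) finite_J0 fK(3) pd \<eta> r, unfolded JK])
    fix G :: "(nat \<Rightarrow> real) set" assume G: "finite G" "G \<subseteq> coord_space J"
      "real (card G) \<le> (2 * sqrt (real (card ?K)) / \<eta> + 1) ^ card ?K"
      "\<And>u. u \<in> G \<Longrightarrow> bform J (hess \<beta>0) u u \<le> r\<^sup>2"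
      "\<And>S w. (\<And>c v. S (\<lambda>j. \<Sum>i\<in>?K. c i * v i j) = (\<Sum>i\<in>?K. c i * (S (v i) :: real))) \<Longrightarrow>
         (\<And>u. u \<in> G \<Longrightarrow> S u < (1 - \<eta>) * r\<^sup>2) \<Longrightarrow> w \<in> coord_space J \<Longrightarrow>
         (\<And>v. v \<in> coord_space J0 \<Longrightarrow> bform J (hess \<beta>0) v w = 0) \<Longrightarrow>
         S w - bform J (hess \<beta>0) w w / 2 \<le> r\<^sup>2 / 2"
    define B where "B = (\<Union>u\<in>G. {\<omega> \<in> space M. (1 - \<eta>) * r\<^sup>2 \<le> ?S \<omega> u})"
    have Bm: "{\<omega> \<in> space M. (1 - \<eta>) * r\<^sup>2 \<le> ?S \<omega> u} \<in> sets M" for u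
      using measurable_score[OF Ym] by measurable
    have tail: "prob {\<omega> \<in> space M. (1 - \<eta>) * r\<^sup>2 \<le> ?S \<omega> u} \<le> exp (1 - (1 - 2 * \<eta>) * (r\<^sup>2 / 2))"
      if u: "u \<in> G" for u
    proof -
      have uJ: "u \<in> coord_space J" using u G(2) by blast
      have N: "0 < real n * lam" using n lam_pos by simp
      have q: "qf \<beta>0 u \<le> r\<^sup>2" using G(4)[OF u] bfJ[OF uJ uJ] by simp
      have "real n * lam * (nrm u)\<^sup>2 \<le> qf \<beta>0 u"
        by (rule qf_lower_lam(1)[OF adJ \<beta>0J _ uJ]) (use \<beta>0 rad_ge a0 in linarith)
      then have "(nrm u)\<^sup>2 \<le> r\<^sup>2 / (real n * lam)" using q N by (simp add: field_simps)
      also have "\<dots> = (r / sqrt (real n * lam))\<^sup>2" using N by (simp add: power_divide)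
      finally have "nrm u \<le> r / sqrt (real n * lam)"
        using r N by (intro power2_le_imp_le[of "nrm u"]) auto
      then have "real n * c_change * nrm u ^ 3 \<le> real n * c_change * (r / sqrt (real n * lam)) ^ 3"
        using c_change by (intro mult_left_mono power_mono) auto
      then have "real n * c_change * nrm u ^ 3 / 2 \<le> 1" using small by simp
      then have "breg \<beta>0 u \<le> r\<^sup>2 / 2 + 1"
        using bregman_quadratic[OF adJ \<beta>0J uJ] q by linarith
      moreover have "(1 - 2 * \<eta>) * (r\<^sup>2 / 2) = (1 - \<eta>) * r\<^sup>2 - r\<^sup>2 / 2"
        by (simp add: left_diff_distrib)
      ultimately have "exp (breg \<beta>0 u - (1 - \<eta>) * r\<^sup>2) \<le> exp (1 - (1 - 2 * \<eta>) * (r\<^sup>2 / 2))"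
        unfolding exp_le_cancel_iff by linarith
      then show ?thesis using score_tail[OF glm, of "(1 - \<eta>) * r\<^sup>2" u] by linarith
    qed
    show ?thesis
    proof (intro bexI[of _ B] conjI ballI impI)
      show "B \<in> sets M" unfolding B_def using G(1) Bm by (intro sets.finite_UN) auto
      have "prob B \<le> (\<Sum>u\<in>G. prob {\<omega> \<in> space M. (1 - \<eta>) * r\<^sup>2 \<le> ?S \<omega> u})"
        unfolding B_def using G(1) Bm by (intro finite_measure_subadditive_finite) auto
      also have "\<dots> \<le> (\<Sum>u\<in>G. exp (1 - (1 - 2 * \<eta>) * (r\<^sup>2 / 2)))" by (intro sum_mono tail)
      also have "\<dots> = real (card G) * exp (1 - (1 - 2 * \<eta>) * (r\<^sup>2 / 2))" by simp
      also have "\<dots> \<le> (2 * sqrt (card ?K) / \<eta> + 1) ^ card ?K * exp (1 - (1 - 2 * \<eta>) * (r\<^sup>2 / 2))"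
        using G(3) by (intro mult_right_mono) auto
      finally show "prob B \<le> \<dots>" .
      fix \<omega> w assume \<omega>: "\<omega> \<in> space M - B" and w: "w \<in> coord_space J"
        "\<forall>v\<in>coord_space J0. bform {1..p} (hess \<beta>0) v w = 0"
      have "?S \<omega> w - bform J (hess \<beta>0) w w / 2 \<le> r\<^sup>2 / 2"
      proof (rule G(5)[OF score_sum _ w(1)])
        show "?S \<omega> u < (1 - \<eta>) * r\<^sup>2" if "u \<in> G" for u
          using \<omega> that by (auto simp: B_def not_le)
        show "bform J (hess \<beta>0) v w = 0" if v: "v \<in> coord_space J0" for v
        proof -
          have "v \<in> coord_space J" using v coord_space_mono[of J0 J] J' by auto
          then show ?thesis using bfJ w v by simp
        qed
      qed
      then show "?S \<omega> w - qf \<beta>0 w / 2 \<le> r\<^sup>2 / 2" using bfJ[OF w(1) w(1)] by simp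
    qed
  qed
qed

text \<open>With the true support fixed, a larger model is determined by its additional covariates,
  so at most \<open>p choose k\<close> models have \<open>k\<close> of them.\<close>

lemma sum_over_overfitting_models:
  assumes "\<And>k. 0 \<le> (h k :: real)"
  shows "(\<Sum>J\<in>{J \<in> submodels p q. J0 \<subset> J}. h (card (J - J0))) \<le> (\<Sum>k\<in>{1..q}. real (p choose k) * h k)"
proof -
  let ?T = "{J \<in> submodels p q. J0 \<subset> J}"
  let ?U = "{K. K \<subseteq> {1..p} \<and> card K \<in> {1..q}}"
  have finU: "finite ?U" by (rule finite_subset[of _ "Pow {1..p}"]) auto
  have inj: "inj_on (\<lambda>J. J - J0) ?T" by (rule inj_onI) auto
  have sub: "(\<lambda>J. J - J0) ` ?T \<subseteq> ?U"
  proof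
    fix K assume "K \<in> (\<lambda>J. J - J0) ` ?T"
    then obtain J where J: "J \<in> submodels p q" "J0 \<subset> J" "K = J - J0" by auto
    have fJ: "finite J" "J \<subseteq> {1..p}" "card J \<le> q" using submodelsD[OF J(1)] by auto
    have "card K \<noteq> 0" using J fJ by (simp add: card_eq_0_iff)
    moreover have "card K \<le> card J" using J fJ by (intro card_mono) auto
    ultimately have "card K \<in> {1..q}" using fJ by simp
    then show "K \<in> ?U" using J fJ by auto
  qed
  have "(\<Sum>J\<in>?T. h (card (J - J0))) = (\<Sum>K\<in>(\<lambda>J. J - J0) ` ?T. h (card K))"
    by (simp add: sum.reindex[OF inj])
  also have "\<dots> \<le> (\<Sum>K\<in>?U. h (card K))" using assms by (intro sum_mono2[OF finU sub]) auto
  also have "\<dots> = (\<Sum>k\<in>{1..q}. \<Sum>K\<in>{K \<in> ?U. card K = k}. h (card K))"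
    by (rule sum.group[symmetric]) (use finU in auto)
  also have "\<dots> = (\<Sum>k\<in>{1..q}. real (p choose k) * h k)"
  proof (rule sum.cong[OF refl])
    fix k assume k: "k \<in> {1..q}"
    have "{K \<in> ?U. card K = k} = {K. K \<subseteq> {1..p} \<and> card K = k}" using k by auto
    then have "card {K \<in> ?U. card K = k} = p choose k" using n_subsets[of "{1..p}" k] by simp
    then show "(\<Sum>K\<in>{K \<in> ?U. card K = k}. h (card K)) = real (p choose k) * h k" by simp
  qed
  finally show ?thesis .
qed

text \<open>The exceptional set is built from finitely many tail events, because the good event
  itself quantifies over uncountably many directions.\<close>

lemma bad_event:
  fixes c \<eta> \<tau> :: real
  assumes glm: "glm_problem M Y \<mu> b n p q X \<beta>0"
    and \<tau>: "0 \<le> \<tau>" "\<tau> \<le> real n * Lam" and \<eta>: "0 < \<eta>" "\<eta> \<le> 1 / 2" and p: "1 \<le> p" and c: "0 < c"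
    and small: "real n * c_change * (sqrt (2 * c * q) / sqrt (real n * lam)) ^ 3 \<le> 2"
    and z: "3 * exp 1 / \<eta> * real p * exp (- ((1 - 2 * \<eta>) * c)) \<le> 1 / 2"
  shows "\<exists>B\<in>sets M. measure M B \<le> 2 * real p * exp (- (\<tau>\<^sup>2 / (2 * (real n * Lam)))) +
      2 * exp 1 * (3 * exp 1 / \<eta> * real p * exp (- ((1 - 2 * \<eta>) * c))) \<and>
     (\<forall>\<omega>\<in>space M - B. score_bounded (\<lambda>i. Y i \<omega>) (sqrt (2 * q) * \<tau>) \<and> overfit_bounded (\<lambda>i. Y i \<omega>) c)"
proof -
  interpret prob_space M using glm by (simp add: glm_problem_def)
  note Ym = glm_problem_measurable[OF glm]
  let ?S = "\<lambda>\<omega>. sc (\<lambda>i. Y i \<omega>) \<beta>0"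
  define B1 where "B1 = (\<Union>j\<in>{1..p}. {\<omega> \<in> space M. \<tau> \<le> \<bar>?S \<omega> (evec j)\<bar>})"
  have B1m: "{\<omega> \<in> space M. \<tau> \<le> \<bar>?S \<omega> (evec j)\<bar>} \<in> sets M" for j
    using measurable_score[OF Ym] by measurable
  have B1s: "B1 \<in> sets M" unfolding B1_def using B1m by (intro sets.finite_UN) auto
  have "prob B1 \<le> (\<Sum>j\<in>{1..p}. prob {\<omega> \<in> space M. \<tau> \<le> \<bar>?S \<omega> (evec j)\<bar>})"
    unfolding B1_def using B1m by (intro finite_measure_subadditive_finite) auto
  also have "\<dots> \<le> (\<Sum>j\<in>{1..p}. 2 * exp (- (\<tau>\<^sup>2 / (2 * (real n * Lam)))))"
    by (intro sum_mono score_unit_tail[OF glm _ \<tau>])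
  finally have P1: "prob B1 \<le> 2 * real p * exp (- (\<tau>\<^sup>2 / (2 * (real n * Lam))))" by simp
  have G1: "score_bounded (\<lambda>i. Y i \<omega>) (sqrt (2 * q) * \<tau>)" if "\<omega> \<in> space M - B1" for \<omega>
    using that \<tau>(1) by (intro score_bounded_coordinatewise) (force simp: B1_def)+
  let ?T = "{J \<in> submodels p q. J0 \<subset> J}"
  have finT: "finite ?T" by (rule finite_subset[of _ "Pow {1..p}"]) (auto simp: submodels_def)
  define a where "a = (1 - 2 * \<eta>) * c"
  define h where "h k = (2 * sqrt (real k) / \<eta> + 1) ^ k * exp (1 - a * k)" for k :: nat
  have ex: "\<exists>B. B \<in> sets M \<and> prob B \<le> h (card (J - J0)) \<and> (\<forall>\<omega>\<in>space M - B. \<forall>w\<in>coord_space J.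
       (\<forall>v\<in>coord_space J0. bform {1..p} (hess \<beta>0) v w = 0) \<longrightarrow>
       ?S \<omega> w - qf \<beta>0 w / 2 \<le> c * card (J - J0))" if J: "J \<in> ?T" for J
  proof -
    let ?k = "card (J - J0)"
    have J': "J \<in> submodels p q" "J0 \<subset> J" using J by auto
    have fJ: "finite J" using submodelsD[OF J'(1)] by simp
    have k0: "0 < ?k" using J' fJ by (simp add: card_gt_0_iff)
    have "?k \<le> card J" using fJ by (intro card_mono) auto
    then have kq: "?k \<le> q" using submodelsD[OF J'(1)] by simp
    \<comment> \<open>Half of \<open>r\<^sup>2\<close> then allots the level \<open>c\<close> to
      each additional covariate.\<close>
    define r where "r = sqrt (2 * c * ?k)"
    have r: "0 < r" using k0 c by (simp add: r_def)
    have r2: "r\<^sup>2 / 2 = c * ?k" using c by (simp add: r_def)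
    have "r \<le> sqrt (2 * c * q)" using kq c by (simp add: r_def)
    then have "real n * c_change * (r / sqrt (real n * lam)) ^ 3 \<le>
        real n * c_change * (sqrt (2 * c * q) / sqrt (real n * lam)) ^ 3"
      using r c_change lam_pos by (intro mult_left_mono power_mono divide_right_mono) auto
    then have sm: "real n * c_change * (r / sqrt (real n * lam)) ^ 3 \<le> 2" using small by linarith
    have \<eta>1: "\<eta> \<le> 1" using \<eta> by simp
    show ?thesis
      using overfit_event[OF glm J' \<eta>(1) \<eta>1 r sm] unfolding r2 h_def a_def
      by (auto simp: mult.assoc)
  qed
  then have "\<forall>J\<in>?T. \<exists>B. B \<in> sets M \<and> prob B \<le> h (card (J - J0)) \<and> (\<forall>\<omega>\<in>space M - B. \<forall>w\<in>coord_space J.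
       (\<forall>v\<in>coord_space J0. bform {1..p} (hess \<beta>0) v w = 0) \<longrightarrow>
       ?S \<omega> w - qf \<beta>0 w / 2 \<le> c * card (J - J0))" by blast
  from bchoice[OF this] obtain BB where BB: "\<forall>J\<in>?T. BB J \<in> sets M \<and> prob (BB J) \<le> h (card (J - J0)) \<and>
      (\<forall>\<omega>\<in>space M - BB J. \<forall>w\<in>coord_space J.
       (\<forall>v\<in>coord_space J0. bform {1..p} (hess \<beta>0) v w = 0) \<longrightarrow>
       ?S \<omega> w - qf \<beta>0 w / 2 \<le> c * card (J - J0))" ..
  define B2 where "B2 = (\<Union>J\<in>?T. BB J)"
  have B2s: "B2 \<in> sets M" unfolding B2_def using finT BB by (intro sets.finite_UN) auto
  let ?z = "3 * exp 1 / \<eta> * real p * exp (- a)"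
  have z0: "0 \<le> ?z" using \<eta> by simp
  have z1: "?z \<le> 1 / 2" using z by (simp add: a_def)
  have "prob B2 \<le> (\<Sum>J\<in>?T. prob (BB J))"
    unfolding B2_def using finT BB by (intro finite_measure_subadditive_finite) auto
  also have "\<dots> \<le> (\<Sum>J\<in>?T. h (card (J - J0)))" using BB by (intro sum_mono) auto
  also have "\<dots> \<le> (\<Sum>k\<in>{1..q}. real (p choose k) * h k)"
    using \<eta> by (intro sum_over_overfitting_models) (auto simp: h_def)
  also have "\<dots> \<le> (\<Sum>k\<in>{1..q}. exp 1 * ?z ^ k)"
  proof (intro sum_mono)
    fix k assume k: "k \<in> {1..q}"
    have "real (p choose k) * h k = exp 1 * (real (p choose k) * ((2 * sqrt (real k) / \<eta> + 1) ^ k * exp (- a * k)))"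
      by (simp add: h_def exp_diff exp_minus divide_inverse)
    also have "\<dots> \<le> exp 1 * ?z ^ k"
      using \<eta> p k by (intro mult_left_mono net_union_bound) auto
    finally show "real (p choose k) * h k \<le> exp 1 * ?z ^ k" .
  qed
  also have "\<dots> = exp 1 * (\<Sum>k\<in>{1..q}. ?z ^ k)" by (simp add: sum_distrib_left)
  \<comment> \<open>With ratio at most 1/2 the geometric sum is at most twice its first term, so
    \<open>?z\<close> alone governs the probability.\<close>
  also have "(\<Sum>k\<in>{1..q}. ?z ^ k) \<le> (\<Sum>k\<in>{1..q}. ?z * (1 / 2) ^ (k - 1))"
  proof (intro sum_mono)
    fix k assume "k \<in> {1..q}"
    then have "?z ^ k = ?z * ?z ^ (k - 1)" by (cases k) auto
    also have "\<dots> \<le> ?z * (1 / 2) ^ (k - 1)" using z0 z1 by (intro mult_left_mono power_mono) auto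
    finally show "?z ^ k \<le> \<dots>" .
  qed
  also have "(\<Sum>k\<in>{1..q}. ?z * (1 / 2) ^ (k - 1)) = ?z * (\<Sum>k<q. (1 / 2) ^ k)"
    unfolding sum_distrib_left[symmetric]
    by (rule arg_cong[where f = "(*) ?z"], rule sum.reindex_bij_witness[of _ Suc "\<lambda>k. k - 1"]) auto
  also have "\<dots> \<le> ?z * 2"
    using z0 by (intro mult_left_mono) (simp_all add: sum_gp_strict)
  finally have P2: "prob B2 \<le> 2 * exp 1 * ?z" by (simp add: mult_ac)
  have G2: "overfit_bounded (\<lambda>i. Y i \<omega>) c" if "\<omega> \<in> space M - B2" for \<omega>
    unfolding overfit_bounded_def
  proof (intro ballI impI)
    fix J w assume J: "J \<in> submodels p q" "J0 \<subset> J" and w: "w \<in> coord_space J"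
      "\<forall>v\<in>coord_space J0. bform {1..p} (hess \<beta>0) v w = 0"
    have JT: "J \<in> ?T" using J by simp
    then have "\<omega> \<in> space M - BB J" using that by (auto simp: B2_def)
    then show "?S \<omega> w - qf \<beta>0 w / 2 \<le> c * card (J - J0)"
      using bspec[OF BB JT] w by simp
  qed
  show ?thesis
  proof (intro bexI[of _ "B1 \<union> B2"] conjI ballI)
    have "prob (B1 \<union> B2) \<le> prob B1 + prob B2" by (rule measure_Un_le[OF B1s B2s])
    then show "prob (B1 \<union> B2) \<le> 2 * real p * exp (- (\<tau>\<^sup>2 / (2 * (real n * Lam)))) +
      2 * exp 1 * (3 * exp 1 / \<eta> * real p * exp (- ((1 - 2 * \<eta>) * c)))"
      using P1 P2 by (simp add: a_def)
  qed (use G1 G2 B1s B2s in auto)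
qed

end

section \<open>The bound on the estimators exceeds the bound on the parameters\<close>

lemma std_normal_mgf:
  "(\<integral>\<^sup>+ y. ennreal (exp (y * \<theta>)) \<partial>density lborel std_normal_density) = ennreal (exp (\<theta>\<^sup>2 / 2))"
proof -
  have "(\<integral>\<^sup>+ y. ennreal (exp (y * \<theta>)) \<partial>density lborel std_normal_density) =
      (\<integral>\<^sup>+ y. ennreal (std_normal_density y) * ennreal (exp (y * \<theta>)) \<partial>lborel)"
    by (subst nn_integral_density) auto
  also have "\<dots> = (\<integral>\<^sup>+ y. ennreal (exp (\<theta>\<^sup>2 / 2)) * ennreal (normal_density \<theta> 1 y) \<partial>lborel)"
  proof (intro nn_integral_cong)
    fix y :: real
    have "- y\<^sup>2 / 2 + y * \<theta> = \<theta>\<^sup>2 / 2 + - (y - \<theta>)\<^sup>2 / 2" by (simp add: power2_eq_square field_simps)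
    then have "exp (- y\<^sup>2 / 2) * exp (y * \<theta>) = exp (\<theta>\<^sup>2 / 2) * exp (- (y - \<theta>)\<^sup>2 / 2)"
      by (simp only: exp_add[symmetric])
    then have "std_normal_density y * exp (y * \<theta>) = exp (\<theta>\<^sup>2 / 2) * normal_density \<theta> 1 y"
      by (simp add: normal_density_def)
    then show "ennreal (std_normal_density y) * ennreal (exp (y * \<theta>)) =
        ennreal (exp (\<theta>\<^sup>2 / 2)) * ennreal (normal_density \<theta> 1 y)"
      by (simp add: ennreal_mult[symmetric])
  qed
  also have "\<dots> = ennreal (exp (\<theta>\<^sup>2 / 2)) * (\<integral>\<^sup>+ y. ennreal (normal_density \<theta> 1 y) \<partial>lborel)"
    by (rule nn_integral_cmult) auto
  also have "(\<integral>\<^sup>+ y. ennreal (normal_density \<theta> 1 y) \<partial>lborel) = 1"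
  proof -
    interpret prob_space "density lborel (normal_density \<theta> 1)" by (rule prob_space_normal_density) simp
    show ?thesis using emeasure_space_1 by (simp add: emeasure_density)
  qed
  finally show ?thesis by simp
qed

text \<open>The Gaussian location family with the standard normal law as base measure. Its cumulant
  function has constant second derivative, so the Hessian of such a model does not depend on the
  parameter.\<close>

lemma exp_family_std_normal: "exp_family (density lborel std_normal_density) (\<lambda>\<theta>. \<theta>\<^sup>2 / 2)"
  unfolding exp_family_def using std_normal_mgf by simp

lemma normal_tilt:
  "density (density lborel std_normal_density) (\<lambda>y. ennreal (exp (y * \<theta> - \<theta>\<^sup>2 / 2))) =
    density lborel (\<lambda>y. ennreal (normal_density \<theta> 1 y))"
proof -
  have "ennreal (std_normal_density y) * ennreal (exp (y * \<theta> - \<theta>\<^sup>2 / 2)) = ennreal (normal_density \<theta> 1 y)" for y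
  proof -
    have "- y\<^sup>2 / 2 + (y * \<theta> - \<theta>\<^sup>2 / 2) = - (y - \<theta>)\<^sup>2 / 2" by (simp add: power2_eq_square field_simps)
    then have "exp (- y\<^sup>2 / 2) * exp (y * \<theta> - \<theta>\<^sup>2 / 2) = exp (- (y - \<theta>)\<^sup>2 / 2)"
      by (simp only: exp_add[symmetric])
    then have "std_normal_density y * exp (y * \<theta> - \<theta>\<^sup>2 / 2) = normal_density \<theta> 1 y"
      by (simp add: normal_density_def)
    then show ?thesis by (simp add: ennreal_mult[symmetric])
  qed
  then show ?thesis by (subst density_density_eq) auto
qed

text \<open>Reflection at the mean exchanges the two half-lines, and the mean is not an
  atom.\<close>

lemma normal_le_mean:
  "measure (density lborel (normal_density \<theta> 1)) {..\<theta>} \<le> 1 / 2"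
proof -
  interpret prob_space "density lborel (normal_density \<theta> 1)" by (rule prob_space_normal_density) simp
  let ?N = "density lborel (normal_density \<theta> 1)"
  have "emeasure ?N {..\<theta>} = (\<integral>\<^sup>+y. ennreal (normal_density \<theta> 1 y) * indicator {..\<theta>} y \<partial>lborel)"
    by (subst emeasure_density) auto
  also have "\<dots> = (\<integral>\<^sup>+y. ennreal (normal_density \<theta> 1 (2 * \<theta> + (- 1) * y)) * indicator {..\<theta>} (2 * \<theta> + (- 1) * y) \<partial>lborel)"
    by (subst nn_integral_real_affine[where c = "- 1" and t = "2 * \<theta>"]) auto
  also have "\<dots> = (\<integral>\<^sup>+y. ennreal (normal_density \<theta> 1 y) * indicator {\<theta>..} y \<partial>lborel)"
    by (intro nn_integral_cong)
      (auto simp: normal_density_def power2_commute algebra_simps split: split_indicator)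
  also have "\<dots> = emeasure ?N {\<theta>..}"
    by (subst emeasure_density) auto
  finally have eq: "prob {..\<theta>} = prob {\<theta>..}" by (simp add: measure_def)
  have "emeasure ?N {\<theta>} = 0"
    by (subst emeasure_density) (auto intro!: nn_integral_null_set[THEN trans] simp: null_sets_def)
  then have z: "prob {\<theta>} = 0" by (simp add: measure_def)
  have "prob ({..\<theta>} \<union> {\<theta><..}) = prob {..\<theta>} + prob {\<theta><..}"
    by (rule finite_measure_Union) auto
  moreover have "{..\<theta>} \<union> {\<theta><..} = space ?N" by auto
  ultimately have "1 = prob {..\<theta>} + prob {\<theta><..}" using prob_space by simp
  moreover have "prob {\<theta>..} = prob {\<theta><..} + prob {\<theta>}"
  proof -
    have "{\<theta>..} = {\<theta><..} \<union> {\<theta>}" by auto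
    then show ?thesis by (simp only:) (rule finite_measure_Union, auto)
  qed
  ultimately show ?thesis using eq z by simp
qed

text \<open>If the parameters could reach the bound \<open>a_MLE\<close>, an orthogonal Gaussian design would
  violate the bound: there the first coordinate of the estimator exceeds its mean \<open>a\<^sub>0\<close> with
  probability \<open>1 / 2\<close>, whatever the sample size.\<close>

lemma mle_bound_gt:
  assumes "mle_bound_constants a\<^sub>0 c_lower c_upper c_change \<nu> c_sample a_MLE"
    "0 < a\<^sub>0" "0 < c_change"
    "\<And>t. t \<ge> 0 \<Longrightarrow> c_lower t > 0" "antimono_on {0..} c_lower" "mono_on {0..} c_upper"
    "c_lower 0 \<le> c_upper 0"
  shows "a\<^sub>0 < a_MLE"
proof (rule ccontr)
  assume neg: "\<not> a\<^sub>0 < a_MLE"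
  have nu: "0 < \<nu>" and cs: "0 < c_sample" using assms(1) by (auto simp: mle_bound_constants_def)
  \<comment> \<open>Large enough for a failure probability of at most 1/4: the bound would hold with
    probability at least 3/4, whereas the design below allows only 1/2.\<close>
  define p where "p = nat \<lceil>4 powr (1 / \<nu>)\<rceil>"
  have p4: "4 powr (1 / \<nu>) \<le> real p" unfolding p_def by linarith
  have "1 \<le> 4 powr (1 / \<nu>)" using nu by (intro ge_one_powr_ge_zero) auto
  then have p: "1 \<le> p" using p4 by linarith
  have "real p powr (- \<nu>) \<le> (4 powr (1 / \<nu>)) powr (- \<nu>)"
    using p4 nu by (intro powr_mono2') auto
  also have "\<dots> = 1 / 4" using nu by (simp add: powr_powr powr_minus)
  finally have p_prob: "real p powr (- \<nu>) \<le> 1 / 4" .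
  have "((\<lambda>n. (c_sample * max (ln (real p)) (ln (real n) ^ 3)) / real n) \<longlongrightarrow> 0) sequentially"
  proof -
    have "(\<lambda>n. c_sample * (\<bar>ln (real p)\<bar> + \<bar>ln (real n) ^ 3\<bar>) / real n) \<longlonglongrightarrow> 0" by real_asymp
    moreover have "\<forall>\<^sub>F n in sequentially. norm ((c_sample * max (ln (real p)) (ln (real n) ^ 3)) / real n) \<le>
        c_sample * (\<bar>ln (real p)\<bar> + \<bar>ln (real n) ^ 3\<bar>) / real n"
    proof (rule always_eventually, rule allI)
      fix n
      have "\<bar>max (ln (real p)) (ln (real n) ^ 3)\<bar> \<le> \<bar>ln (real p)\<bar> + \<bar>ln (real n) ^ 3\<bar>" by linarith
      then show "norm ((c_sample * max (ln (real p)) (ln (real n) ^ 3)) / real n) \<le>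
          c_sample * (\<bar>ln (real p)\<bar> + \<bar>ln (real n) ^ 3\<bar>) / real n"
        unfolding real_norm_def abs_divide abs_mult abs_of_nat using cs
        by (intro divide_right_mono mult_mono) auto
    qed
    ultimately show ?thesis by (rule Lim_null_comparison[rotated])
  qed
  then have "\<forall>\<^sub>F n in sequentially. (c_sample * max (ln (real p)) (ln (real n) ^ 3)) / real n < 1"
    by (rule order_tendstoD) simp
  moreover have "\<forall>\<^sub>F n in sequentially. p \<le> n" by (rule eventually_ge_at_top)
  ultimately have "\<forall>\<^sub>F n in sequentially. p \<le> n \<and> (c_sample * max (ln (real p)) (ln (real n) ^ 3)) / real n < 1"
    by eventually_elim simp
  then obtain n where n: "p \<le> n" "(c_sample * max (ln (real p)) (ln (real n) ^ 3)) / real n < 1"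
    using eventually_happens by force
  have n1: "1 \<le> n" using n p by simp
  have size: "c_sample * real 1 ^ 3 * max (ln (real p)) (ln (real n) ^ 3) \<le> real n"
    using n(2) n1 by (simp add: field_simps)
  \<comment> \<open>The Hessian will be \<open>n * s\<close> times the identity. Since
    \<open>c_lower\<close> decreases, \<open>c_upper\<close> increases and
    \<open>c_lower 0 \<le> c_upper 0\<close>, both Loewner bounds hold at every radius; a constant
    Hessian satisfies the Lipschitz bound.\<close>
  define s where "s = c_lower 0"
  have s: "0 < s" using assms(4) by (simp add: s_def)
  define X where "X i j = (if i = j then sqrt (real n * s) else 0)" for i j :: nat
  define \<beta>0 :: "nat \<Rightarrow> real" where "\<beta>0 j = (if j = 1 then a\<^sub>0 else 0)" for j
  define b :: "real \<Rightarrow> real" where "b \<theta> = \<theta>\<^sup>2 / 2" for \<theta>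
  define \<theta> where "\<theta> i = lin_pred p X i \<beta>0" for i
  \<comment> \<open>The sample space has type \<open>nat \<Rightarrow> real\<close>, the type over
    which \<open>mle_bound_constants\<close> quantifies.\<close>
  define M where "M = (\<Pi>\<^sub>M i\<in>{1..n}. density lborel (normal_density (\<theta> i) 1))"
  define Y :: "nat \<Rightarrow> (nat \<Rightarrow> real) \<Rightarrow> real" where "Y i \<omega> = \<omega> i" for i \<omega>
  have lp: "lin_pred p X i u = (if i \<in> {1..p} then sqrt (real n * s) * u i else 0)" for i u
  proof -
    have "lin_pred p X i u = (\<Sum>j\<in>{1..p}. if i = j then sqrt (real n * s) * u j else 0)"
      unfolding lin_pred_def by (intro sum.cong) (auto simp: X_def)
    then show ?thesis by simp
  qed
  have supp: "support \<beta>0 = {1}" using assms(2) by (auto simp: support_def \<beta>0_def)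
  have b2: "deriv (deriv b) x = 1" for x
  proof -
    have "deriv b = (\<lambda>x. x)"
    proof
      fix x
      show "deriv b x = x" unfolding b_def
        by (rule DERIV_imp_deriv) (auto intro!: derivative_eq_intros)
    qed
    then show ?thesis by simp
  qed
  interpret N: prob_space "density lborel (normal_density (\<theta> i) 1)" for i
    by (rule prob_space_normal_density) simp
  interpret PN: product_prob_space "\<lambda>i. density lborel (normal_density (\<theta> i) 1)" "{1..n}" ..
  have prM: "prob_space M" unfolding M_def by (rule PN.prob_space_axioms)
  interpret M: prob_space M by (rule prM)
  have distY: "distr M borel (Y i) = density lborel (normal_density (\<theta> i) 1)" if "i \<in> {1..n}" for i
  proof -
    have "distr M borel (Y i) = distr M (density lborel (normal_density (\<theta> i) 1)) (\<lambda>\<omega>. \<omega> i)"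
      by (intro distr_cong) (auto simp: Y_def)
    also have "\<dots> = density lborel (normal_density (\<theta> i) 1)"
      unfolding M_def using that by (rule PN.PiM_component)
    finally show ?thesis .
  qed
  have Ym: "Y i \<in> borel_measurable M" if "i \<in> {1..n}" for i
  proof -
    have "(\<lambda>\<omega>. \<omega> i) \<in> measurable M (density lborel (normal_density (\<theta> i) 1))"
      unfolding M_def using that by (rule measurable_component_singleton)
    then show ?thesis by (simp add: Y_def[abs_def] cong: measurable_cong_sets)
  qed
  have glm: "glm_problem M Y (density lborel std_normal_density) b n p 1 X \<beta>0"
    unfolding glm_problem_def
  proof (intro conjI ballI)
    show "exp_family (density lborel std_normal_density) b"
      using exp_family_std_normal by (simp add: b_def[abs_def])
    show "\<beta>0 \<in> coord_space {1..p}" using p by (auto simp: coord_space_def \<beta>0_def)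
    show "M.indep_vars (\<lambda>_. borel) Y {1..n}"
    proof (subst M.indep_vars_iff_distr_eq_PiM')
      show "{1..n} \<noteq> {}" using n1 by simp
      show "distr M (\<Pi>\<^sub>M i\<in>{1..n}. borel) (\<lambda>x. \<lambda>i\<in>{1..n}. Y i x) = (\<Pi>\<^sub>M i\<in>{1..n}. distr M borel (Y i))"
      proof -
        have "distr M (\<Pi>\<^sub>M i\<in>{1..n}. borel) (\<lambda>x. \<lambda>i\<in>{1..n}. Y i x) = distr M M (\<lambda>x. x)"
        proof (rule distr_cong)
          show "sets (\<Pi>\<^sub>M i\<in>{1..n}. borel) = sets M" unfolding M_def by (intro sets_PiM_cong) auto
          show "(\<lambda>i\<in>{1..n}. Y i x) = x" if "x \<in> space M" for x
            using that by (auto simp: M_def Y_def space_PiM PiE_def extensional_restrict)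
        qed simp
        also have "\<dots> = M" by simp
        finally have 1: "distr M (\<Pi>\<^sub>M i\<in>{1..n}. borel) (\<lambda>x. \<lambda>i\<in>{1..n}. Y i x) = M" .
        have "(\<Pi>\<^sub>M i\<in>{1..n}. distr M borel (Y i)) = (\<Pi>\<^sub>M i\<in>{1..n}. density lborel (normal_density (\<theta> i) 1))"
          by (intro PiM_cong refl distY)
        then have "(\<Pi>\<^sub>M i\<in>{1..n}. distr M borel (Y i)) = M" by (simp only: M_def)
        then show ?thesis using 1 by simp
      qed
    qed (use Ym in auto)
    fix i assume i: "i \<in> {1..n}"
    show "distributed M (density lborel std_normal_density) (Y i)
        (\<lambda>y. ennreal (exp (y * lin_pred p X i \<beta>0 - b (lin_pred p X i \<beta>0))))"
      unfolding distributed_def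
    proof (intro conjI)
      show "Y i \<in> measurable M (density lborel std_normal_density)"
        using Ym[OF i] by (simp cong: measurable_cong_sets)
      have "distr M (density lborel std_normal_density) (Y i) = distr M borel (Y i)"
        by (intro distr_cong) auto
      then show "distr M (density lborel std_normal_density) (Y i) =
        density (density lborel std_normal_density)
          (\<lambda>y. ennreal (exp (y * lin_pred p X i \<beta>0 - b (lin_pred p X i \<beta>0))))"
        unfolding distY[OF i] b_def normal_tilt \<theta>_def by simp
    qed simp
  qed (use prM supp in auto)
  have nrm0: "L2_set \<beta>0 {1..p} \<le> a\<^sub>0"
  proof -
    have "(\<Sum>j\<in>{1..p}. (\<beta>0 j)\<^sup>2) = (\<Sum>j\<in>{1..p}. if j = 1 then a\<^sub>0\<^sup>2 else 0)"
      by (intro sum.cong) (auto simp: \<beta>0_def)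
    also have "\<dots> \<le> a\<^sub>0\<^sup>2" by simp
    finally have "L2_set \<beta>0 {1..p} \<le> sqrt (a\<^sub>0\<^sup>2)" unfolding L2_set_def by (rule real_sqrt_le_mono)
    then show ?thesis using assms(2) by simp
  qed
  have reg: "hess_regular n p X b c_lower c_upper c_change J" if J: "J \<in> submodels p (2 * 1)" for J
  proof -
    have fJ: "finite J" "J \<subseteq> {1..p}" using J finite_subset[of J "{1..p}"] by (auto simp: submodels_def)
    have H: "neg_hess n p X b \<beta> j k = scalar_matrix (real n * s) j k" if "j \<in> J" "k \<in> J" for \<beta> j k
    proof -
      have "neg_hess n p X b \<beta> j k = (\<Sum>i\<in>{1..n}. if i = j then (if j = k then real n * s else 0) else 0)"
        unfolding neg_hess_def b2 using s by (intro sum.cong) (auto simp: X_def)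
      then show ?thesis using that fJ n(1) by (auto simp: scalar_matrix_def)
    qed
    have bf: "bform J (\<lambda>j k. 1 / real n * neg_hess n p X b \<beta> j k) v v = s * (L2_set v J)\<^sup>2" for \<beta> v
    proof -
      have "bform J (neg_hess n p X b \<beta>) v v = bform J (scalar_matrix (real n * s)) v v"
        unfolding bform_def using H by (intro sum.cong refl) simp
      then show ?thesis unfolding bform_scaled_matrix bform_scalar_matrix[OF fJ(1)] using n1 by simp
    qed
    show ?thesis
      unfolding hess_regular_def loewner_le_bform bf bform_scalar_matrix[OF fJ(1)]
    proof (intro ballI conjI)
      fix \<beta> \<beta>' assume "\<beta> \<in> coord_space J" "\<beta>' \<in> coord_space J"
      have "c_lower (L2_set \<beta> J) \<le> s" using assms(5) by (auto simp: monotone_on_def s_def)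
      then show "c_lower (L2_set \<beta> J) * (L2_set v J)\<^sup>2 \<le> s * (L2_set v J)\<^sup>2" for v
        by (intro mult_right_mono) auto
      have "s \<le> c_upper (L2_set \<beta> J)"
      proof -
        have "c_upper 0 \<le> c_upper (L2_set \<beta> J)" using assms(6) by (auto simp: monotone_on_def)
        then show ?thesis using assms(7) by (simp add: s_def)
      qed
      then show "s * (L2_set v J)\<^sup>2 \<le> c_upper (L2_set \<beta> J) * (L2_set v J)\<^sup>2" for v
        by (intro mult_right_mono) auto
      have "spectral_norm J (\<lambda>j k. neg_hess n p X b \<beta> j k - neg_hess n p X b \<beta>' j k) = 0"
      proof -
        have "L2_set (\<lambda>j. \<Sum>k\<in>J. (neg_hess n p X b \<beta> j k - neg_hess n p X b \<beta>' j k) * v k) J = 0" for v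
          unfolding L2_set_def using H by (simp add: sum.neutral)
        moreover have "{v \<in> coord_space J. L2_set v J \<le> 1} \<noteq> {}"
          using coord_space_zero[of J] by (auto simp: L2_set_def intro!: exI[of _ "\<lambda>_. 0"])
        ultimately show ?thesis unfolding spectral_norm_def by simp
      qed
      then show "1 / real n * spectral_norm J (\<lambda>j k. neg_hess n p X b \<beta> j k - neg_hess n p X b \<beta>' j k)
          \<le> c_change * L2_set (\<lambda>j. \<beta> j - \<beta>' j) J"
        using assms(3) by simp
    qed
  qed
  define E where "E = {\<omega> \<in> space M. \<forall>J \<in> submodels p 1.
              mle_exists n p X b (\<lambda>i. Y i \<omega>) J \<and>
              L2_set (mle n p X b (\<lambda>i. Y i \<omega>) J) J \<le> a_MLE}"
  have "1 - real p powr (- \<nu>) \<le> measure M E"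
    using assms(1) n1 p glm nrm0 reg size unfolding mle_bound_constants_def E_def by blast
  then have E: "3 / 4 \<le> measure M E" using p_prob by simp
  have "E \<subseteq> {\<omega> \<in> space M. Y 1 \<omega> \<le> \<theta> 1}"
  proof
    fix \<omega> assume \<omega>: "\<omega> \<in> E"
    let ?y = "\<lambda>i. Y i \<omega>"
    have J: "{1} \<in> submodels p 1" using p by (simp add: submodels_def)
    then have ex: "mle_exists n p X b ?y {1}" and le: "L2_set (mle n p X b ?y {1}) {1} \<le> a_MLE"
      using \<omega> by (auto simp: E_def)
    define \<beta> where "\<beta> = mle n p X b ?y {1}"
    have "is_mle n p X b ?y {1} \<beta>"
      using ex unfolding mle_exists_def mle_def \<beta>_def by (rule theI'[of "is_mle n p X b ?y {1}"])
    then have \<beta>: "\<beta> \<in> coord_space {1}" "\<And>\<beta>'. \<beta>' \<in> coord_space {1} \<Longrightarrow> log_lik n p X b ?y \<beta>' \<le> log_lik n p X b ?y \<beta>"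
      by (auto simp: is_mle_log_lik)
    let ?r = "sqrt (real n * s)"
    have r: "0 < ?r" using n1 s by simp
    have ll: "log_lik n p X b ?y u = ?y 1 * (?r * u 1) - (?r * u 1)\<^sup>2 / 2" if "u \<in> coord_space {1}" for u
    proof -
      have "log_lik n p X b ?y u = (\<Sum>i\<in>{1..n}. if i = 1 then ?y 1 * (?r * u 1) - (?r * u 1)\<^sup>2 / 2 else 0)"
        unfolding log_lik_def lp b_def using that p
        by (intro sum.cong) (auto simp: coord_space_def)
      then show ?thesis using n1 by simp
    qed
    \<comment> \<open>The least squares solution in the first coordinate; since
      \<open>\<beta>\<close> is at least as good, the two must agree there.\<close>
    define u :: "nat \<Rightarrow> real" where "u = (\<lambda>j. if j = 1 then ?y 1 / ?r else 0)"
    have u: "u \<in> coord_space {1}" by (simp add: coord_space_def u_def)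
    have "?r * u 1 = ?y 1" using n1 s by (simp add: u_def)
    then have "?y 1 * ?y 1 - (?y 1)\<^sup>2 / 2 \<le> ?y 1 * (?r * \<beta> 1) - (?r * \<beta> 1)\<^sup>2 / 2"
      using \<beta>(2)[OF u] unfolding ll[OF u] ll[OF \<beta>(1)] by simp
    then have "(?y 1 - ?r * \<beta> 1)\<^sup>2 \<le> 0" unfolding power2_diff by (simp add: power2_eq_square)
    then have "?y 1 = ?r * \<beta> 1" by simp
    also have "\<dots> \<le> ?r * a\<^sub>0"
    proof (intro mult_left_mono)
      have "\<beta> 1 \<le> L2_set \<beta> {1}" by (simp add: L2_set_def)
      then show "\<beta> 1 \<le> a\<^sub>0" using le neg by (simp add: \<beta>_def)
    qed (use r in simp)
    also have "\<dots> = \<theta> 1" using p by (simp add: \<theta>_def lp \<beta>0_def)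
    finally show "\<omega> \<in> {\<omega> \<in> space M. Y 1 \<omega> \<le> \<theta> 1}" using \<omega> by (simp add: E_def)
  qed
  then have "measure M E \<le> measure M {\<omega> \<in> space M. Y 1 \<omega> \<le> \<theta> 1}"
    using Ym[of 1] n1 by (intro M.finite_measure_mono) auto
  also have "\<dots> = measure (distr M borel (Y 1)) {..\<theta> 1}"
    using Ym[of 1] n1 by (subst measure_distr) (auto intro!: arg_cong[where f = "measure M"])
  also have "\<dots> \<le> 1 / 2" using distY[of 1] n1 normal_le_mean[of "\<theta> 1"] by simp
  finally show False using E by simp
qed

section \<open>Asymptotics\<close>

context regular_glm
begin

text \<open>On the good event the claim reduces to inequalities between numbers that do not depend
  on \<open>J\<close>. \<open>D\<close> is the margin per additional covariate; being nonnegative it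
  grows with their number, so the case of a single one decides.\<close>

lemma selects_truthI:
  fixes \<sigma> c s \<gamma> F3 F4 a_MLE :: real
  assumes sb: "score_bounded y \<sigma>" and ob: "overfit_bounded y c" and \<sigma>: "0 \<le> \<sigma>"
    and small: "4 * \<sigma> \<le> real n * c_lower (a\<^sub>0 + 1)" "4 * \<sigma> \<le> real n * lam * s"
      "a\<^sub>0 + 2 * \<sigma> / (real n * lam) \<le> a_MLE"
    and s: "0 \<le> s" "\<And>j. j \<in> J0 \<Longrightarrow> s \<le> \<bar>\<beta>0 j\<bar>"
    and pq: "q < p" and \<gamma>: "0 \<le> \<gamma>" and N: "2 * pi \<le> real n * lam"
    and F: "0 < F3" "0 < F4"
      "\<And>J \<beta>. J \<in> submodels p q \<Longrightarrow> \<beta> \<in> coord_space J \<Longrightarrow> f J \<beta> \<le> F3"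
      "\<And>J \<beta>. J \<in> submodels p q \<Longrightarrow> \<beta> \<in> coord_space J \<Longrightarrow> L2_set \<beta> J \<le> a_MLE \<Longrightarrow> F4 \<le> f J \<beta>"
    and missing: "ln F3 + \<gamma> * q * ln p + q / 2 * ln (real n * Lam + 1) < ln F4 + real n * lam * s\<^sup>2 / 4"
  defines "\<delta> \<equiv> 2 * \<sigma> / (real n * lam)"
  defines "D \<equiv> ln (real n * lam / (2 * pi)) / 2 + \<gamma> * ln ((real p - real q) / real q) - c"
  assumes overfit: "0 \<le> D"
    "real n * c_change * \<delta> ^ 3 + ln F3 - ln F4 + q / 2 * ln (1 + 2 * c_change * \<delta> / lam) < D"
  shows "selects_truth \<gamma> n p q X b f \<beta>0 y"
  unfolding selects_truth_def argmax_singleton_iff[OF J0_submodel]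
proof (intro conjI ballI)
  show "mle_exists n p X b y J" if "J \<in> submodels p q" for J
    by (rule mle_near(1)[OF sb small(1) that])
  note m0 = mle_near[OF sb small(1) J0_submodel]
  have f0: "F4 \<le> f J0 (mle n p X b y J0)"
  proof (rule F(4)[OF J0_submodel m0(3)])
    have "nrm (mle n p X b y J0) \<le> nrm (\<lambda>j. mle n p X b y J0 j - \<beta>0 j) + nrm \<beta>0"
      using nrm_add[of "\<lambda>j. mle n p X b y J0 j - \<beta>0 j" \<beta>0] by simp
    also have "\<dots> \<le> a_MLE"
      using mle_close[OF sb small(1) J0_submodel _ \<sigma>] \<beta>0(3) small(3) by simp
    finally show "L2_set (mle n p X b y J0) J0 \<le> a_MLE"
      using L2_set_coord_space[OF m0(3), of "{1..p}"] J0_subset by simp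
  qed
  fix J assume J: "J \<in> submodels p q - {J0}"
  then have Js: "J \<in> submodels p q" by simp
  note m = mle_near[OF sb small(1) Js]
  have fJ: "f J (mle n p X b y J) \<le> F3" by (rule F(3)[OF Js m(3)])
  show "Laplace_gen \<gamma> n p X b f y J < Laplace_gen \<gamma> n p X b f y J0"
  proof (cases "J0 \<subseteq> J")
    case False
    have "1 \<le> p" using pq by linarith
    then show ?thesis
      using Laplace_gen_missing_signal[where f = f, OF sb small(1) Js False s small(2) _ \<gamma> N F(1) fJ F(2) f0 missing]
      by blast
  next
    case True
    then have JJ: "J0 \<subset> J" using J by auto
    define k where "k = card (J - J0)"
    have "k \<noteq> 0" using submodelsD[OF Js] JJ by (auto simp: k_def)
    then have k: "1 \<le> real k" by simp
    have chi: "sc y \<beta>0 w - qf \<beta>0 w / 2 \<le> c * real k"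
      if "w \<in> coord_space J" "\<And>v. v \<in> coord_space J0 \<Longrightarrow> bform {1..p} (hess \<beta>0) v w = 0" for w
      using ob Js JJ that unfolding overfit_bounded_def k_def by blast
    show ?thesis
    proof (rule Laplace_gen_overfit[where f = f, OF sb small(1) Js True \<sigma> chi pq \<gamma> F(1) fJ F(2) f0])
      have "real n * c_change * \<delta> ^ 3 + ln F3 - ln F4 + q / 2 * ln (1 + 2 * c_change * \<delta> / lam) < real k * D"
        using overfit mult_right_mono[OF k overfit(1)] by linarith
      then show "c * real k + real n * c_change * (2 * \<sigma> / (real n * lam)) ^ 3 + ln F3 +
          q / 2 * ln (1 + 2 * c_change * (2 * \<sigma> / (real n * lam)) / lam)
        < ln F4 + card (J - J0) / 2 * ln (real n * lam / (2 * pi)) +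
          \<gamma> * card (J - J0) * ln ((real p - real q) / real q)"
        unfolding \<delta>_def[symmetric] k_def[symmetric] by (simp add: D_def algebra_simps)
    qed
  qed
qed

text \<open>The two Loewner bounds can be compared along a nonzero direction, which a nonempty
  support provides.\<close>

lemma c_lower_le_c_upper: "J0 \<noteq> {} \<Longrightarrow> c_lower 0 \<le> c_upper 0"
proof -
  assume "J0 \<noteq> {}"
  then obtain j where j: "j \<in> J0" by blast
  have ad0: "admissible J0" using admissible_union[OF J0_submodel] by simp
  have e: "evec j \<in> coord_space J0" using j by (auto simp: coord_space_def)
  have "0 < nrm (evec j)"
  proof -
    have "(\<Sum>i\<in>{1..p}. (evec j i)\<^sup>2) = (\<Sum>i\<in>{1..p}. if i = j then 1 else 0)" by (intro sum.cong) auto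
    then show ?thesis using j J0_subset by (auto simp: L2_set_def)
  qed
  moreover have "nrm (\<lambda>_. 0) = 0" by (simp add: L2_set_def)
  ultimately show ?thesis
    using order_trans[OF qf_bounds(1)[OF ad0 coord_space_zero e] qf_bounds(2)[OF ad0 coord_space_zero e]] n
    by simp
qed

end

lemma rounding_of_bounds:
  assumes "rounding_of k x" "1 \<le> x"
  shows "x / 2 \<le> real k" "real k \<le> 2 * x" "1 \<le> k"
proof -
  have "real_of_int (int k) = real_of_int \<lfloor>x\<rfloor> \<or> real_of_int (int k) = real_of_int \<lceil>x\<rceil>"
    using assms(1) by (auto simp: rounding_of_def)
  moreover have "1 \<le> \<lfloor>x\<rfloor>" using assms(2) by simp
  moreover have "\<lfloor>x\<rfloor> \<le> \<lceil>x\<rceil>" by (rule floor_le_ceiling)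
  ultimately have "x - 1 \<le> real k \<and> real k \<le> x + 1 \<and> 1 \<le> real k" by linarith
  then show "x / 2 \<le> real k" "real k \<le> 2 * x" "1 \<le> k" using assms(2) by auto
qed

text \<open>The exponent \<open>a\<close> is shared out evenly among the \<open>m\<close> factors,
  which reduces the claim to a single logarithm.\<close>

lemma powr_times_log_tendsto_0:
  fixes a c d :: real
  assumes "a < 0" "0 < m"
  shows "(\<lambda>n. real n powr a * (c * ln (real n) + d) ^ m) \<longlonglongrightarrow> 0"
proof -
  define e where "e = a / real m"
  have e: "e < 0" using assms by (simp add: e_def divide_neg_pos)
  have "(\<lambda>n. real n powr e * ln (real n)) \<longlonglongrightarrow> 0" "(\<lambda>n. real n powr e) \<longlonglongrightarrow> 0"
    using e by real_asymp+
  then have "(\<lambda>n. c * (real n powr e * ln (real n)) + d * real n powr e) \<longlonglongrightarrow> c * 0 + d * 0"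
    by (intro tendsto_add tendsto_mult_left)
  then have "(\<lambda>n. (c * (real n powr e * ln (real n)) + d * real n powr e) ^ m) \<longlonglongrightarrow> (c * 0 + d * 0) ^ m"
    by (rule tendsto_power)
  moreover have "(c * (real n powr e * ln (real n)) + d * real n powr e) ^ m = real n powr a * (c * ln (real n) + d) ^ m"
    for n :: nat
  proof -
    have "(real n powr e) ^ m = real n powr a"
    proof (cases "n = 0")
      case False
      then have "(real n powr e) ^ m = (real n powr e) powr real m" by (simp add: powr_realpow)
      then show ?thesis using assms by (simp add: powr_powr e_def)
    qed (use assms in simp)
    moreover have "c * (real n powr e * ln (real n)) + d * real n powr e = real n powr e * (c * ln (real n) + d)"
      by (simp add: algebra_simps)
    ultimately show ?thesis by (simp add: power_mult_distrib)
  qed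
  ultimately show ?thesis using assms by (simp add: zero_power)
qed

text \<open>The rates in the main proof contain square roots of products; squared, they become
  products of powers and logarithms.\<close>

lemma tendsto_0_of_square_le:
  fixes x y :: "nat \<Rightarrow> real"
  assumes "y \<longlonglongrightarrow> 0" "\<And>n. 1 \<le> n \<Longrightarrow> (x n)\<^sup>2 \<le> y n"
  shows "x \<longlonglongrightarrow> 0"
proof (rule Lim_null_comparison)
  show "\<forall>\<^sub>F n in sequentially. norm (x n) \<le> sqrt (y n)"
    using eventually_ge_at_top[of 1]
  proof eventually_elim
    case (elim n)
    have "norm (x n) = sqrt ((x n)\<^sup>2)" by simp
    also have "\<dots> \<le> sqrt (y n)" by (rule real_sqrt_le_mono) (rule assms(2)[OF elim])
    finally show ?case .
  qed
  show "(\<lambda>n. sqrt (y n)) \<longlonglongrightarrow> 0" using tendsto_real_sqrt[OF assms(1)] by simp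
qed

theorem theorem2:
  fixes M :: "nat \<Rightarrow> 'w measure"
    and Y :: "nat \<Rightarrow> nat \<Rightarrow> 'w \<Rightarrow> real"
    and \<mu> :: "nat \<Rightarrow> real measure"
    and b :: "nat \<Rightarrow> real \<Rightarrow> real"
    and p q :: "nat \<Rightarrow> nat"
    and X :: "nat \<Rightarrow> nat \<Rightarrow> nat \<Rightarrow> real"
    and \<beta>0 :: "nat \<Rightarrow> nat \<Rightarrow> real"
    and f :: "nat \<Rightarrow> nat set \<Rightarrow> (nat \<Rightarrow> real) \<Rightarrow> real"
    and c_lower c_upper :: "real \<Rightarrow> real"
    and \<kappa> \<psi> \<phi> \<gamma> a\<^sub>0 c_change \<nu> c_sample a_MLE F\<^sub>3 F\<^sub>4 :: real
  assumes problem: "\<And>n. n \<ge> 1 \<Longrightarrow>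
      glm_problem (M n) (Y n) (\<mu> n) (b n) n (p n) (q n) (X n) (\<beta>0 n)"
    and exponents: "0 < \<kappa>" "0 \<le> \<psi>" "\<psi> < 1 / 3" "0 \<le> \<phi>" "\<phi> < 1 - \<psi>" "\<psi> < \<kappa>"
    and p_n: "\<And>n. n \<ge> 1 \<Longrightarrow> rounding_of (p n) (real n powr \<kappa>)"
    and q_n: "\<And>n. n \<ge> 1 \<Longrightarrow> rounding_of (q n) (real n powr \<psi>)"
    and support_nonempty: "\<And>n. n \<ge> 1 \<Longrightarrow> support (\<beta>0 n) \<noteq> {}"
    and beta_min: "\<And>n. n \<ge> 1 \<Longrightarrow> signal_strength (\<beta>0 n) = real n powr (- \<phi> / 2)"
    and a0_pos: "0 < a\<^sub>0"
    and c_lower: "\<And>t. t \<ge> 0 \<Longrightarrow> c_lower t > 0" "antimono_on {0..} c_lower"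
    and c_upper: "\<And>t. t \<ge> 0 \<Longrightarrow> c_upper t > 0" "mono_on {0..} c_upper"
    and c_change: "0 < c_change"
    and beta0_bound: "\<And>n. n \<ge> 1 \<Longrightarrow> L2_set (\<beta>0 n) {1..p n} \<le> a\<^sub>0"
    and regular: "\<And>n J. n \<ge> 1 \<Longrightarrow> J \<in> submodels (p n) (2 * q n) \<Longrightarrow> support (\<beta>0 n) \<subseteq> J \<Longrightarrow>
      hess_regular n (p n) (X n) (b n) c_lower c_upper c_change J"
    and mle_constants: "mle_bound_constants a\<^sub>0 c_lower c_upper c_change \<nu> c_sample a_MLE"
    and prior: "\<And>n J. n \<ge> 1 \<Longrightarrow> J \<in> submodels (p n) (q n) \<Longrightarrow> prior_density J (f n J)"
    and F_pos: "0 < F\<^sub>3" "0 < F\<^sub>4"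
    and prior_upper: "\<And>n J \<beta>. n \<ge> 1 \<Longrightarrow> J \<in> submodels (p n) (q n) \<Longrightarrow> \<beta> \<in> coord_space J \<Longrightarrow>
      f n J \<beta> \<le> F\<^sub>3"
    and prior_lower: "\<And>n J \<beta>. n \<ge> 1 \<Longrightarrow> J \<in> submodels (p n) (q n) \<Longrightarrow> \<beta> \<in> coord_space J \<Longrightarrow>
      L2_set \<beta> J \<le> a_MLE \<Longrightarrow> F\<^sub>4 \<le> f n J \<beta>"
    and gamma: "0 \<le> \<gamma>" "\<gamma> > 1 - (1 - 2 * \<psi>) / (2 * (\<kappa> - \<psi>))"
  shows "(\<lambda>n. measure (M n) {\<omega> \<in> space (M n).
      selects_truth \<gamma> n (p n) (q n) (X n) (b n) (f n) (\<beta>0 n) (\<lambda>i. Y n i \<omega>)}) \<longlonglongrightarrow> 1"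
proof -

  \<comment> \<open>Constants, rates and thresholds\<close>
  define rad where "rad = mle_radius c_lower c_upper a\<^sub>0"
  define lam where "lam = c_lower (a\<^sub>0 + rad)"
  define Lam where "Lam = c_upper (a\<^sub>0 + rad)"
  define l where "l n = \<kappa> * ln (real n) + ln 2" for n :: nat
  define w where "w n = real n powr \<psi>" for n :: nat
  \<comment> \<open>Coefficient of \<open>ln n\<close> in the margin per additional covariate: 1/2
    from the determinant, \<open>\<gamma> * (\<kappa> - \<psi>)\<close> from the binomial factor,
    and \<open>- \<kappa>\<close> from the score. The condition on \<gamma> says that it is
    positive.\<close>
  define g where "g = 1 / 2 + \<gamma> * (\<kappa> - \<psi>) - \<kappa>"
  \<comment> \<open>Spends half of the margin, as
    \<open>(1 + \<epsilon>) * \<kappa> = \<kappa> + g / 2\<close>.\<close>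
  define \<epsilon> where "\<epsilon> = g / (2 * \<kappa>)"
  \<comment> \<open>Makes \<open>(1 - 2 * \<eta>) * (1 + \<epsilon>)\<close> equal to
    \<open>1 + \<epsilon> / 2\<close>, so the union bound still leaves \<open>p\<close> to the power
    \<open>- \<epsilon> / 2\<close>.\<close>
  define \<eta> where "\<eta> = \<epsilon> / (4 * (1 + \<epsilon>))"
  \<comment> \<open>The tail exponent \<open>\<tau>\<^sup>2 / (2 * n * Lam)\<close> becomes
    \<open>2 * ln p\<close>, and the union over \<open>p\<close> coordinates costs
    \<open>2 / p\<close>.\<close>
  define \<tau> where "\<tau> n = 2 * sqrt (real n * Lam * ln (real (p n)))" for n
  define \<sigma> where "\<sigma> n = sqrt (2 * q n) * \<tau> n" for n
  define \<delta> where "\<delta> n = 2 * \<sigma> n / (real n * lam)" for n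
  define s where "s n = real n powr (- \<phi> / 2)" for n :: nat
  define c where "c n = (1 + \<epsilon>) * ln (real (p n))" for n
  \<comment> \<open>From \<open>\<delta>\<^sup>2 = 32 * Lam / lam\<^sup>2 * q * ln p / n\<close>
    with \<open>q \<le> 2 * w\<close> and \<open>ln p \<le> l\<close>.\<close>
  define K where "K = 64 * Lam / lam\<^sup>2"
  define D where "D n = ln (real n * lam / (2 * pi)) / 2
    + \<gamma> * ln ((real (p n) - real (q n)) / real (q n)) - c n" for n
  define bound where "bound = (\<lambda>n. 2 * real (p n) * exp (- ((\<tau> n)\<^sup>2 / (2 * (real n * Lam)))) +
      2 * exp 1 * (3 * exp 1 / \<eta> * real (p n) * exp (- ((1 - 2 * \<eta>) * c n))))"

  \<comment> \<open>Size of the dimensions, and the locale at each sample size\<close>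
  have pb: "real n powr \<kappa> / 2 \<le> real (p n)" "real (p n) \<le> 2 * real n powr \<kappa>" "1 \<le> p n" if "1 \<le> n" for n
    using rounding_of_bounds[OF p_n[OF that]] that exponents by (auto simp: ge_one_powr_ge_zero)
  have qb: "w n / 2 \<le> real (q n)" "real (q n) \<le> 2 * w n" "1 \<le> q n" if "1 \<le> n" for n
    using rounding_of_bounds[OF q_n[OF that]] that exponents by (auto simp: ge_one_powr_ge_zero w_def)
  have glm: "regular_glm n (p n) (q n) (X n) (b n) (\<beta>0 n) c_lower c_upper c_change a\<^sub>0" if n: "1 \<le> n" for n
  proof
    have "exp_family (\<mu> n) (b n)" using problem[OF n] by (simp add: glm_problem_def)
    note b = exp_family_deriv[OF this]
    show "(b n has_real_derivative deriv (b n) x) (at x)"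
      "(deriv (b n) has_real_derivative deriv (deriv (b n)) x) (at x)" for x by (rule b)+
    show "continuous_on UNIV (deriv (deriv (b n)))" by (rule b)
    show "\<beta>0 n \<in> coord_space {1..p n}" "card (support (\<beta>0 n)) \<le> q n"
      using problem[OF n] by (auto simp: glm_problem_def)
  qed (use n qb(3)[OF n] beta0_bound[OF n] a0_pos c_lower c_upper c_change regular[OF n] in auto)
  \<comment> \<open>\<open>lam\<close> and \<open>Lam\<close> are the same for all sample sizes, so
    their positivity may be read off from sample size 1.\<close>
  interpret one: regular_glm 1 "p 1" "q 1" "X 1" "b 1" "\<beta>0 1" c_lower c_upper c_change a\<^sub>0
    by (rule glm) simp
  have lam: "0 < lam" and Lam: "0 < Lam"
    using one.lam_pos one.Lam_pos by (auto simp: lam_def Lam_def rad_def)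
  have "c_lower 0 \<le> c_upper 0" by (rule one.c_lower_le_c_upper) (rule support_nonempty, simp)
  then have aMLE: "a\<^sub>0 < a_MLE"
    by (intro mle_bound_gt[OF mle_constants a0_pos c_change c_lower(1) c_lower(2) c_upper(2)]) auto

  \<comment> \<open>The margin and the size of the deviations\<close>
  have \<kappa>: "0 < \<kappa>" "0 < \<kappa> - \<psi>" using exponents by auto
  have g: "0 < g"
  proof -
    have "1 - (1 - 2 * \<psi>) / (2 * (\<kappa> - \<psi>)) < \<gamma>" by (rule gamma)
    then have "(1 - (1 - 2 * \<psi>) / (2 * (\<kappa> - \<psi>))) * (\<kappa> - \<psi>) < \<gamma> * (\<kappa> - \<psi>)"
      using \<kappa> by (intro mult_strict_right_mono) auto
    moreover have "(1 - (1 - 2 * \<psi>) / (2 * (\<kappa> - \<psi>))) * (\<kappa> - \<psi>) = \<kappa> - 1 / 2"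
      using \<kappa> by (simp add: field_simps)
    ultimately show ?thesis by (simp add: g_def)
  qed
  have \<epsilon>: "0 < \<epsilon>" using g \<kappa> by (simp add: \<epsilon>_def)
  have \<eta>: "0 < \<eta>" "\<eta> \<le> 1 / 2" using \<epsilon> by (auto simp: \<eta>_def field_simps)
  have \<eta>\<epsilon>: "(1 - 2 * \<eta>) * (1 + \<epsilon>) = 1 + \<epsilon> / 2"
    using \<epsilon> by (simp add: \<eta>_def field_simps)
  have lnp: "0 \<le> ln (real (p n))" "ln (real (p n)) \<le> l n" if "1 \<le> n" for n
  proof -
    show "0 \<le> ln (real (p n))" using pb(3)[OF that] by simp
    have "ln (real (p n)) \<le> ln (2 * real n powr \<kappa>)" using pb(2,3)[OF that] that by (intro ln_mono) auto
    also have "\<dots> = l n" using that by (simp add: l_def ln_mult ln_powr)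
    finally show "ln (real (p n)) \<le> l n" .
  qed
  have l0: "0 \<le> l n" if "1 \<le> n" for n using lnp[OF that] by linarith
  have w0: "0 < w n" if "1 \<le> n" for n using that by (simp add: w_def)
  have w3: "real n powr (3 * \<psi> - 1) = w n ^ 3 / real n" if "1 \<le> n" for n
  proof -
    have "w n ^ 3 = real n powr (3 * \<psi>)" using that by (simp add: w_def powr_powr[symmetric] powr_numeral mult.commute flip: powr_powr)
    then show ?thesis using that by (simp add: powr_diff)
  qed
  have qlnp: "real (q n) * ln (real (p n)) \<le> 2 * w n * l n" if "1 \<le> n" for n
    using qb(2)[OF that] lnp[OF that] w0[OF that] by (intro mult_mono) auto
  have \<tau>2: "(\<tau> n)\<^sup>2 = 4 * (real n * Lam * ln (real (p n)))" if "1 \<le> n" for n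
    using lnp(1)[OF that] Lam by (simp add: \<tau>_def power_mult_distrib)
  have \<tau>0: "0 \<le> \<tau> n" if "1 \<le> n" for n using lnp(1)[OF that] Lam by (simp add: \<tau>_def)
  have \<sigma>0: "0 \<le> \<sigma> n" if "1 \<le> n" for n using \<tau>0[OF that] by (simp add: \<sigma>_def)
  have \<delta>0: "0 \<le> \<delta> n" if "1 \<le> n" for n using \<sigma>0[OF that] lam by (simp add: \<delta>_def)
  have \<delta>2: "(\<delta> n)\<^sup>2 \<le> K * (w n * l n / real n)" if n: "1 \<le> n" for n
  proof -
    have "(\<sigma> n)\<^sup>2 = 2 * real (q n) * (\<tau> n)\<^sup>2" by (simp add: \<sigma>_def power_mult_distrib)
    then have "(\<delta> n)\<^sup>2 = 4 * (2 * real (q n) * (4 * (real n * Lam * ln (real (p n))))) / (real n * lam)\<^sup>2"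
      unfolding \<tau>2[OF n] by (simp add: \<delta>_def power_divide power_mult_distrib)
    also have "\<dots> = 32 * Lam / lam\<^sup>2 * (real (q n) * ln (real (p n))) / real n"
      using n lam by (simp add: power2_eq_square field_simps)
    also have "\<dots> \<le> 32 * Lam / lam\<^sup>2 * (2 * w n * l n) / real n"
      using qlnp[OF n] Lam by (intro divide_right_mono mult_left_mono) auto
    also have "\<dots> = K * (w n * l n / real n)" by (simp add: K_def)
    finally show ?thesis .
  qed

  \<comment> \<open>Limits of the error rates\<close>
  have lim\<psi>: "(\<lambda>n. real n powr (3 * \<psi> - 1) * l n ^ m) \<longlonglongrightarrow> 0" if "0 < m" for m
    unfolding l_def using exponents that by (intro powr_times_log_tendsto_0) auto
  have \<delta>_lim: "\<delta> \<longlonglongrightarrow> 0"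
  proof (rule tendsto_0_of_square_le)
    have "(\<lambda>n. real n powr (\<psi> - 1) * l n ^ 1) \<longlonglongrightarrow> 0"
      unfolding l_def using exponents by (intro powr_times_log_tendsto_0) auto
    then show "(\<lambda>n. K * (real n powr (\<psi> - 1) * l n ^ 1)) \<longlonglongrightarrow> 0" by (rule tendsto_mult_right_zero)
    show "(\<delta> n)\<^sup>2 \<le> K * (real n powr (\<psi> - 1) * l n ^ 1)" if "1 \<le> n" for n
      using \<delta>2[OF that] that by (simp add: powr_diff w_def)
  qed
  \<comment> \<open>Estimation error against signal strength: up to logarithms the squared ratio is
    of order \<open>n powr (\<psi> + \<phi> - 1)\<close>, and here
    \<open>\<phi> < 1 - \<psi>\<close> enters.\<close>
  have \<delta>s_lim: "(\<lambda>n. \<delta> n / s n) \<longlonglongrightarrow> 0"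
  proof (rule tendsto_0_of_square_le)
    have "(\<lambda>n. real n powr (\<psi> + \<phi> - 1) * l n ^ 1) \<longlonglongrightarrow> 0"
      unfolding l_def using exponents by (intro powr_times_log_tendsto_0) auto
    then show "(\<lambda>n. K * (real n powr (\<psi> + \<phi> - 1) * l n ^ 1)) \<longlonglongrightarrow> 0" by (rule tendsto_mult_right_zero)
    show "(\<delta> n / s n)\<^sup>2 \<le> K * (real n powr (\<psi> + \<phi> - 1) * l n ^ 1)" if n: "1 \<le> n" for n
    proof -
      have s2: "(s n)\<^sup>2 = real n powr (- \<phi>)" using n by (simp add: s_def power2_eq_square flip: powr_add)
      have "(\<delta> n / s n)\<^sup>2 = (\<delta> n)\<^sup>2 * real n powr \<phi>"
        unfolding power_divide s2 powr_minus by (simp add: divide_inverse)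
      also have "\<dots> \<le> K * (w n * l n / real n) * real n powr \<phi>"
        using \<delta>2[OF n] by (intro mult_right_mono) auto
      also have "\<dots> = K * (real n powr (\<psi> + \<phi> - 1) * l n ^ 1)"
        using n by (simp add: powr_diff powr_add w_def)
      finally show ?thesis .
    qed
  qed
  \<comment> \<open>Error of the determinant comparison. The next two limits concern the cubic
    remainders at the estimator and on the net; all three rest on
    \<open>\<psi> < 1 / 3\<close>.\<close>
  have q\<delta>_lim: "(\<lambda>n. real (q n) * \<delta> n) \<longlonglongrightarrow> 0"
  proof (rule tendsto_0_of_square_le)
    show "(\<lambda>n. 4 * K * (real n powr (3 * \<psi> - 1) * l n ^ 1)) \<longlonglongrightarrow> 0"
      by (rule tendsto_mult_right_zero[OF lim\<psi>]) simp
    show "(real (q n) * \<delta> n)\<^sup>2 \<le> 4 * K * (real n powr (3 * \<psi> - 1) * l n ^ 1)" if n: "1 \<le> n" for n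
    proof -
      have "(real (q n) * \<delta> n)\<^sup>2 \<le> (2 * w n)\<^sup>2 * (K * (w n * l n / real n))"
        unfolding power_mult_distrib[of "real (q n)"]
        using qb(2)[OF n] \<delta>2[OF n] by (intro mult_mono power_mono) auto
      also have "\<dots> = 4 * K * (real n powr (3 * \<psi> - 1) * l n ^ 1)"
        unfolding w3[OF n] by (simp add: power2_eq_square power3_eq_cube)
      finally show ?thesis .
    qed
  qed
  have n\<delta>3_lim: "(\<lambda>n. real n * \<delta> n ^ 3) \<longlonglongrightarrow> 0"
  proof (rule tendsto_0_of_square_le)
    show "(\<lambda>n. K ^ 3 * (real n powr (3 * \<psi> - 1) * l n ^ 3)) \<longlonglongrightarrow> 0"
      by (rule tendsto_mult_right_zero[OF lim\<psi>]) simp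
    show "(real n * \<delta> n ^ 3)\<^sup>2 \<le> K ^ 3 * (real n powr (3 * \<psi> - 1) * l n ^ 3)" if n: "1 \<le> n" for n
    proof -
      have "(real n * \<delta> n ^ 3)\<^sup>2 = (real n)\<^sup>2 * ((\<delta> n)\<^sup>2) ^ 3"
        by (simp add: power_mult_distrib flip: power_mult)
      also have "\<dots> \<le> (real n)\<^sup>2 * (K * (w n * l n / real n)) ^ 3"
        using \<delta>2[OF n] by (intro mult_left_mono power_mono) auto
      also have "\<dots> = K ^ 3 * (real n powr (3 * \<psi> - 1) * l n ^ 3)"
        unfolding w3[OF n] using n by (simp add: power_mult_distrib power_divide power2_eq_square power3_eq_cube)
      finally show ?thesis .
    qed
  qed
  have net_lim: "(\<lambda>n. real n * (sqrt (2 * c n * q n) / sqrt (real n * lam)) ^ 3) \<longlonglongrightarrow> 0"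
  proof (rule tendsto_0_of_square_le)
    show "(\<lambda>n. (4 * (1 + \<epsilon>) / lam) ^ 3 * (real n powr (3 * \<psi> - 1) * l n ^ 3)) \<longlonglongrightarrow> 0"
      by (rule tendsto_mult_right_zero[OF lim\<psi>]) simp
    show "(real n * (sqrt (2 * c n * q n) / sqrt (real n * lam)) ^ 3)\<^sup>2
        \<le> (4 * (1 + \<epsilon>) / lam) ^ 3 * (real n powr (3 * \<psi> - 1) * l n ^ 3)" if n: "1 \<le> n" for n
    proof -
      have c0: "0 \<le> c n" using lnp(1)[OF n] \<epsilon> by (simp add: c_def)
      have "(sqrt (2 * c n * q n) / sqrt (real n * lam))\<^sup>2 = 2 * (1 + \<epsilon>) * (real (q n) * ln (real (p n))) / (real n * lam)"
        using c0 lam by (simp add: power_divide c_def)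
      also have "\<dots> \<le> 2 * (1 + \<epsilon>) * (2 * w n * l n) / (real n * lam)"
        using qlnp[OF n] \<epsilon> lam by (intro divide_right_mono mult_left_mono) auto
      also have "\<dots> = 4 * (1 + \<epsilon>) / lam * (w n * l n / real n)"
        using n lam by (simp add: field_simps)
      finally have le: "(sqrt (2 * c n * q n) / sqrt (real n * lam))\<^sup>2 \<le> 4 * (1 + \<epsilon>) / lam * (w n * l n / real n)" .
      have "(real n * (sqrt (2 * c n * q n) / sqrt (real n * lam)) ^ 3)\<^sup>2 =
          (real n)\<^sup>2 * ((sqrt (2 * c n * q n) / sqrt (real n * lam))\<^sup>2) ^ 3"
        unfolding power_mult_distrib power_mult[symmetric] by (simp add: mult.commute)
      also have "\<dots> \<le> (real n)\<^sup>2 * (4 * (1 + \<epsilon>) / lam * (w n * l n / real n)) ^ 3"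
        using le by (intro mult_left_mono power_mono) auto
      also have "\<dots> = (4 * (1 + \<epsilon>) / lam) ^ 3 * ((real n)\<^sup>2 * (w n * l n / real n) ^ 3)"
        unfolding power_mult_distrib by simp
      also have "(real n)\<^sup>2 * (w n * l n / real n) ^ 3 = real n powr (3 * \<psi> - 1) * l n ^ 3"
        unfolding w3[OF n] using n by (simp add: power_mult_distrib power_divide power2_eq_square power3_eq_cube)
      finally show ?thesis .
    qed
  qed
  have \<tau>_lim: "(\<lambda>n. \<tau> n / real n) \<longlonglongrightarrow> 0"
  proof (rule tendsto_0_of_square_le)
    have "(\<lambda>n. real n powr (- 1) * l n ^ 1) \<longlonglongrightarrow> 0"
      unfolding l_def by (intro powr_times_log_tendsto_0) auto
    then show "(\<lambda>n. 4 * Lam * (real n powr (- 1) * l n ^ 1)) \<longlonglongrightarrow> 0" by (rule tendsto_mult_right_zero)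
    show "(\<tau> n / real n)\<^sup>2 \<le> 4 * Lam * (real n powr (- 1) * l n ^ 1)" if n: "1 \<le> n" for n
    proof -
      have "(\<tau> n / real n)\<^sup>2 = 4 * Lam * (ln (real (p n)) / real n)"
        unfolding power_divide \<tau>2[OF n] using n by (simp add: power2_eq_square)
      also have "\<dots> \<le> 4 * Lam * (l n / real n)"
        using lnp(2)[OF n] Lam by (intro mult_left_mono divide_right_mono) auto
      finally show ?thesis using n by (simp add: powr_minus divide_inverse mult_ac)
    qed
  qed
  have p_lim: "filterlim (\<lambda>n. real (p n)) at_top sequentially"
  proof (rule filterlim_at_top_mono)
    show "filterlim (\<lambda>n. real n powr \<kappa> / 2) at_top sequentially" using \<kappa>(1) by real_asymp
    show "\<forall>\<^sub>F n in sequentially. real n powr \<kappa> / 2 \<le> real (p n)"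
      by (rule eventually_sequentiallyI[of 1], rule pb(1))
  qed

  \<comment> \<open>Probability of the exceptional set\<close>
  have b1: "(\<lambda>n. 2 * real (p n) * exp (- ((\<tau> n)\<^sup>2 / (2 * (real n * Lam))))) \<longlonglongrightarrow> 0"
  proof (rule Lim_transform_eventually)
    have "((\<lambda>x::real. 2 / x) \<longlongrightarrow> 0) at_top" by real_asymp
    then show "(\<lambda>n. 2 / real (p n)) \<longlonglongrightarrow> 0" by (rule filterlim_compose[OF _ p_lim])
    show "\<forall>\<^sub>F n in sequentially. 2 / real (p n) = 2 * real (p n) * exp (- ((\<tau> n)\<^sup>2 / (2 * (real n * Lam))))"
      using eventually_ge_at_top[of 1]
    proof eventually_elim
      case (elim n)
      have pp: "0 < real (p n)" using pb(3)[OF elim] by simp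
      have "(\<tau> n)\<^sup>2 / (2 * (real n * Lam)) = ln (real (p n)) + ln (real (p n))"
        using elim Lam by (simp add: \<tau>2)
      then have "exp (- ((\<tau> n)\<^sup>2 / (2 * (real n * Lam)))) = inverse (real (p n) * real (p n))"
        using pp by (simp only: exp_minus exp_add exp_ln)
      then show ?case using pp by (simp add: field_simps)
    qed
  qed
  have b2: "(\<lambda>n. 3 * exp 1 / \<eta> * real (p n) * exp (- ((1 - 2 * \<eta>) * c n))) \<longlonglongrightarrow> 0"
  proof (rule Lim_transform_eventually)
    have "((\<lambda>x::real. x powr (- \<epsilon> / 2)) \<longlongrightarrow> 0) at_top" using \<epsilon> by real_asymp
    then have "(\<lambda>n. real (p n) powr (- \<epsilon> / 2)) \<longlonglongrightarrow> 0" by (rule filterlim_compose[OF _ p_lim])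
    then show "(\<lambda>n. 3 * exp 1 / \<eta> * real (p n) powr (- \<epsilon> / 2)) \<longlonglongrightarrow> 0" by (rule tendsto_mult_right_zero)
    show "\<forall>\<^sub>F n in sequentially. 3 * exp 1 / \<eta> * real (p n) powr (- \<epsilon> / 2) =
        3 * exp 1 / \<eta> * real (p n) * exp (- ((1 - 2 * \<eta>) * c n))"
      using eventually_ge_at_top[of 1]
    proof eventually_elim
      case (elim n)
      have pp: "0 < real (p n)" using pb(3)[OF elim] by simp
      have "(1 - 2 * \<eta>) * c n = (1 + \<epsilon> / 2) * ln (real (p n))"
        unfolding c_def mult.assoc[symmetric] \<eta>\<epsilon> ..
      then have "exp (- ((1 - 2 * \<eta>) * c n)) = exp (- ln (real (p n)) + (- \<epsilon> / 2) * ln (real (p n)))"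
        by (simp add: algebra_simps)
      also have "\<dots> = inverse (real (p n)) * real (p n) powr (- \<epsilon> / 2)"
        using pp by (simp only: exp_add exp_minus exp_ln powr_def) simp
      finally show ?case using pp by simp
    qed
  qed
  have bound_lim: "bound \<longlonglongrightarrow> 0"
    unfolding bound_def using tendsto_add[OF b1 tendsto_mult_right_zero[OF b2, of "2 * exp 1"]] by simp

  \<comment> \<open>Inequalities valid for all large sample sizes\<close>
  have e1: "\<forall>\<^sub>F n in sequentially. 4 * \<sigma> n \<le> real n * c_lower (a\<^sub>0 + 1)"
  proof -
    have pos: "0 < c_lower (a\<^sub>0 + 1) / (2 * lam)" using lam a0_pos c_lower(1)[of "a\<^sub>0 + 1"] by simp
    show ?thesis
      using order_tendstoD(2)[OF \<delta>_lim pos] eventually_ge_at_top[of 1]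
      by eventually_elim (use lam in \<open>simp add: \<delta>_def field_simps\<close>)
  qed
  have e2: "\<forall>\<^sub>F n in sequentially. 4 * \<sigma> n \<le> real n * lam * s n"
  proof -
    have "(0::real) < 1 / 2" by simp
    from order_tendstoD(2)[OF \<delta>s_lim this] eventually_ge_at_top[of 1]
    show ?thesis by eventually_elim (use lam in \<open>simp add: \<delta>_def s_def field_simps\<close>)
  qed
  have e3: "\<forall>\<^sub>F n in sequentially. a\<^sub>0 + \<delta> n \<le> a_MLE"
  proof -
    have "0 < a_MLE - a\<^sub>0" using aMLE by simp
    from order_tendstoD(2)[OF \<delta>_lim this] show ?thesis by eventually_elim simp
  qed
  have e4: "\<forall>\<^sub>F n in sequentially. 2 * pi \<le> real n * lam"
    using lam by real_asymp
  have e5: "\<forall>\<^sub>F n in sequentially. 2 * real (q n) \<le> real (p n)"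
  proof -
    have "filterlim (\<lambda>n. real n powr (\<kappa> - \<psi>)) at_top sequentially" using \<kappa>(2) by real_asymp
    \<comment> \<open>\<open>p\<close> is at least \<open>n powr \<kappa> / 2\<close> and
      \<open>2 * q\<close> at most \<open>4 * w\<close>, hence the constant 8.\<close>
    then have "\<forall>\<^sub>F n in sequentially. 8 \<le> real n powr (\<kappa> - \<psi>)" by (simp add: filterlim_at_top)
    then show ?thesis using eventually_ge_at_top[of 1]
    proof eventually_elim
      case (elim n)
      have "2 * real (q n) \<le> 4 * w n" using qb(2)[OF elim(2)] by simp
      also have "\<dots> \<le> real n powr \<kappa> / 2" using elim w0[OF elim(2)] by (simp add: w_def powr_diff field_simps)
      also have "\<dots> \<le> real (p n)" by (rule pb(1)[OF elim(2)])
      finally show ?case .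
    qed
  qed
  have e6: "\<forall>\<^sub>F n in sequentially. ln F\<^sub>3 + \<gamma> * q n * ln (p n) + q n / 2 * ln (real n * Lam + 1)
      < ln F\<^sub>4 + real n * lam * (s n)\<^sup>2 / 4"
  proof -
    define C where "C = ln F\<^sub>3 - ln F\<^sub>4"
    define h where "h n = C * real n powr (\<phi> - 1) + (2 * \<gamma> * (real n powr (\<psi> + \<phi> - 1) * l n ^ 1)
       + real n powr (\<psi> + \<phi> - 1) * (1 * ln (real n) + ln (Lam + 1)) ^ 1)" for n
    have h1: "(\<lambda>n. real n powr (\<phi> - 1)) \<longlonglongrightarrow> 0"
      using powr_times_log_tendsto_0[of "\<phi> - 1" 1 0 1] exponents by simp
    have h2: "(\<lambda>n. real n powr (\<psi> + \<phi> - 1) * l n ^ 1) \<longlonglongrightarrow> 0"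
      unfolding l_def using exponents by (intro powr_times_log_tendsto_0) auto
    have h3: "(\<lambda>n. real n powr (\<psi> + \<phi> - 1) * (1 * ln (real n) + ln (Lam + 1)) ^ 1) \<longlonglongrightarrow> 0"
      using exponents by (intro powr_times_log_tendsto_0) auto
    have "h \<longlonglongrightarrow> C * 0 + (2 * \<gamma> * 0 + 0)"
      unfolding h_def by (intro tendsto_add tendsto_mult_left h1 h2 h3)
    then have "\<forall>\<^sub>F n in sequentially. h n < lam / 4" using lam by (intro order_tendstoD(2)) auto
    then show ?thesis using eventually_ge_at_top[of 1]
    proof eventually_elim
      case (elim n)
      have n: "1 \<le> n" by fact
      \<comment> \<open>Order of the signal term; dividing by it turns the claim into the limit of
        \<open>h\<close>.\<close>
      define R where "R = real n powr (1 - \<phi>)"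
      have R: "0 < R" using n by (simp add: R_def)
      have R1: "real n powr (\<phi> - 1) * R = 1" using n by (simp add: R_def flip: powr_add)
      have R2: "real n powr (\<psi> + \<phi> - 1) * R = w n" using n by (simp add: R_def w_def flip: powr_add)
      have "\<gamma> * q n * ln (p n) \<le> \<gamma> * (2 * w n * l n)"
        using qlnp[OF n] gamma(1) by (simp add: mult.assoc mult_left_mono)
      moreover have "q n / 2 * ln (real n * Lam + 1) \<le> w n * (ln (real n) + ln (Lam + 1))"
      proof (rule mult_mono)
        have "ln (real n * Lam + 1) \<le> ln (real n * (Lam + 1))"
          using n Lam by (intro ln_mono) (auto simp: algebra_simps intro: add_pos_pos)
        then show "ln (real n * Lam + 1) \<le> ln (real n) + ln (Lam + 1)" using n Lam by (simp add: ln_mult)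
      qed (use qb(2)[OF n] w0[OF n] n Lam in \<open>auto intro!: ln_ge_zero\<close>)
      ultimately have "ln F\<^sub>3 - ln F\<^sub>4 + \<gamma> * q n * ln (p n) + q n / 2 * ln (real n * Lam + 1) \<le>
          C * (real n powr (\<phi> - 1) * R) + (2 * \<gamma> * l n * (real n powr (\<psi> + \<phi> - 1) * R)
          + (ln (real n) + ln (Lam + 1)) * (real n powr (\<psi> + \<phi> - 1) * R))"
        unfolding R1 R2 C_def by (simp add: algebra_simps)
      also have "\<dots> = h n * R" by (simp add: h_def algebra_simps)
      also have "\<dots> < lam / 4 * R" using elim(1) R by (rule mult_strict_right_mono)
      also have "\<dots> = real n * lam * (s n)\<^sup>2 / 4"
      proof -
        have s2: "(s n)\<^sup>2 = real n powr (- \<phi>)" using n by (simp add: s_def power2_eq_square flip: powr_add)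
        have "real n * real n powr (- \<phi>) = R" using n by (simp add: R_def powr_mult_base)
        then have "R = real n * (s n)\<^sup>2" by (simp only: s2)
        then show ?thesis by simp
      qed
      finally show ?case by linarith
    qed
  qed
  have D_lim: "filterlim D at_top sequentially"
  proof (rule filterlim_at_top_mono)
    have g2: "0 < g / 2" using g by simp
    have "filterlim (\<lambda>n. ln (real n)) at_top sequentially" by real_asymp
    then have "filterlim (\<lambda>n. g / 2 * ln (real n)) at_top sequentially"
      by (rule filterlim_tendsto_pos_mult_at_top[OF tendsto_const g2])
    \<comment> \<open>\<open>ln 8\<close> comes from
      \<open>(p - q) / q \<ge> n powr (\<kappa> - \<psi>) / 8\<close>, and
      \<open>(1 + \<epsilon>) * ln 2\<close> from \<open>p \<le> 2 * n powr \<kappa>\<close>. Half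
      of the margin \<open>g\<close> is left as coefficient of the logarithm.\<close>
    then show "filterlim (\<lambda>n. (ln (lam / (2 * pi)) / 2 - \<gamma> * ln 8 - (1 + \<epsilon>) * ln 2) + g / 2 * ln (real n))
        at_top sequentially"
      by (rule filterlim_tendsto_add_at_top[OF tendsto_const])
    show "\<forall>\<^sub>F n in sequentially. (ln (lam / (2 * pi)) / 2 - \<gamma> * ln 8 - (1 + \<epsilon>) * ln 2) + g / 2 * ln (real n) \<le> D n"
      using e5 eventually_ge_at_top[of 1]
    proof eventually_elim
      case (elim n)
      have n: "1 \<le> n" by fact
      have qp: "0 < real (q n)" using qb(3)[OF n] by simp
      have "real n powr (\<kappa> - \<psi>) / 8 = (real n powr \<kappa> / 2) / (2 * (2 * w n))"
        using n by (simp add: powr_diff w_def)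
      also have "\<dots> \<le> real (p n) / (2 * real (q n))"
        using pb(1)[OF n] qb(2)[OF n] qp by (intro frac_le) auto
      also have "\<dots> \<le> (real (p n) - real (q n)) / real (q n)" using elim(1) qp by (simp add: field_simps)
      finally have "ln (real n powr (\<kappa> - \<psi>) / 8) \<le> ln ((real (p n) - real (q n)) / real (q n))"
        using n by (intro ln_mono) auto
      then have "(\<kappa> - \<psi>) * ln (real n) - ln 8 \<le> ln ((real (p n) - real (q n)) / real (q n))"
        using n by (simp add: ln_div ln_powr)
      then have "\<gamma> * ((\<kappa> - \<psi>) * ln (real n) - ln 8) \<le> \<gamma> * ln ((real (p n) - real (q n)) / real (q n))"
        using gamma(1) by (rule mult_left_mono)
      moreover have "c n \<le> (1 + \<epsilon>) * l n"
        unfolding c_def using lnp(2)[OF n] \<epsilon> by (intro mult_left_mono) auto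
      moreover have "ln (real n * lam / (2 * pi)) = ln (real n) + ln (lam / (2 * pi))"
        using n lam ln_mult[of "real n" "lam / (2 * pi)"] by simp
      moreover have "g / 2 * ln (real n) = ln (real n) / 2 + \<gamma> * ((\<kappa> - \<psi>) * ln (real n)) - (1 + \<epsilon>) * (\<kappa> * ln (real n))"
        using \<kappa>(1) by (simp add: \<epsilon>_def g_def field_simps)
      moreover have "\<gamma> * ((\<kappa> - \<psi>) * ln (real n) - ln 8) = \<gamma> * ((\<kappa> - \<psi>) * ln (real n)) - \<gamma> * ln 8"
        by (rule right_diff_distrib)
      moreover have "(1 + \<epsilon>) * l n = (1 + \<epsilon>) * (\<kappa> * ln (real n)) + (1 + \<epsilon>) * ln 2"
        unfolding l_def by (rule distrib_left)
      ultimately show ?case unfolding D_def by linarith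
    qed
  qed
  have e7: "\<forall>\<^sub>F n in sequentially. 0 \<le> D n" using D_lim by (simp add: filterlim_at_top)
  have e8: "\<forall>\<^sub>F n in sequentially. real n * c_change * \<delta> n ^ 3 + ln F\<^sub>3 - ln F\<^sub>4
      + q n / 2 * ln (1 + 2 * c_change * \<delta> n / lam) < D n"
  proof -
    have "(\<lambda>n. c_change * (real n * \<delta> n ^ 3) + c_change / lam * (real (q n) * \<delta> n)) \<longlonglongrightarrow> c_change * 0 + c_change / lam * 0"
      by (intro tendsto_add tendsto_mult_left n\<delta>3_lim q\<delta>_lim)
    then have "\<forall>\<^sub>F n in sequentially. c_change * (real n * \<delta> n ^ 3) + c_change / lam * (real (q n) * \<delta> n) < 1"
      by (intro order_tendstoD(2)) auto
    moreover have "\<forall>\<^sub>F n in sequentially. 1 + ln F\<^sub>3 - ln F\<^sub>4 \<le> D n" using D_lim by (simp add: filterlim_at_top)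
    ultimately show ?thesis using eventually_ge_at_top[of 1]
    proof eventually_elim
      case (elim n)
      have n: "1 \<le> n" by fact
      have "ln (1 + 2 * c_change * \<delta> n / lam) \<le> 2 * c_change * \<delta> n / lam"
        using \<delta>0[OF n] c_change lam by (intro ln_add_one_self_le_self) auto
      then have "q n / 2 * ln (1 + 2 * c_change * \<delta> n / lam) \<le> q n / 2 * (2 * c_change * \<delta> n / lam)"
        by (intro mult_left_mono) auto
      also have "\<dots> = c_change / lam * (real (q n) * \<delta> n)" by simp
      finally have "q n / 2 * ln (1 + 2 * c_change * \<delta> n / lam) \<le> c_change / lam * (real (q n) * \<delta> n)" .
      moreover have "real n * c_change * \<delta> n ^ 3 = c_change * (real n * \<delta> n ^ 3)" by simp
      ultimately show ?case using elim by linarith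
    qed
  qed
  have e9: "\<forall>\<^sub>F n in sequentially. \<tau> n \<le> real n * Lam"
    using order_tendstoD(2)[OF \<tau>_lim Lam] eventually_ge_at_top[of 1]
    by eventually_elim (simp add: field_simps)
  have e10: "\<forall>\<^sub>F n in sequentially. real n * c_change * (sqrt (2 * c n * q n) / sqrt (real n * lam)) ^ 3 \<le> 2"
  proof -
    have "(\<lambda>n. c_change * (real n * (sqrt (2 * c n * q n) / sqrt (real n * lam)) ^ 3)) \<longlonglongrightarrow> 0"
      by (rule tendsto_mult_right_zero[OF net_lim])
    then have "\<forall>\<^sub>F n in sequentially. c_change * (real n * (sqrt (2 * c n * q n) / sqrt (real n * lam)) ^ 3) < 2"
      by (rule order_tendstoD(2)) simp
    then show ?thesis by eventually_elim (simp add: mult_ac)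
  qed
  have e11: "\<forall>\<^sub>F n in sequentially. 3 * exp 1 / \<eta> * real (p n) * exp (- ((1 - 2 * \<eta>) * c n)) < 1 / 2"
    by (rule order_tendstoD(2)[OF b2]) simp
  have e12: "\<forall>\<^sub>F n in sequentially. 2 \<le> real (p n)" using p_lim unfolding filterlim_at_top by blast

  \<comment> \<open>Selection of the true support outside the exceptional set\<close>
  let ?E = "\<lambda>n. {\<omega> \<in> space (M n).
      selects_truth \<gamma> n (p n) (q n) (X n) (b n) (f n) (\<beta>0 n) (\<lambda>i. Y n i \<omega>)}"
  have "\<forall>\<^sub>F n in sequentially. 1 - bound n \<le> measure (M n) (?E n) \<and> measure (M n) (?E n) \<le> 1"
    using e1 e2 e3 e4 e5 e6 e7 e8 e9 e10 e11 e12 eventually_ge_at_top[of 1]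
  proof eventually_elim
    case (elim n)
    have n: "1 \<le> n" by fact
    interpret R: regular_glm n "p n" "q n" "X n" "b n" "\<beta>0 n" c_lower c_upper c_change a\<^sub>0
      by (rule glm[OF n])
    interpret prob_space "M n" using problem[OF n] by (simp add: glm_problem_def)
    note eqs = lam_def[symmetric] Lam_def[symmetric] rad_def[symmetric]
    have c0: "0 < c n" using elim(12) \<epsilon> by (simp add: c_def)
    have "\<exists>B\<in>sets (M n). prob B \<le> bound n \<and> (\<forall>\<omega>\<in>space (M n) - B.
        R.score_bounded (\<lambda>i. Y n i \<omega>) (\<sigma> n) \<and> R.overfit_bounded (\<lambda>i. Y n i \<omega>) (c n))"
      unfolding bound_def \<sigma>_def
      using R.bad_event[OF problem[OF n] \<tau>0[OF n] _ \<eta> pb(3)[OF n] c0] elim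
      unfolding eqs by simp
    then obtain B where B: "B \<in> sets (M n)" "prob B \<le> bound n" "\<And>\<omega>. \<omega> \<in> space (M n) - B \<Longrightarrow>
        R.score_bounded (\<lambda>i. Y n i \<omega>) (\<sigma> n) \<and> R.overfit_bounded (\<lambda>i. Y n i \<omega>) (c n)"
      by blast
    have sig: "s n \<le> \<bar>\<beta>0 n j\<bar>" if "j \<in> support (\<beta>0 n)" for j
    proof -
      have "s n = Min ((\<lambda>j. \<bar>\<beta>0 n j\<bar>) ` support (\<beta>0 n))"
        using beta_min[OF n] by (simp add: signal_strength_def s_def)
      also have "\<dots> \<le> \<bar>\<beta>0 n j\<bar>" using R.finite_J0 that by (intro Min_le) auto
      finally show ?thesis .
    qed
    have sub: "space (M n) - B \<subseteq> ?E n"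
    proof
      fix \<omega> assume \<omega>: "\<omega> \<in> space (M n) - B"
      have "selects_truth \<gamma> n (p n) (q n) (X n) (b n) (f n) (\<beta>0 n) (\<lambda>i. Y n i \<omega>)"
      proof (rule R.selects_truthI[where \<sigma> = "\<sigma> n" and c = "c n" and s = "s n" and ?F3.0 = F\<^sub>3 and ?F4.0 = F\<^sub>4
            and a_MLE = a_MLE])
        show "R.score_bounded (\<lambda>i. Y n i \<omega>) (\<sigma> n)" "R.overfit_bounded (\<lambda>i. Y n i \<omega>) (c n)"
          using B(3)[OF \<omega>] by auto
        show "0 \<le> s n" by (simp add: s_def)
        show "q n < p n" using elim(5) qb(3)[OF n] by linarith
        show "f n J \<beta> \<le> F\<^sub>3" if "J \<in> submodels (p n) (q n)" "\<beta> \<in> coord_space J" for J \<beta>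
          by (rule prior_upper[OF n that])
        show "F\<^sub>4 \<le> f n J \<beta>" if "J \<in> submodels (p n) (q n)" "\<beta> \<in> coord_space J" "L2_set \<beta> J \<le> a_MLE" for J \<beta>
          by (rule prior_lower[OF n that])
      qed (use elim \<sigma>0[OF n] gamma(1) F_pos sig in \<open>simp_all only: eqs \<delta>_def[symmetric] D_def[symmetric]\<close>)
      then show "\<omega> \<in> ?E n" using \<omega> by simp
    qed
    have E: "?E n \<in> sets (M n)"
      by (rule R.sets_selects_truth[OF glm_problem_measurable[OF problem[OF n]] prior[OF n]])
    have "1 - bound n \<le> prob (space (M n) - B)" using prob_compl[OF B(1)] B(2) by simp
    also have "\<dots> \<le> prob (?E n)" by (rule finite_measure_mono[OF sub E])
    finally show ?case by simp
  qed
  then have lo: "\<forall>\<^sub>F n in sequentially. 1 - bound n \<le> measure (M n) (?E n)"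
    and hi: "\<forall>\<^sub>F n in sequentially. measure (M n) (?E n) \<le> 1" by (auto elim: eventually_mono)
  have "(\<lambda>n. 1 - bound n) \<longlonglongrightarrow> 1" using tendsto_diff[OF tendsto_const bound_lim, of 1] by simp
  from tendsto_sandwich[OF lo hi this tendsto_const]
  show ?thesis .
qed

end
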